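(* Let $r\ge1$. The Hilbert–Poincaré series of the cohomology of $\mathrm{Quot}_2(\mathcal{O}_{\mathbb{A}^\infty}^{\oplus r})$ is, with $q=t^2$, $$\sum_{i\ge0}\mathrm{rk}_{\mathbb{Z}}H^i\big(\mathrm{Quot}_2(\mathcal{O}_{\mathbb{A}^\infty}^{\oplus r}),\mathbb{Z}\big)\,t^i=\frac{1-q^{2r}}{(1-q^2)(1-q)},$$ which is equal to the Hilbert series of the graded ring $\mathbb{Z}[x_1,x_2]/(x_2^r)$ with $x_i$ in degree $2i$ for $i=1,2$.
   Context: The base field is $\mathbb{C}$ and $H^*$ is singular cohomology. $\mathrm{Quot}_2(\mathcal{O}_{\mathbb{A}^n}^{\oplus r})$ is the Quot scheme of points parametrizing equivalence classes of surjections of $\mathbb{C}[x_1,\dots,x_n]$-modules $\mathbb{C}[x_1,\dots,x_n]^{\oplus r}\twoheadrightarrow M$ with $\dim_{\mathbb{C}}M=2$. $\mathrm{Quot}_2(\mathcal{O}_{\mathbb{A}^\infty}^{\oplus r}):=\mathrm{colim}_{n\to\infty}\mathrm{Quot}_2(\mathcal{O}_{\mathbb{A}^n}^{\oplus r})$, the colimit along the closed embeddings sending a quotient $\mathbb{C}[x_1,\dots,x_n]^{\oplus r}\twoheadrightarrow M$ to the composite $\mathbb{C}[x_1,\dots,x_{n+1}]^{\oplus r}\twoheadrightarrow\mathbb{C}[x_1,\dots,x_n]^{\oplus r}\twoheadrightarrow M$ with $x_{n+1}\mapsto0$. *)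

theory Defs
  imports
    "HOL-Homology.Homology"
    "HOL-Algebra.Module"
    "HOL-Algebra.QuotRing"
    "HOL-Analysis.Sum_Topology"
    "HOL-Computational_Algebra.Formal_Power_Series"
    "HOL-Library.Extended_Nat"
    "HOL-Library.Poly_Mapping"
begin

section \<open>Rank and Hilbert series\<close>

definition int_independent :: "('a, 'b) monoid_scheme \<Rightarrow> 'a set \<Rightarrow> bool" where
  "int_independent G S \<longleftrightarrow>
     (\<forall>a :: 'a \<Rightarrow> int. finprod G (\<lambda>x. x [^]\<^bsub>G\<^esub> a x) S = \<one>\<^bsub>G\<^esub> \<longrightarrow> (\<forall>x\<in>S. a x = 0))"

text \<open>The rank of an abelian group as a \<open>\<int>\<close>-module; the value \<open>\<infinity>\<close> means infinite rank.\<close>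

definition abelian_rank :: "('a, 'b) monoid_scheme \<Rightarrow> enat" where
  "abelian_rank G =
     (SUP S \<in> {S. finite S \<and> S \<subseteq> carrier G \<and> int_independent G S}. enat (card S))"

definition finite_type :: "(nat \<Rightarrow> ('a, 'b) monoid_scheme) \<Rightarrow> bool" where
  "finite_type G \<longleftrightarrow> (\<forall>i. abelian_rank (G i) \<noteq> \<infinity>)"

text \<open>\<^const>\<open>the_enat\<close> is only meaningful on finite ranks, so this series is to be used together with
  \<^const>\<open>finite_type\<close>. The coefficients are rational so that division is available.\<close>

definition hilbert_series :: "(nat \<Rightarrow> ('a, 'b) monoid_scheme) \<Rightarrow> rat fps" where
  "hilbert_series G = Abs_fps (\<lambda>i. of_nat (the_enat (abelian_rank (G i))))"


section \<open>Singular cohomology with integer coefficients\<close>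

text \<open>Cochains are homomorphisms from the singular chain group to \<open>\<int>\<close>, made
  \<^const>\<open>extensional\<close> so that equality of cochains is equality of functions.\<close>

definition cochain_group :: "nat \<Rightarrow> 'a topology \<Rightarrow> ('a chain \<Rightarrow> int) monoid" where
  "cochain_group p X =
     \<lparr>carrier = hom (chain_group p X) integer_group \<inter> extensional (carrier (chain_group p X)),
      monoid.mult = (\<lambda>\<phi> \<psi>. \<lambda>c\<in>carrier (chain_group p X). \<phi> c + \<psi> c),
      one = (\<lambda>c\<in>carrier (chain_group p X). 0)\<rparr>"

definition coboundary :: "nat \<Rightarrow> 'a topology \<Rightarrow> ('a chain \<Rightarrow> int) \<Rightarrow> 'a chain \<Rightarrow> int" where
  "coboundary p X \<phi> =
     (\<lambda>c\<in>carrier (chain_group (Suc p) X). \<phi> (chain_boundary (Suc p) c))"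

definition singular_cocycle_set :: "nat \<Rightarrow> 'a topology \<Rightarrow> ('a chain \<Rightarrow> int) set" where
  "singular_cocycle_set p X =
     kernel (cochain_group p X) (cochain_group (Suc p) X) (coboundary p X)"

definition singular_coboundary_set :: "nat \<Rightarrow> 'a topology \<Rightarrow> ('a chain \<Rightarrow> int) set" where
  "singular_coboundary_set p X =
     (case p of 0 \<Rightarrow> {\<one>\<^bsub>cochain_group 0 X\<^esub>}
      | Suc q \<Rightarrow> coboundary q X ` carrier (cochain_group q X))"

definition cohomology_group :: "nat \<Rightarrow> 'a topology \<Rightarrow> ('a chain \<Rightarrow> int) set monoid" where
  "cohomology_group p X =
     subgroup_generated (cochain_group p X) (singular_cocycle_set p X)
       Mod singular_coboundary_set p X"


section \<open>Sequential colimits of topological spaces\<close>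

definition colimit_step ::
    "(nat \<Rightarrow> 'a topology) \<Rightarrow> (nat \<Rightarrow> 'a \<Rightarrow> 'a) \<Rightarrow> nat \<times> 'a \<Rightarrow> nat \<times> 'a \<Rightarrow> bool" where
  "colimit_step X f u v \<longleftrightarrow> snd u \<in> topspace (X (fst u)) \<and> v = (Suc (fst u), f (fst u) (snd u))"

definition colimit_class ::
    "(nat \<Rightarrow> 'a topology) \<Rightarrow> (nat \<Rightarrow> 'a \<Rightarrow> 'a) \<Rightarrow> nat \<times> 'a \<Rightarrow> (nat \<times> 'a) set" where
  "colimit_class X f u = {v. equivclp (colimit_step X f) u v}"

text \<open>The colimit of \<open>X 0 \<rightarrow> X 1 \<rightarrow> \<dots>\<close> along the maps \<open>f n\<close>: the disjoint union modulo the
  equivalence relation generated by \<open>x \<sim> f n x\<close>, with the quotient topology.\<close>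

definition sequential_colimit ::
    "(nat \<Rightarrow> 'a topology) \<Rightarrow> (nat \<Rightarrow> 'a \<Rightarrow> 'a) \<Rightarrow> (nat \<times> 'a) set topology" where
  "sequential_colimit X f = topology (\<lambda>U.
     U \<subseteq> colimit_class X f ` topspace (sum_topology X UNIV) \<and>
     openin (sum_topology X UNIV)
       {u \<in> topspace (sum_topology X UNIV). colimit_class X f u \<in> U})"

lemma openin_sequential_colimit:
  "openin (sequential_colimit X f) U \<longleftrightarrow>
     U \<subseteq> colimit_class X f ` topspace (sum_topology X UNIV) \<and>
     openin (sum_topology X UNIV)
       {u \<in> topspace (sum_topology X UNIV). colimit_class X f u \<in> U}"
proof -
  define Y where "Y = sum_topology X UNIV"
  define q where "q = colimit_class X f"
  have "istopology (\<lambda>U. U \<subseteq> q ` topspace Y \<and> openin Y {u \<in> topspace Y. q u \<in> U})"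
    unfolding istopology_def
  proof (intro conjI allI impI)
    fix S T
    assume S: "S \<subseteq> q ` topspace Y \<and> openin Y {u \<in> topspace Y. q u \<in> S}"
      and T: "T \<subseteq> q ` topspace Y \<and> openin Y {u \<in> topspace Y. q u \<in> T}"
    then show "S \<inter> T \<subseteq> q ` topspace Y" by blast
    have eq: "{u \<in> topspace Y. q u \<in> S \<inter> T} = {u \<in> topspace Y. q u \<in> S} \<inter> {u \<in> topspace Y. q u \<in> T}"
      by blast
    show "openin Y {u \<in> topspace Y. q u \<in> S \<inter> T}"
      unfolding eq by (rule openin_Int) (use S T in blast)+
  next
    fix \<K>
    assume K: "\<forall>K\<in>\<K>. K \<subseteq> q ` topspace Y \<and> openin Y {u \<in> topspace Y. q u \<in> K}"
    then show "\<Union>\<K> \<subseteq> q ` topspace Y" by blast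
    have "{u \<in> topspace Y. q u \<in> \<Union>\<K>} = (\<Union>K\<in>\<K>. {u \<in> topspace Y. q u \<in> K})"
      by blast
    then show "openin Y {u \<in> topspace Y. q u \<in> \<Union>\<K>}" using K by auto
  qed
  then show ?thesis
    by (simp add: sequential_colimit_def Y_def q_def)
qed

lemma topspace_sequential_colimit:
  "topspace (sequential_colimit X f) = colimit_class X f ` topspace (sum_topology X UNIV)"
    (is "_ = ?Q")
proof -
  have eq: "{u \<in> topspace (sum_topology X UNIV). colimit_class X f u \<in> ?Q} = topspace (sum_topology X UNIV)"
    by blast
  have "openin (sequential_colimit X f) ?Q"
    unfolding openin_sequential_colimit eq by (simp del: topspace_sum_topology)
  then show ?thesis
    by (meson openin_sequential_colimit openin_subset openin_topspace subset_antisym)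
qed

lemma quotient_map_sequential_colimit:
  "quotient_map (sum_topology X UNIV) (sequential_colimit X f) (colimit_class X f)"
  unfolding quotient_map_def topspace_sequential_colimit openin_sequential_colimit
  by blast


section \<open>Polynomials and free modules\<close>

type_synonym 'a mpoly = "(nat \<Rightarrow>\<^sub>0 nat) \<Rightarrow>\<^sub>0 'a"

text \<open>The polynomial ring over \<open>'a\<close> in the variables \<open>x\<^sub>i\<close>, \<open>i \<in> V\<close>.\<close>

definition mpoly_ring :: "nat set \<Rightarrow> 'a::comm_ring_1 mpoly ring" where
  "mpoly_ring V =
     \<lparr>carrier = {p. \<forall>m \<in> Poly_Mapping.keys p. Poly_Mapping.keys m \<subseteq> V},
      monoid.mult = (*), one = 1, zero = 0, add = (+)\<rparr>"

definition mvar :: "nat \<Rightarrow> 'a::comm_ring_1 mpoly" where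
  "mvar i = Poly_Mapping.single (Poly_Mapping.single i 1) 1"

definition mconst :: "'a::comm_ring_1 \<Rightarrow> 'a mpoly" where
  "mconst a = Poly_Mapping.single 0 a"

text \<open>The module \<open>\<complex>[x\<^sub>1,\<dots>,x\<^sub>n]\<^sup>r\<close>, a vector being a function supported on
  \<open>{1..r}\<close>. The \<open>mult\<close> and \<open>one\<close> components of a module record are not used.\<close>

definition vec_module :: "nat \<Rightarrow> nat \<Rightarrow> (complex mpoly, nat \<Rightarrow>\<^sub>0 complex mpoly) module" where
  "vec_module n r =
     \<lparr>carrier = {v. Poly_Mapping.keys v \<subseteq> {1..r} \<and>
                    (\<forall>j. Poly_Mapping.lookup v j \<in> carrier (mpoly_ring {1..n}))},
      monoid.mult = undefined, one = undefined, zero = 0, add = (+),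
      smult = (\<lambda>p. Poly_Mapping.map ((*) p))\<rparr>"


section \<open>The Quot scheme of length two quotients\<close>

text \<open>\<open>g \<equiv> a e + b e'\<close> modulo \<open>K\<close>: the class of \<open>g\<close> in \<open>\<complex>[x\<^sub>1,\<dots>,x\<^sub>n]\<^sup>r / K\<close> is the
  linear combination of the classes of \<open>e\<close>, \<open>e'\<close> with coefficients \<open>c = (a, b)\<close>.\<close>

definition quotient_coords ::
    "(nat \<Rightarrow>\<^sub>0 complex mpoly) set \<Rightarrow> (nat \<Rightarrow>\<^sub>0 complex mpoly) \<Rightarrow> (nat \<Rightarrow>\<^sub>0 complex mpoly) \<Rightarrow>
     (nat \<Rightarrow>\<^sub>0 complex mpoly) \<Rightarrow> complex \<times> complex \<Rightarrow> bool" where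
  "quotient_coords K e e' g c \<longleftrightarrow>
     g - (Poly_Mapping.map ((*) (mconst (fst c))) e + Poly_Mapping.map ((*) (mconst (snd c))) e') \<in> K"

text \<open>The classes of \<open>e\<close>, \<open>e'\<close> form a \<open>\<complex>\<close>-basis of \<open>\<complex>[x\<^sub>1,\<dots>,x\<^sub>n]\<^sup>r / K\<close>.\<close>

definition quotient_basis ::
    "nat \<Rightarrow> nat \<Rightarrow> (nat \<Rightarrow>\<^sub>0 complex mpoly) set \<Rightarrow> (nat \<Rightarrow>\<^sub>0 complex mpoly) \<Rightarrow>
     (nat \<Rightarrow>\<^sub>0 complex mpoly) \<Rightarrow> bool" where
  "quotient_basis n r K e e' \<longleftrightarrow>
     e \<in> carrier (vec_module n r) \<and> e' \<in> carrier (vec_module n r) \<and>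
     (\<forall>g \<in> carrier (vec_module n r). \<exists>!c. quotient_coords K e e' g c)"

text \<open>The \<open>\<complex>\<close>-points: an equivalence class of surjections \<open>\<complex>[x\<^sub>1,\<dots>,x\<^sub>n]\<^sup>r \<rightarrow> M\<close> with
  \<open>dim M = 2\<close> is given by its kernel.\<close>

definition Quot2_points :: "nat \<Rightarrow> nat \<Rightarrow> (nat \<Rightarrow>\<^sub>0 complex mpoly) set set" where
  "Quot2_points n r =
     {K. submodule K (mpoly_ring {1..n}) (vec_module n r) \<and> (\<exists>e e'. quotient_basis n r K e e')}"

text \<open>The analytic topology. The Quot scheme is covered by the open affine subschemes
  \<open>U(e, e')\<close> where the classes of \<open>e\<close>, \<open>e'\<close> form a basis of the quotient, and the
  coordinate ring of \<open>U(e, e')\<close> is generated by the coordinates in this basis of the classes of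
  vectors \<open>g\<close>. So a subbasis of open sets is given by the conditions that the coordinates of some \<open>g\<close>
  lie in an open set \<open>W\<close>.\<close>

definition Quot2_subbasic ::
    "nat \<Rightarrow> nat \<Rightarrow> (nat \<Rightarrow>\<^sub>0 complex mpoly) \<Rightarrow> (nat \<Rightarrow>\<^sub>0 complex mpoly) \<Rightarrow>
     (nat \<Rightarrow>\<^sub>0 complex mpoly) \<Rightarrow> (complex \<times> complex) set \<Rightarrow> (nat \<Rightarrow>\<^sub>0 complex mpoly) set set" where
  "Quot2_subbasic n r e e' g W =
     {K \<in> Quot2_points n r. quotient_basis n r K e e' \<and> (\<exists>c\<in>W. quotient_coords K e e' g c)}"

definition Quot2 :: "nat \<Rightarrow> nat \<Rightarrow> (nat \<Rightarrow>\<^sub>0 complex mpoly) set topology" where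
  "Quot2 n r = topology_generated_by
     {Quot2_subbasic n r e e' g W | e e' g W. g \<in> carrier (vec_module n r) \<and> open W}"

text \<open>The ring homomorphism \<open>x\<^sub>i \<mapsto> 0\<close>: it drops all monomials in which \<open>x\<^sub>i\<close> occurs.\<close>

definition set_zero :: "nat \<Rightarrow> complex mpoly \<Rightarrow> complex mpoly" where
  "set_zero i p =
     (\<Sum>m \<in> {m \<in> Poly_Mapping.keys p. Poly_Mapping.lookup m i = 0}.
        Poly_Mapping.single m (Poly_Mapping.lookup p m))"

text \<open>The kernel of \<open>\<complex>[x\<^sub>1,\<dots>,x\<^sub>n\<^sub>+\<^sub>1]\<^sup>r \<rightarrow> \<complex>[x\<^sub>1,\<dots>,x\<^sub>n]\<^sup>r \<rightarrow> M\<close>, where \<open>K\<close> is the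
  kernel of the second map.\<close>

definition Quot2_embed ::
    "nat \<Rightarrow> nat \<Rightarrow> (nat \<Rightarrow>\<^sub>0 complex mpoly) set \<Rightarrow> (nat \<Rightarrow>\<^sub>0 complex mpoly) set" where
  "Quot2_embed r n K =
     {v \<in> carrier (vec_module (Suc n) r). Poly_Mapping.map (set_zero (Suc n)) v \<in> K}"

definition Quot2_infinity :: "nat \<Rightarrow> (nat \<times> (nat \<Rightarrow>\<^sub>0 complex mpoly) set) set topology" where
  "Quot2_infinity r = sequential_colimit (\<lambda>n. Quot2 n r) (Quot2_embed r)"

lemma topspace_Quot2: "topspace (Quot2 n r) = Quot2_points n r"
proof
  show "topspace (Quot2 n r) \<subseteq> Quot2_points n r"
    by (auto simp: Quot2_def Quot2_subbasic_def)
  show "Quot2_points n r \<subseteq> topspace (Quot2 n r)"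
  proof
    fix K assume K: "K \<in> Quot2_points n r"
    then obtain e e' where e: "quotient_basis n r K e e'"
      by (auto simp: Quot2_points_def)
    then have ecar: "e \<in> carrier (vec_module n r)" by (simp add: quotient_basis_def)
    then have "\<exists>!c. quotient_coords K e e' e c"
      using e unfolding quotient_basis_def by (elim conjE) (drule (1) bspec)
    then obtain c where "quotient_coords K e e' e c" by (elim ex1E)
    then have "K \<in> Quot2_subbasic n r e e' e UNIV"
      using K e unfolding Quot2_subbasic_def by blast
    then show "K \<in> topspace (Quot2 n r)"
      using ecar unfolding Quot2_def topology_generated_by_topspace
      by (intro UnionI CollectI exI conjI) (rule refl, assumption, rule open_UNIV, assumption)
  qed
qed


section \<open>The graded ring \<open>\<int>[x\<^sub>1, x\<^sub>2] / (x\<^sub>2\<^sup>r)\<close>\<close>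

definition truncation_ideal :: "nat \<Rightarrow> int mpoly set" where
  "truncation_ideal r = PIdl\<^bsub>mpoly_ring {1, 2}\<^esub> (mvar 2 ^ r)"

definition truncated_ring :: "nat \<Rightarrow> int mpoly set ring" where
  "truncated_ring r = mpoly_ring {1, 2} Quot truncation_ideal r"

text \<open>The variable \<open>x\<^sub>i\<close> has degree \<open>2i\<close>.\<close>

definition homogeneous :: "nat \<Rightarrow> int mpoly set" where
  "homogeneous d =
     {p \<in> carrier (mpoly_ring {1, 2}). \<forall>m \<in> Poly_Mapping.keys p.
        (\<Sum>i \<in> {1, 2}. 2 * i * Poly_Mapping.lookup m i) = d}"

definition truncated_ring_piece :: "nat \<Rightarrow> nat \<Rightarrow> int mpoly set monoid" where
  "truncated_ring_piece r d =
     \<lparr>carrier = (\<lambda>p. truncation_ideal r +>\<^bsub>mpoly_ring {1, 2}\<^esub> p) ` homogeneous d,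
      monoid.mult = add (truncated_ring r), one = zero (truncated_ring r)\<rparr>"

end

theory Submission
  imports Defs "HOL-Analysis.Abstract_Topological_Spaces"
begin

text \<open>
  A point of the colimit is a tuple of vectors \<open>v\<^sub>1, \<dots>, v\<^sub>r\<close> in \<open>\<complex>\<^sup>2\<close> and commuting \<open>2 \<times> 2\<close> matrices
  \<open>X\<^sub>1, X\<^sub>2, \<dots>\<close>, almost all zero, for which the \<open>v\<^sub>k\<close> generate \<open>\<complex>\<^sup>2\<close>, up to change of basis. The space is
  covered by open charts indexed by pivot pairs \<open>(i, J)\<close> with \<open>1 \<le> i \<le> r\<close> and \<open>i < J\<close>: the class of the \<open>i\<close>-th
  unit vector \<open>e\<^sub>i\<close> and that of \<open>e\<^sub>J\<close> (if \<open>J \<le> r\<close>) or of \<open>x\<^sub>a e\<^sub>i\<close> (if \<open>J = r + a\<close>) form a basis. Add the charts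
  one at a time, in the order of \<open>(i + J, i)\<close>. The part of a new chart that is not covered yet is the zero locus of
  \<open>i + J - 3\<close> complex coordinates, and the remaining coordinates can be scaled to zero, so by excision each step
  attaches the relative homology of \<open>(\<complex>\<^sup>c, \<complex>\<^sup>c - 0)\<close> with \<open>c = i + J - 3\<close>. All of this is in even degree;
  hence homology is free with one generator of degree \<open>2 (i + J - 3)\<close> for each pivot pair, and a universal
  coefficient argument gives the ranks in cohomology. Writing \<open>i = b + 1\<close> and \<open>J = a + b + 2\<close> turns the degree into
  \<open>2 a + 4 b\<close> with \<open>b < r\<close>, the degree of the monomial \<open>x\<^sub>1\<^sup>a x\<^sub>2\<^sup>b\<close>.
\<close>

text \<open>The charts need not be manifolds: if \<open>J \<le> r\<close>, the matrices on a chart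
  form an arbitrary commuting tuple, and the variety of such tuples is singular in general. So the
  argument asks of a chart only that it contracts, compatibly with its part already covered, onto a
  copy of C^c. Commutativity survives the scaling for two different reasons. Commuting tuples form a
  cone; and if \<open>J > r\<close>, the class of the i-th unit vector is cyclic for x_a, so every
  matrix is a linear polynomial in the matrix of x_a, whose coefficients may be scaled freely. The
  number c = i + J - 3 counts the entries to the left of the pivots when the pivot columns are
  normalised: two in each of the i - 1 columns before the first pivot, one in each of the J - i - 1
  columns between the pivots. The order of the charts is made for the equivalence that one of these
  entries is nonzero exactly when the point lies in an earlier chart. Maps out of a chart of the
  colimit are built on the finite levels. Homotopies descend as well, because the product of a
  quotient map with the unit interval is again a quotient map.\<close>

section \<open>Ranks of free abelian groups\<close>

text \<open>Fraction-free elimination: a row \<open>x0\<close> with nonzero entry at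
  \<open>s\<close> clears that coordinate in all other rows, and induction gives a relation among
  the cleared rows. It bounds the size of an independent set from above.\<close>

lemma nontrivial_int_relation:
  fixes u :: "'a \<Rightarrow> 'b \<Rightarrow> int"
  assumes "finite S" "finite T" "card S < card T"
  shows "\<exists>a. (\<exists>x\<in>T. a x \<noteq> 0) \<and> (\<forall>s\<in>S. (\<Sum>x\<in>T. a x * u x s) = 0)"
  using assms
proof (induction S arbitrary: T u rule: finite_induct)
  case empty
  then have "T \<noteq> {}" by auto
  then show ?case by (intro exI[of _ "\<lambda>_. 1"]) auto
next
  case (insert s S)
  show ?case
  proof (cases "\<forall>x\<in>T. u x s = 0")
    case True
    have "card S < card T" using insert by simp
    from insert.IH[OF insert.prems(1) this, of u] True show ?thesis by auto
  next
    case False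
    then obtain x0 where x0: "x0 \<in> T" "u x0 s \<noteq> 0" by blast
    define T' where "T' = T - {x0}"
    have T': "finite T'" "card S < card T'" using insert x0 by (auto simp: T'_def)
    have T: "T = insert x0 T'" "x0 \<notin> T'" using x0 by (auto simp: T'_def)
    from insert.IH[OF T', of "\<lambda>x t. u x0 s * u x t - u x s * u x0 t"]
    obtain a' where a': "\<exists>x\<in>T'. a' x \<noteq> 0"
      "\<And>t. t \<in> S \<Longrightarrow> (\<Sum>x\<in>T'. a' x * (u x0 s * u x t - u x s * u x0 t)) = 0" by blast
    \<comment> \<open>The coefficient of \<open>x0\<close> is forced by the coordinate
      \<open>s\<close>. The others carry the nonzero factor \<open>u x0 s\<close>, which keeps the
      relation nontrivial.\<close>
    define a where "a = (\<lambda>x. if x = x0 then - (\<Sum>x\<in>T'. a' x * u x s) else a' x * u x0 s)"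
    have eq: "(\<Sum>x\<in>T. a x * u x t) = (\<Sum>x\<in>T'. a' x * (u x0 s * u x t - u x s * u x0 t))" for t
    proof -
      have "(\<Sum>x\<in>T. a x * u x t) = a x0 * u x0 t + (\<Sum>x\<in>T'. a x * u x t)"
        using T T'(1) by simp
      also have "(\<Sum>x\<in>T'. a x * u x t) = (\<Sum>x\<in>T'. a' x * u x0 s * u x t)"
        using T by (intro sum.cong) (auto simp: a_def)
      finally have "(\<Sum>x\<in>T. a x * u x t) = a x0 * u x0 t + (\<Sum>x\<in>T'. a' x * u x0 s * u x t)" .
      also have "a x0 * u x0 t = - (\<Sum>x\<in>T'. a' x * u x s * u x0 t)"
        by (simp add: a_def sum_distrib_right)
      finally show ?thesis
        by (simp add: sum_subtractf algebra_simps)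
    qed
    show ?thesis
    proof (intro exI[of _ a] conjI ballI)
      from a'(1) obtain x where "x \<in> T'" "a' x \<noteq> 0" by blast
      then show "\<exists>x\<in>T. a x \<noteq> 0" using x0 T by (intro bexI[of _ x]) (auto simp: a_def)
      fix t assume "t \<in> insert s S"
      then show "(\<Sum>x\<in>T. a x * u x t) = 0"
        unfolding eq using a'(2) by (cases "t = s") (auto simp: algebra_simps)
    qed
  qed
qed

lemma hom_free_Abelian_finprod:
  assumes G: "comm_group G" and h: "h \<in> hom G (free_Abelian_group S)"
    and "finite T" "f \<in> T \<rightarrow> carrier G"
  shows "h (finprod G f T) = (\<Sum>x\<in>T. h (f x))"
  using assms(3,4)
proof (induction T rule: finite_induct)
  interpret comm_group G by (rule G)
  interpret H: group_hom G "free_Abelian_group S" h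
    by (simp add: group_hom_def group_hom_axioms_def h group_axioms)
  case empty
  then show ?case using H.hom_one by simp
next
  interpret comm_group G by (rule G)
  interpret H: group_hom G "free_Abelian_group S" h
    by (simp add: group_hom_def group_hom_axioms_def h group_axioms)
  case (insert x T)
  then show ?case
    using H.hom_mult[of "f x" "finprod G f T"] by (simp add: Pi_iff)
qed

lemma hom_free_Abelian_int_pow:
  assumes G: "group G" and h: "h \<in> hom G (free_Abelian_group S)" and x: "x \<in> carrier G"
  shows "h (x [^]\<^bsub>G\<^esub> (k::int)) = frag_cmul k (h x)"
proof -
  interpret H: group_hom G "free_Abelian_group S" h
    by (simp add: group_hom_def group_hom_axioms_def h G)
  have "h x \<in> carrier (free_Abelian_group S)" using x by (rule H.hom_closed)
  then show ?thesis using H.hom_int_pow[OF x, of k]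
    by (simp del: carrier_free_Abelian_group_iff add: carrier_free_Abelian_group_iff[symmetric])
qed

text \<open>\<open>h\<close> turns independence in \<open>G\<close> into independence of integer
  vectors with coordinates in \<open>S\<close>. More than \<open>card S\<close> of these satisfy a
  relation, and preimages of the basis vectors attain the bound.\<close>

lemma abelian_rank_free:
  assumes G: "comm_group G" and h: "h \<in> iso G (free_Abelian_group S)" and S: "finite S"
  shows "abelian_rank G = enat (card S)"
proof -
  interpret comm_group G by (rule G)
  have hom: "h \<in> hom G (free_Abelian_group S)" and bij: "bij_betw h (carrier G) (carrier (free_Abelian_group S))"
    using h by (auto simp: iso_def)
  interpret H: group_hom G "free_Abelian_group S" h
    by (simp add: group_hom_def group_hom_axioms_def hom group_axioms)
  have keys: "Poly_Mapping.keys (h x) \<subseteq> S" if "x \<in> carrier G" for x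
    using H.hom_closed[OF that] by simp
  have ind: "int_independent G T \<longleftrightarrow>
      (\<forall>a. (\<Sum>x\<in>T. frag_cmul (a x) (h x)) = 0 \<longrightarrow> (\<forall>x\<in>T. a x = 0))"
    if T: "finite T" "T \<subseteq> carrier G" for T
  proof -
    have "finprod G (\<lambda>x. x [^]\<^bsub>G\<^esub> a x) T = \<one>\<^bsub>G\<^esub> \<longleftrightarrow> (\<Sum>x\<in>T. frag_cmul (a x) (h x)) = 0" for a :: "_ \<Rightarrow> int"
    proof -
      have Pi: "(\<lambda>x. x [^]\<^bsub>G\<^esub> a x) \<in> T \<rightarrow> carrier G" using T by auto
      have "h (finprod G (\<lambda>x. x [^]\<^bsub>G\<^esub> a x) T) = (\<Sum>x\<in>T. h (x [^]\<^bsub>G\<^esub> a x))"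
        by (rule hom_free_Abelian_finprod[OF G hom T(1) Pi])
      also have "\<dots> = (\<Sum>x\<in>T. frag_cmul (a x) (h x))"
        using T by (intro sum.cong refl hom_free_Abelian_int_pow[OF group_axioms hom]) auto
      finally have 1: "h (finprod G (\<lambda>x. x [^]\<^bsub>G\<^esub> a x) T) = (\<Sum>x\<in>T. frag_cmul (a x) (h x))" .
      have 2: "h \<one>\<^bsub>G\<^esub> = 0" using H.hom_one by simp
      have 3: "finprod G (\<lambda>x. x [^]\<^bsub>G\<^esub> a x) T \<in> carrier G" using Pi by (rule finprod_closed)
      show ?thesis using 1 2 3 bij unfolding bij_betw_def inj_on_def
        by (metis one_closed)
    qed
    then show ?thesis by (simp add: int_independent_def)
  qed
  have upper: "card T \<le> card S" if T: "finite T" "T \<subseteq> carrier G" "int_independent G T" for T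
  proof (rule ccontr)
    assume "\<not> card T \<le> card S"
    then obtain a where a: "\<exists>x\<in>T. a x \<noteq> 0"
      "\<And>s. s \<in> S \<Longrightarrow> (\<Sum>x\<in>T. a x * Poly_Mapping.lookup (h x) s) = 0"
      using nontrivial_int_relation[OF S T(1), of "\<lambda>x. Poly_Mapping.lookup (h x)"] by auto
    have "(\<Sum>x\<in>T. frag_cmul (a x) (h x)) = 0"
    proof (rule poly_mapping_eqI)
      fix s
      show "Poly_Mapping.lookup (\<Sum>x\<in>T. frag_cmul (a x) (h x)) s = Poly_Mapping.lookup 0 s"
      proof (cases "s \<in> S")
        case True
        then show ?thesis using a by (simp add: lookup_sum)
      next
        case False
        then have "Poly_Mapping.lookup (h x) s = 0" if "x \<in> T" for x
          using keys[of x] that T(2) by (meson in_keys_iff subsetD)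
        then show ?thesis by (simp add: lookup_sum)
      qed
    qed
    then show False using ind[OF T(1,2)] T(3) a(1) by blast
  qed
  obtain g where g: "\<And>s. s \<in> S \<Longrightarrow> g s \<in> carrier G \<and> h (g s) = frag_of s"
  proof -
    have "\<exists>x. x \<in> carrier G \<and> h x = frag_of s" if "s \<in> S" for s
      using bij that unfolding bij_betw_def by (metis frag_of_in_free_Abelian_group imageE)
    then show ?thesis using that by metis
  qed
  have inj: "inj_on g S" using g by (metis frag_of_eq inj_onI)
  have gS: "finite (g ` S)" "g ` S \<subseteq> carrier G" using S g by auto
  have "int_independent G (g ` S)"
    unfolding ind[OF gS]
  proof (intro allI impI ballI)
    fix a x assume a: "(\<Sum>x\<in>g ` S. frag_cmul (a x) (h x)) = 0" and "x \<in> g ` S"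
    then obtain s where s: "s \<in> S" "x = g s" by blast
    have "(\<Sum>x\<in>g ` S. frag_cmul (a x) (h x)) = (\<Sum>t\<in>S. frag_cmul (a (g t)) (frag_of t))"
      using inj g by (simp add: sum.reindex)
    then have "0 = (\<Sum>t\<in>S. a (g t) * (if s = t then 1 else 0))"
      using arg_cong[OF a, of "\<lambda>c. Poly_Mapping.lookup c s"] by (simp add: lookup_sum when_def)
    also have "\<dots> = (\<Sum>t\<in>S. if s = t then a (g t) else 0)" by (intro sum.cong) auto
    finally show "a x = 0" using s S by simp
  qed
  moreover have "card (g ` S) = card S" using inj by (rule card_image)
  ultimately have "enat (card S) \<in> (\<lambda>S. enat (card S)) ` {T. finite T \<and> T \<subseteq> carrier G \<and> int_independent G T}"
    using gS by (metis (mono_tags, lifting) image_eqI mem_Collect_eq)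
  then show ?thesis unfolding abelian_rank_def
    by (intro antisym SUP_least Sup_upper) (use upper in auto)
qed

text \<open>The group laws are pulled back along the injection \<open>h\<close>, so a structure
  defined on cosets need not be known to be a group beforehand.\<close>

lemma comm_group_via_free_Abelian:
  assumes "\<And>x y. x \<in> carrier G \<Longrightarrow> y \<in> carrier G \<Longrightarrow> x \<otimes>\<^bsub>G\<^esub> y \<in> carrier G"
    and "\<one>\<^bsub>G\<^esub> \<in> carrier G" and one: "h \<one>\<^bsub>G\<^esub> = 0"
    and "\<And>x y. x \<in> carrier G \<Longrightarrow> y \<in> carrier G \<Longrightarrow> h (x \<otimes>\<^bsub>G\<^esub> y) = h x + h y"
    and "bij_betw h (carrier G) (carrier (free_Abelian_group S))"
  shows "comm_group G" and "h \<in> iso G (free_Abelian_group S)"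
proof -
  have inj: "x = y" if "x \<in> carrier G" "y \<in> carrier G" "h x = h y" for x y
    using assms(5) that by (auto simp: bij_betw_def inj_on_def)
  show "comm_group G"
  proof (rule comm_groupI)
    fix x assume x: "x \<in> carrier G"
    have "- h x \<in> carrier (free_Abelian_group S)"
      using assms(5) x unfolding bij_betw_def by (metis carrier_free_Abelian_group_iff imageI keys_minus)
    then obtain y where "y \<in> carrier G" "h y = - h x"
      using assms(5) unfolding bij_betw_def by (metis imageE)
    then show "\<exists>y\<in>carrier G. y \<otimes>\<^bsub>G\<^esub> x = \<one>\<^bsub>G\<^esub>"
      using x assms one by (intro bexI[of _ y] inj) auto
  qed (use assms one in \<open>auto intro!: inj simp: add.assoc add.commute\<close>)
  show "h \<in> iso G (free_Abelian_group S)"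
    using assms by (auto simp: iso_def hom_def bij_betw_def)
qed

section \<open>The graded ring\<close>

lemma poly_mapping_sum_singles:
  "(\<Sum>m\<in>Poly_Mapping.keys p. Poly_Mapping.single m (Poly_Mapping.lookup p m)) = p"
  by (rule poly_mapping_eqI) (simp add: lookup_sum lookup_single when_def in_keys_iff)

lemma mvar_power: "mvar i ^ k = Poly_Mapping.single (Poly_Mapping.single i k) 1"
  by (induction k) (simp_all add: mvar_def mult_single single_add[symmetric])

text \<open>A principal ideal generated by a monomial is a monomial ideal, so membership is read off
  exponent by exponent.\<close>

lemma truncation_ideal_eq:
  "truncation_ideal r = {p \<in> carrier (mpoly_ring {1, 2}). \<forall>m\<in>Poly_Mapping.keys p. r \<le> Poly_Mapping.lookup m 2}"
    (is "_ = ?I")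
proof
  let ?m = "Poly_Mapping.single (2::nat) r"
  have eq: "truncation_ideal r = {q * Poly_Mapping.single ?m 1 | q. q \<in> carrier (mpoly_ring {1, 2})}"
    unfolding truncation_ideal_def cgenideal_def mvar_power by (auto simp: mpoly_ring_def)
  show "truncation_ideal r \<subseteq> ?I"
  proof
    fix p assume "p \<in> truncation_ideal r"
    then obtain q where q: "p = q * Poly_Mapping.single ?m (1::int)" "q \<in> carrier (mpoly_ring {1, 2})"
      unfolding eq by blast
    have "\<exists>m'\<in>Poly_Mapping.keys q. m = m' + ?m" if "m \<in> Poly_Mapping.keys p" for m
      using keys_mult[of q "Poly_Mapping.single ?m (1::int)"] that q by auto
    moreover have "Poly_Mapping.keys (m' + ?m) \<subseteq> {1, 2}" if "m' \<in> Poly_Mapping.keys q" for m'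
      using Poly_Mapping.keys_add[of m' ?m] q that by (fastforce simp: mpoly_ring_def split: if_splits)
    ultimately show "p \<in> ?I" by (fastforce simp: mpoly_ring_def lookup_add)
  qed
  show "?I \<subseteq> truncation_ideal r"
  proof
    fix p assume p: "p \<in> ?I"
    \<comment> \<open>The quotient by x2^r, formed monomial by monomial. Subtraction of exponents is
      truncated, but every exponent of x2 is at least \<open>r\<close> here.\<close>
    define q where "q = (\<Sum>m\<in>Poly_Mapping.keys p. Poly_Mapping.single (m - ?m) (Poly_Mapping.lookup p m))"
    have "m - ?m + ?m = m" if "m \<in> Poly_Mapping.keys p" for m
      using p that by (intro poly_mapping_eqI) (auto simp: lookup_add lookup_minus lookup_single when_def)
    then have "q * Poly_Mapping.single ?m 1 = (\<Sum>m\<in>Poly_Mapping.keys p. Poly_Mapping.single m (Poly_Mapping.lookup p m))"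
      unfolding q_def sum_distrib_right by (intro sum.cong) (auto simp: mult_single)
    then have 1: "p = q * Poly_Mapping.single ?m 1" by (simp add: poly_mapping_sum_singles)
    have "Poly_Mapping.keys (m - ?m) \<subseteq> {1, 2}" if "m \<in> Poly_Mapping.keys p" for m
    proof -
      have "Poly_Mapping.keys (m - ?m) \<subseteq> Poly_Mapping.keys m"
        by (auto simp: in_keys_iff lookup_minus)
      then show ?thesis using p that by (auto simp: mpoly_ring_def)
    qed
    then have "q \<in> carrier (mpoly_ring {1, 2})"
      using keys_sum[of "\<lambda>m. Poly_Mapping.single (m - ?m) (Poly_Mapping.lookup p m)" "Poly_Mapping.keys p"]
      unfolding q_def mpoly_ring_def by (fastforce split: if_splits)
    with 1 show "p \<in> truncation_ideal r" unfolding eq by blast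
  qed
qed

text \<open>Exponents of the monomials x1^a x2^b of degree \<open>d\<close> that survive modulo
  x2^r.\<close>

definition weight_set :: "nat \<Rightarrow> nat \<Rightarrow> (nat \<times> nat) set" where
  "weight_set r d = {(a, b). b < r \<and> 2 * a + 4 * b = d}"

lemma finite_weight_set [simp]: "finite (weight_set r d)"
  by (rule finite_subset[of _ "{..d} \<times> {..d}"]) (auto simp: weight_set_def)

text \<open>The surviving monomials form a basis of the graded piece: \<open>\<phi>\<close> reads
  off their coefficients, and on homogeneous elements it forgets exactly the ideal.\<close>

lemma abelian_rank_truncated_ring_piece:
  "abelian_rank (truncated_ring_piece r d) = enat (card (weight_set r d))"
proof -
  let ?R = "mpoly_ring {1, 2} :: int mpoly ring" and ?I = "truncation_ideal r"
  let ?G = "truncated_ring_piece r d" and ?W = "weight_set r d"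
  define mon where "mon = (\<lambda>(a, b). Poly_Mapping.single (1::nat) (a::nat) + Poly_Mapping.single 2 b)"
  define \<phi> where "\<phi> p = (\<Sum>w\<in>?W. frag_cmul (Poly_Mapping.lookup p (mon w)) (frag_of w))" for p :: "int mpoly"
  have lookup_phi: "Poly_Mapping.lookup (\<phi> p) w = (if w \<in> ?W then Poly_Mapping.lookup p (mon w) else 0)" for p w
    by (simp add: \<phi>_def lookup_sum when_def if_distrib cong: if_cong)
  have mon_lookup: "Poly_Mapping.lookup (mon (a, b)) i = (if i = 1 then a else if i = 2 then b else 0)" for a b i
    by (simp add: mon_def lookup_add lookup_single when_def)
  have keys_mon: "m = mon (Poly_Mapping.lookup m 1, Poly_Mapping.lookup m 2)" if "Poly_Mapping.keys m \<subseteq> {1, 2}" for m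
    using that by (intro poly_mapping_eqI) (auto simp: mon_lookup in_keys_iff subset_iff)
  have hom_add: "p + q \<in> homogeneous d" if "p \<in> homogeneous d" "q \<in> homogeneous d" for p q
    using that Poly_Mapping.keys_add[of p q] unfolding homogeneous_def mpoly_ring_def by fastforce
  have hom0: "0 \<in> homogeneous d" by (simp add: homogeneous_def mpoly_ring_def)
  have I0: "0 \<in> ?I" by (simp add: truncation_ideal_eq mpoly_ring_def)
  have I_add: "p + q \<in> ?I" if "p \<in> ?I" "q \<in> ?I" for p q
    using that Poly_Mapping.keys_add[of p q] unfolding truncation_ideal_eq mpoly_ring_def by fastforce
  have I_diff: "p - q \<in> ?I" if "p \<in> ?I" "q \<in> ?I" for p q
    using that keys_diff[of p q] unfolding truncation_ideal_eq mpoly_ring_def by fastforce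
  have coset: "?I +>\<^bsub>?R\<^esub> p = (\<lambda>h. h + p) ` ?I" for p
    by (auto simp: a_r_coset_def r_coset_def mpoly_ring_def)
  have coset_eq: "?I +>\<^bsub>?R\<^esub> p = ?I +>\<^bsub>?R\<^esub> q \<longleftrightarrow> p - q \<in> ?I" for p q
  proof
    assume "?I +>\<^bsub>?R\<^esub> p = ?I +>\<^bsub>?R\<^esub> q"
    moreover have "p \<in> ?I +>\<^bsub>?R\<^esub> p" unfolding coset using I0 by (intro image_eqI[of _ _ 0]) auto
    ultimately show "p - q \<in> ?I" unfolding coset by auto
  next
    assume pq: "p - q \<in> ?I"
    show "?I +>\<^bsub>?R\<^esub> p = ?I +>\<^bsub>?R\<^esub> q"
      unfolding coset
    proof safe
      fix h assume "h \<in> ?I"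
      then show "h + p \<in> (\<lambda>h. h + q) ` ?I" using I_add[OF _ pq]
        by (intro image_eqI[of _ _ "h + (p - q)"]) auto
      show "h + q \<in> (\<lambda>h. h + p) ` ?I" using I_diff[OF \<open>h \<in> ?I\<close> pq]
        by (intro image_eqI[of _ _ "h - (p - q)"]) auto
    qed
  qed
  have phi_eq: "\<phi> p = \<phi> q \<longleftrightarrow> p - q \<in> ?I" if pq: "p \<in> homogeneous d" "q \<in> homogeneous d" for p q
  proof
    assume eq: "\<phi> p = \<phi> q"
    show "p - q \<in> ?I" unfolding truncation_ideal_eq
    proof (intro CollectI conjI ballI)
      show "p - q \<in> carrier ?R" using pq keys_diff[of p q] by (fastforce simp: homogeneous_def mpoly_ring_def)
      fix m assume m: "m \<in> Poly_Mapping.keys (p - q)"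
      then have "m \<in> Poly_Mapping.keys p \<or> m \<in> Poly_Mapping.keys q" using keys_diff[of p q] by blast
      then have m': "Poly_Mapping.keys m \<subseteq> {1, 2}" "2 * Poly_Mapping.lookup m 1 + 4 * Poly_Mapping.lookup m 2 = d"
        using pq by (auto simp: homogeneous_def mpoly_ring_def)
      show "r \<le> Poly_Mapping.lookup m 2"
      proof (rule ccontr)
        let ?w = "(Poly_Mapping.lookup m 1, Poly_Mapping.lookup m 2)"
        assume "\<not> ?thesis"
        then have "?w \<in> ?W" using m' by (simp add: weight_set_def)
        then have "Poly_Mapping.lookup p m = Poly_Mapping.lookup q m"
          using arg_cong[OF eq, of "\<lambda>c. Poly_Mapping.lookup c ?w"] keys_mon[OF m'(1)] lookup_phi by simp
        then show False using m by (simp add: in_keys_iff lookup_minus)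
      qed
    qed
  next
    assume pq: "p - q \<in> ?I"
    show "\<phi> p = \<phi> q"
    proof (rule poly_mapping_eqI)
      fix w :: "nat \<times> nat"
      obtain a b where w: "w = (a, b)" by force
      have "Poly_Mapping.lookup p (mon w) = Poly_Mapping.lookup q (mon w)" if "w \<in> ?W"
      proof (rule ccontr)
        assume "\<not> ?thesis"
        then have "mon w \<in> Poly_Mapping.keys (p - q)" by (simp add: in_keys_iff lookup_minus)
        then have "r \<le> Poly_Mapping.lookup (mon w) 2" using pq by (simp add: truncation_ideal_eq)
        then show False using that w by (simp add: mon_lookup weight_set_def)
      qed
      then show "Poly_Mapping.lookup (\<phi> p) w = Poly_Mapping.lookup (\<phi> q) w" by (simp add: lookup_phi)
    qed
  qed
  have phi_surj: "\<exists>p\<in>homogeneous d. \<phi> p = c" if "Poly_Mapping.keys c \<subseteq> ?W" for c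
  proof -
    define p where "p = (\<Sum>w\<in>Poly_Mapping.keys c. Poly_Mapping.single (mon w) (Poly_Mapping.lookup c w))"
    have inj: "mon w = mon w' \<longleftrightarrow> w = w'" for w w'
    proof
      assume "mon w = mon w'"
      then have "Poly_Mapping.lookup (mon w) i = Poly_Mapping.lookup (mon w') i" for i by simp
      from this[of 1] this[of 2] show "w = w'" by (cases w; cases w') (simp add: mon_lookup)
    qed simp
    have "Poly_Mapping.lookup p (mon w) = Poly_Mapping.lookup c w" for w :: "nat \<times> nat"
      by (simp add: p_def lookup_sum lookup_single when_def inj in_keys_iff)
    then have "\<phi> p = c"
      using that by (intro poly_mapping_eqI) (auto simp: lookup_phi in_keys_iff)
    moreover have "p \<in> homogeneous d"
    proof -
      have keysp: "\<exists>w\<in>?W. m = mon w" if m: "m \<in> Poly_Mapping.keys p" for m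
      proof -
        obtain w where w: "w \<in> Poly_Mapping.keys c" "m \<in> Poly_Mapping.keys (Poly_Mapping.single (mon w) (Poly_Mapping.lookup c w))"
          using keys_sum[of "\<lambda>w. Poly_Mapping.single (mon w) (Poly_Mapping.lookup c w)" "Poly_Mapping.keys c"] m
          unfolding p_def by blast
        then have "m = mon w" by (simp split: if_splits)
        then show ?thesis using w(1) \<open>Poly_Mapping.keys c \<subseteq> ?W\<close> by blast
      qed
      have k: "Poly_Mapping.keys (mon w) \<subseteq> {1, 2}" for w :: "nat \<times> nat"
        by (cases w) (auto simp: in_keys_iff mon_lookup split: if_splits)
      have wt: "(\<Sum>i \<in> {1, 2}. 2 * i * Poly_Mapping.lookup (mon w) i) = d" if "w \<in> ?W" for w
        using that by (cases w) (simp add: mon_lookup weight_set_def)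
      show ?thesis unfolding homogeneous_def mpoly_ring_def
      proof (intro CollectI conjI ballI)
        show "p \<in> carrier \<lparr>carrier = {p. \<forall>m\<in>Poly_Mapping.keys p. Poly_Mapping.keys m \<subseteq> {1, 2}},
          monoid.mult = (*), one = 1, zero = 0, add = (+)\<rparr>" using keysp k by (auto dest!: keysp)
        fix m assume "m \<in> Poly_Mapping.keys p"
        then obtain w where w: "w \<in> ?W" "m = mon w" using keysp by blast
        show "(\<Sum>i \<in> {1, 2}. 2 * i * Poly_Mapping.lookup m i) = d" unfolding w(2) by (rule wt[OF w(1)])
      qed
    qed
    ultimately show ?thesis by blast
  qed
  have phi_add: "\<phi> (p + q) = \<phi> p + \<phi> q" for p q
    by (rule poly_mapping_eqI) (simp add: lookup_phi lookup_add)
  have phi_keys: "Poly_Mapping.keys (\<phi> p) \<subseteq> ?W" for p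
    by (auto simp: in_keys_iff lookup_phi split: if_splits)
  \<comment> \<open>The value on a coset is taken at a chosen homogeneous representative;
    \<open>phi_eq\<close> makes it independent of the choice.\<close>
  define h where "h C = \<phi> (SOME p. p \<in> homogeneous d \<and> C = ?I +>\<^bsub>?R\<^esub> p)" for C
  have h: "h (?I +>\<^bsub>?R\<^esub> p) = \<phi> p" if p: "p \<in> homogeneous d" for p
  proof -
    let ?q = "SOME q. q \<in> homogeneous d \<and> ?I +>\<^bsub>?R\<^esub> p = ?I +>\<^bsub>?R\<^esub> q"
    have "?q \<in> homogeneous d \<and> ?I +>\<^bsub>?R\<^esub> p = ?I +>\<^bsub>?R\<^esub> ?q" by (rule someI[of _ p]) (use p in auto)
    then have q: "?q \<in> homogeneous d" "p - ?q \<in> ?I" unfolding coset_eq by auto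
    then have "\<phi> p = \<phi> ?q" using phi_eq[OF p q(1)] by simp
    then show ?thesis unfolding h_def by simp
  qed
  have carr: "carrier ?G = (\<lambda>p. ?I +>\<^bsub>?R\<^esub> p) ` homogeneous d" by (simp add: truncated_ring_piece_def)
  have mult: "(?I +>\<^bsub>?R\<^esub> p) \<otimes>\<^bsub>?G\<^esub> (?I +>\<^bsub>?R\<^esub> q) = ?I +>\<^bsub>?R\<^esub> (p + q)" for p q
  proof -
    have "(?I +>\<^bsub>?R\<^esub> p) \<otimes>\<^bsub>?G\<^esub> (?I +>\<^bsub>?R\<^esub> q) = {x + y | x y. x \<in> ?I +>\<^bsub>?R\<^esub> p \<and> y \<in> ?I +>\<^bsub>?R\<^esub> q}"
      unfolding truncated_ring_piece_def truncated_ring_def FactRing_def set_add_def set_mult_def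
      by (simp add: mpoly_ring_def) blast
    also have "\<dots> = ?I +>\<^bsub>?R\<^esub> (p + q)"
      unfolding coset
    proof safe
      fix h h' assume "h \<in> ?I" "h' \<in> ?I"
      then show "h + p + (h' + q) \<in> (\<lambda>h. h + (p + q)) ` ?I"
        using I_add by (intro image_eqI[of _ _ "h + h'"]) (auto simp: algebra_simps)
    next
      fix h assume "h \<in> ?I"
      then show "\<exists>x y. h + (p + q) = x + y \<and> x \<in> (\<lambda>h. h + p) ` ?I \<and> y \<in> (\<lambda>h. h + q) ` ?I"
        using I0 by (intro exI[of _ "h + p"] exI[of _ "0 + q"]) (auto simp: algebra_simps)
    qed
    finally show ?thesis .
  qed
  have one: "\<one>\<^bsub>?G\<^esub> = ?I +>\<^bsub>?R\<^esub> 0"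
    unfolding coset by (simp add: truncated_ring_piece_def truncated_ring_def FactRing_def)
  have bij: "bij_betw h (carrier ?G) (carrier (free_Abelian_group ?W))"
    unfolding bij_betw_def
  proof
    show "inj_on h (carrier ?G)"
      unfolding carr
    proof (rule inj_onI)
      fix x y assume "x \<in> (\<lambda>p. ?I +>\<^bsub>?R\<^esub> p) ` homogeneous d" "y \<in> (\<lambda>p. ?I +>\<^bsub>?R\<^esub> p) ` homogeneous d"
        and hxy: "h x = h y"
      then obtain p q where p: "p \<in> homogeneous d" "x = ?I +>\<^bsub>?R\<^esub> p" and q: "q \<in> homogeneous d" "y = ?I +>\<^bsub>?R\<^esub> q"
        by blast
      show "x = y" unfolding p q coset_eq using hxy phi_eq[OF p(1) q(1)] unfolding p(2) q(2) h[OF p(1)] h[OF q(1)] by simp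
    qed
    have "h ` carrier ?G = \<phi> ` homogeneous d"
      unfolding carr image_image by (rule image_cong[OF refl h])
    also have "\<dots> = carrier (free_Abelian_group ?W)"
      unfolding free_Abelian_group_def using phi_surj phi_keys by (auto simp: image_def)
    finally show "h ` carrier ?G = carrier (free_Abelian_group ?W)" .
  qed
  have closed: "x \<otimes>\<^bsub>?G\<^esub> y \<in> carrier ?G \<and> h (x \<otimes>\<^bsub>?G\<^esub> y) = h x + h y"
    if x: "x \<in> carrier ?G" and y: "y \<in> carrier ?G" for x y
  proof -
    obtain p q where p: "p \<in> homogeneous d" "x = ?I +>\<^bsub>?R\<^esub> p" and q: "q \<in> homogeneous d" "y = ?I +>\<^bsub>?R\<^esub> q"
      using x y unfolding carr by blast
    have "x \<otimes>\<^bsub>?G\<^esub> y = ?I +>\<^bsub>?R\<^esub> (p + q)" unfolding p q by (rule mult)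
    then show ?thesis
      unfolding carr p(2) q(2) h[OF p(1)] h[OF q(1)] using h[OF hom_add[OF p(1) q(1)]] hom_add[OF p(1) q(1)] phi_add
      by simp
  qed
  have one': "\<one>\<^bsub>?G\<^esub> \<in> carrier ?G" "h \<one>\<^bsub>?G\<^esub> = 0"
    unfolding one carr h[OF hom0] using hom0 phi_add[of 0 0] by auto
  note conclude = comm_group_via_free_Abelian[of ?G h ?W, OF _ one' _ bij]
  have "comm_group ?G" by (rule conclude(1)) (use closed in blast)+
  moreover have "h \<in> iso ?G (free_Abelian_group ?W)" by (rule conclude(2)) (use closed in blast)+
  ultimately show ?thesis by (rule abelian_rank_free) simp
qed

section \<open>Cohomology from homology\<close>

text \<open>One identity expresses Z-linearity, in the same shape in which
  \<open>chain_closed\<close> expresses being a subgroup: the combination x - k y covers sums,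
  multiples and inverses at once.\<close>

definition chain_linear :: "('a \<Rightarrow>\<^sub>0 int) set \<Rightarrow> (('a \<Rightarrow>\<^sub>0 int) \<Rightarrow> int) \<Rightarrow> bool" where
  "chain_linear A f \<longleftrightarrow> (\<forall>x\<in>A. \<forall>y\<in>A. \<forall>k. f (x - frag_cmul k y) = f x - k * f y)"

definition chain_closed :: "('a \<Rightarrow>\<^sub>0 int) set \<Rightarrow> bool" where
  "chain_closed A \<longleftrightarrow> 0 \<in> A \<and> (\<forall>x\<in>A. \<forall>y\<in>A. \<forall>k. x - frag_cmul k y \<in> A)"

lemma chain_closed_cmul: "chain_closed A \<Longrightarrow> x \<in> A \<Longrightarrow> frag_cmul k x \<in> A"
  unfolding chain_closed_def by (metis diff_0 frag_cmul_cmul minus_frag_cmul mult_minus1_right minus_minus)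

lemma chain_linear_0: "chain_closed A \<Longrightarrow> chain_linear A f \<Longrightarrow> f 0 = 0"
  unfolding chain_closed_def chain_linear_def
  by (metis add_diff_cancel_left' diff_self diff_zero frag_cmul_one mult_1)

lemma chain_linear_add: "chain_closed A \<Longrightarrow> chain_linear A f \<Longrightarrow> x \<in> A \<Longrightarrow> y \<in> A \<Longrightarrow> f (x + y) = f x + f y"
proof -
  assume A: "chain_closed A" "chain_linear A f" "x \<in> A" "y \<in> A"
  have "f (x - frag_cmul (- 1) y) = f x - (- 1) * f y"
    using A(2-4) unfolding chain_linear_def by blast
  then show ?thesis by simp
qed

lemma chain_linearI:
  assumes A: "chain_closed A" and add: "\<And>x y. x \<in> A \<Longrightarrow> y \<in> A \<Longrightarrow> f (x + y) = f x + f y"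
  shows "chain_linear A f"
proof -
  have f0: "f 0 = 0" using add[of 0 0] A by (simp add: chain_closed_def)
  have neg: "f (- x) = - f x" if "x \<in> A" for x
    using add[of x "- x"] chain_closed_cmul[OF A that, of "-1"] that f0 by simp
  have cmul_nat: "f (frag_cmul (int n) x) = int n * f x" if x: "x \<in> A" for x n
  proof (induction n)
    case (Suc n)
    have "f (frag_cmul (int n) x + x) = f (frag_cmul (int n) x) + f x"
      by (rule add) (use x chain_closed_cmul[OF A] in auto)
    then show ?case using Suc by (simp add: frag_cmul_distrib algebra_simps)
  qed (simp add: f0)
  have cmul: "f (frag_cmul k x) = k * f x" if x: "x \<in> A" for x k
  proof (cases k)
    case (nonneg n) then show ?thesis using cmul_nat[OF x] by simp
  next
    case k: (neg n)
    have "frag_cmul k x = - frag_cmul (int (Suc n)) x" using k by simp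
    also have "f (- frag_cmul (int (Suc n)) x) = - f (frag_cmul (int (Suc n)) x)" by (rule neg[OF chain_closed_cmul[OF A x]])
    also have "\<dots> = k * f x" unfolding cmul_nat[OF x] k by (simp add: algebra_simps)
    finally show ?thesis .
  qed
  show ?thesis unfolding chain_linear_def
  proof (intro ballI allI)
    fix x y k assume x: "x \<in> A" and y: "y \<in> A"
    have "x - frag_cmul k y = x + frag_cmul (- k) y"
      by (simp only: diff_conv_add_uminus minus_frag_cmul)
    also have "f \<dots> = f x + f (frag_cmul (- k) y)" by (rule add[OF x chain_closed_cmul[OF A y]])
    also have "\<dots> = f x - k * f y" using cmul[OF y] by simp
    finally show "f (x - frag_cmul k y) = f x - k * f y" .
  qed
qed

lemma diff_cmul_minus: "x - frag_cmul (- k) y = x + frag_cmul k y"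
  by (metis diff_minus_eq_add minus_frag_cmul)

text \<open>An image of \<open>d\<close> lies in a free abelian group and is therefore free, so the kernel of \<open>d\<close> is a
  direct summand. The proof extends the functional one basis element of the target at a time.\<close>

lemma chain_linear_extend_from_kernel:
  fixes d :: "('a \<Rightarrow>\<^sub>0 int) \<Rightarrow> ('b \<Rightarrow>\<^sub>0 int)"
  assumes A: "chain_closed A"
    and d: "\<And>x y k. x \<in> A \<Longrightarrow> y \<in> A \<Longrightarrow> d (x - frag_cmul k y) = d x - frag_cmul k (d y)"
    and f: "chain_linear {x \<in> A. d x = 0} f"
  shows "\<exists>g. chain_linear A g \<and> (\<forall>x\<in>A. d x = 0 \<longrightarrow> g x = f x)"
proof -
  define D where "D J = {x \<in> A. Poly_Mapping.keys (d x) \<subseteq> J}" for J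
  \<comment> \<open>A partial functional, defined on the part \<open>D J\<close> of \<open>A\<close>
    whose image under \<open>d\<close> is supported in \<open>J\<close>. It is stored as its graph,
    so that the union over a chain is again of this form.\<close>
  define good where "good J G \<longleftrightarrow> Domain G = D J \<and> single_valued G
      \<and> (\<forall>x m y n k. (x, m) \<in> G \<longrightarrow> (y, n) \<in> G \<longrightarrow> (x - frag_cmul k y, m - k * n) \<in> G)
      \<and> (\<forall>x\<in>A. d x = 0 \<longrightarrow> (x, f x) \<in> G)" for J and G :: "(('a \<Rightarrow>\<^sub>0 int) \<times> int) set"
  \<comment> \<open>The tags pack \<open>J\<close> and the graph into one set, so that Zorn's lemma
    for inclusion handles both together.\<close>
  define \<A> where "\<A> = {Inl ` J \<union> Inr ` G | J G. good J G}"
  have D_diff: "x - frag_cmul k y \<in> D J" if "x \<in> D J" "y \<in> D J" for x y k J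
    using that A d[of x y k] keys_diff[of "d x" "frag_cmul k (d y)"] keys_cmul[of k "d y"]
    unfolding D_def chain_closed_def by auto
  have "\<exists>M\<in>\<A>. \<forall>X\<in>\<A>. M \<subseteq> X \<longrightarrow> X = M"
  proof (rule subset_Zorn_nonempty)
    have "good {} {(x, f x) | x. x \<in> A \<and> d x = 0}"
      unfolding good_def
    proof (intro conjI allI impI)
      fix x m y n k
      assume "(x, m) \<in> {(x, f x) | x. x \<in> A \<and> d x = 0}" "(y, n) \<in> {(x, f x) | x. x \<in> A \<and> d x = 0}"
      then have xy: "x \<in> A" "y \<in> A" "d x = 0" "d y = 0" "m = f x" "n = f y" by auto
      then show "(x - frag_cmul k y, m - k * n) \<in> {(x, f x) | x. x \<in> A \<and> d x = 0}"
        using A f d[of x y k] unfolding chain_closed_def chain_linear_def by auto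
    qed (auto simp: D_def single_valued_def)
    then show "\<A> \<noteq> {}" unfolding \<A>_def by blast
  next
    fix \<C> assume ne: "\<C> \<noteq> {}" and chain: "subset.chain \<A> \<C>"
    define J where "J = Inl -` \<Union>\<C>"
    define G where "G = Inr -` \<Union>\<C>"
    have good_part: "good (Inl -` M) (Inr -` M)" if "M \<in> \<C>" for M
    proof -
      have "M \<in> \<A>" using that chain by (auto simp: subset.chain_def)
      then obtain J' G' where "M = Inl ` J' \<union> Inr ` G'" "good J' G'" by (auto simp: \<A>_def)
      moreover from this have "Inl -` M = J'" "Inr -` M = G'" by auto
      ultimately show ?thesis by simp
    qed
    have common: "\<exists>M\<in>\<C>. S \<subseteq> M" if "finite S" "S \<subseteq> \<Union>\<C>" for S
      using finite_subset_Union_chain[OF that ne] chain by blast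
    have "good J G" unfolding good_def
    proof (intro conjI allI impI ballI)
      show "Domain G = D J"
      proof
        show "Domain G \<subseteq> D J"
        proof
          fix x assume "x \<in> Domain G"
          then obtain m M where M: "M \<in> \<C>" "(x, m) \<in> Inr -` M" by (auto simp: G_def)
          then have "x \<in> D (Inl -` M)" using good_part[OF M(1)] by (auto simp: good_def)
          then show "x \<in> D J" using M unfolding D_def J_def by blast
        qed
        show "D J \<subseteq> Domain G"
        proof
          fix x assume x: "x \<in> D J"
          obtain M where M: "M \<in> \<C>" "Inl ` Poly_Mapping.keys (d x) \<subseteq> M"
          proof -
            have "Inl ` Poly_Mapping.keys (d x) \<subseteq> \<Union>\<C>" using x by (auto simp: D_def J_def)
            then obtain M where "M \<in> \<C>" "Inl ` Poly_Mapping.keys (d x) \<subseteq> M" using common[of "Inl ` Poly_Mapping.keys (d x)"] by auto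
            then show ?thesis by (rule that)
          qed
          then have "x \<in> D (Inl -` M)" using x by (auto simp: D_def)
          then have "x \<in> Domain (Inr -` M)" using good_part[OF M(1)] by (simp add: good_def)
          then show "x \<in> Domain G" using M by (auto simp: G_def)
        qed
      qed
      show "single_valued G"
      proof (rule single_valuedI)
        fix x m n assume "(x, m) \<in> G" "(x, n) \<in> G"
        then obtain M where M: "M \<in> \<C>" "{Inr (x, m), Inr (x, n)} \<subseteq> M"
          using common[of "{Inr (x, m), Inr (x, n)}"] by (auto simp: G_def)
        then show "m = n" using good_part[OF M(1)] by (auto simp: good_def single_valued_def)
      qed
    next
      fix x m y n k assume "(x, m) \<in> G" "(y, n) \<in> G"
      then obtain M where M: "M \<in> \<C>" "{Inr (x, m), Inr (y, n)} \<subseteq> M"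
        using common[of "{Inr (x, m), Inr (y, n)}"] by (auto simp: G_def)
      then have "(x - frag_cmul k y, m - k * n) \<in> Inr -` M"
        using good_part[OF M(1)] by (simp add: good_def)
      then show "(x - frag_cmul k y, m - k * n) \<in> G" using M by (auto simp: G_def)
    next
      fix x assume "x \<in> A" "d x = 0"
      obtain M where "M \<in> \<C>" using ne by blast
      then show "(x, f x) \<in> G" using good_part[OF \<open>M \<in> \<C>\<close>] \<open>x \<in> A\<close> \<open>d x = 0\<close>
        by (auto simp: good_def G_def)
    qed
    moreover have "\<Union>\<C> = Inl ` J \<union> Inr ` G"
    proof (rule Set.set_eqI)
      fix z show "z \<in> \<Union>\<C> \<longleftrightarrow> z \<in> Inl ` J \<union> Inr ` G" by (cases z) (auto simp: J_def G_def)
    qed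
    ultimately show "\<Union>\<C> \<in> \<A>" unfolding \<A>_def by blast
  qed
  then obtain J G where G: "good J G" and max: "\<And>J' G'. good J' G' \<Longrightarrow> J \<subseteq> J' \<Longrightarrow> G \<subseteq> G' \<Longrightarrow> J' = J"
  proof -
    assume *: "\<And>J G. good J G \<Longrightarrow> (\<And>J' G'. good J' G' \<Longrightarrow> J \<subseteq> J' \<Longrightarrow> G \<subseteq> G' \<Longrightarrow> J' = J) \<Longrightarrow> thesis"
    assume "\<exists>M\<in>\<A>. \<forall>X\<in>\<A>. M \<subseteq> X \<longrightarrow> X = M"
    then obtain M where M: "M \<in> \<A>" "\<And>X. X \<in> \<A> \<Longrightarrow> M \<subseteq> X \<Longrightarrow> X = M" by blast
    then obtain J G where JG: "M = Inl ` J \<union> Inr ` G" "good J G" by (auto simp: \<A>_def)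
    show thesis
    proof (rule *[OF JG(2)])
      fix J' G' assume "good J' G'" "J \<subseteq> J'" "G \<subseteq> G'"
      then have "Inl ` J' \<union> Inr ` G' = Inl ` J \<union> Inr ` G" using JG(1)
        by (intro M(2)[unfolded JG(1)]) (auto simp: \<A>_def)
      then show "J' = J" by blast
    qed
  qed
  have dom: "Domain G = D J" and sv: "single_valued G"
    and lin: "\<And>x m y n k. (x, m) \<in> G \<Longrightarrow> (y, n) \<in> G \<Longrightarrow> (x - frag_cmul k y, m - k * n) \<in> G"
    and ext: "\<And>x. x \<in> A \<Longrightarrow> d x = 0 \<Longrightarrow> (x, f x) \<in> G"
    using G by (auto simp: good_def)
  have "b \<in> J" for b
  proof (rule ccontr)
    assume b: "b \<notin> J"
    define J' where "J' = insert b J"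
    define \<beta> where "\<beta> x = Poly_Mapping.lookup (d x) b" for x
    have D': "x \<in> D J \<longleftrightarrow> x \<in> D J' \<and> \<beta> x = 0" for x
      using b by (auto simp: D_def J'_def \<beta>_def in_keys_iff subset_iff)
    have beta_diff: "\<beta> (x - frag_cmul k y) = \<beta> x - k * \<beta> y" if "x \<in> A" "y \<in> A" for x y k
      using d[OF that] by (simp add: \<beta>_def lookup_minus)
    have DA: "D J' \<subseteq> A" by (auto simp: D_def)
    have zero: "0 \<in> D J'" using A d[of 0 0 1] by (simp add: D_def chain_closed_def)
    \<comment> \<open>The coefficients at \<open>b\<close> form a subgroup of the integers.
      \<open>c\<close> realises a generator, found as a nonzero value of least absolute value; if
      all coefficients vanish, 0 will do.\<close>
    obtain c where c: "c \<in> D J'" and div: "\<And>x. x \<in> D J' \<Longrightarrow> \<beta> c dvd \<beta> x"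
    proof (cases "\<exists>x\<in>D J'. \<beta> x \<noteq> 0")
      case False
      then show ?thesis using that[OF zero] by auto
    next
      case True
      define n where "n = (LEAST n. \<exists>x\<in>D J'. \<beta> x \<noteq> 0 \<and> nat \<bar>\<beta> x\<bar> = n)"
      have "\<exists>n. \<exists>x\<in>D J'. \<beta> x \<noteq> 0 \<and> nat \<bar>\<beta> x\<bar> = n" using True by blast
      from LeastI_ex[OF this] obtain c where c: "c \<in> D J'" "\<beta> c \<noteq> 0" "nat \<bar>\<beta> c\<bar> = n"
        unfolding n_def by blast
      show ?thesis
      proof (rule that[OF c(1)], rule ccontr)
        fix x assume x: "x \<in> D J'" "\<not> \<beta> c dvd \<beta> x"
        let ?k = "\<beta> x div \<beta> c"
        let ?z = "x - frag_cmul ?k c"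
        have z: "?z \<in> D J'" using D_diff x c by blast
        have bz: "\<beta> ?z = \<beta> x mod \<beta> c"
          using beta_diff[of x c ?k] x c DA by (auto simp: minus_div_mult_eq_mod)
        then have "\<beta> ?z \<noteq> 0" using x by (simp add: dvd_eq_mod_eq_0)
        moreover have "nat \<bar>\<beta> ?z\<bar> < n"
          using c(2,3) bz abs_mod_less[of "\<beta> c" "\<beta> x"] by linarith
        ultimately show False using z not_less_Least[of "nat \<bar>\<beta> ?z\<bar>"] unfolding n_def by blast
      qed
    qed
    \<comment> \<open>The extension gives \<open>c\<close> the value 0. If \<open>\<beta> c\<close>
      is nonzero, the multiple \<open>k\<close> can be recovered from the coefficient at
      \<open>b\<close>; otherwise it is fixed to be 0, which keeps the graph single valued.\<close>
    define G' where "G' = {(x + frag_cmul k c, m) | x k m. (x, m) \<in> G \<and> (\<beta> c = 0 \<longrightarrow> k = 0)}"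
    have GD: "x \<in> D J" if "(x, m) \<in> G" for x m using that dom by blast
    have "good J' G'" unfolding good_def
    proof (intro conjI allI impI ballI)
      show "Domain G' = D J'"
      proof
        show "Domain G' \<subseteq> D J'"
        proof
          fix z assume "z \<in> Domain G'"
          then obtain x k m where z: "z = x + frag_cmul k c" "(x, m) \<in> G" unfolding G'_def by blast
          have "x \<in> D J'" using GD[OF z(2)] D' by blast
          then show "z \<in> D J'" using D_diff[OF _ c, of x "-k"] by (simp add: z(1) diff_cmul_minus)
        qed
        show "D J' \<subseteq> Domain G'"
        proof
          fix z assume z: "z \<in> D J'"
          let ?k = "\<beta> z div \<beta> c"
          have "\<beta> (z - frag_cmul ?k c) = 0"
            using beta_diff[of z c ?k] z c DA div[OF z] by (simp add: subset_iff)
          then have "z - frag_cmul ?k c \<in> Domain G" using D_diff[OF z c] D' dom by blast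
          then obtain m where "(z - frag_cmul ?k c, m) \<in> G" by blast
          then have "(z - frag_cmul ?k c + frag_cmul ?k c, m) \<in> G'"
            unfolding G'_def
            by (intro CollectI exI[of _ "z - frag_cmul ?k c"] exI[of _ ?k] exI[of _ m]) (simp del: diff_add_cancel)
          then show "z \<in> Domain G'" unfolding diff_add_cancel by blast
        qed
      qed
      show "single_valued G'"
      proof (rule single_valuedI)
        fix z m n assume "(z, m) \<in> G'" "(z, n) \<in> G'"
        then obtain x k y l where x: "z = x + frag_cmul k c" "(x, m) \<in> G" "\<beta> c = 0 \<longrightarrow> k = 0"
          and y: "z = y + frag_cmul l c" "(y, n) \<in> G" "\<beta> c = 0 \<longrightarrow> l = 0" unfolding G'_def by blast
        have "k = l"
        proof (cases "\<beta> c = 0")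
          case False
          have "\<beta> z = k * \<beta> c" if "z = x + frag_cmul k c" "(x, m) \<in> G" for x k m
          proof -
            have "x \<in> D J'" "\<beta> x = 0" using GD[OF that(2)] D' by blast+
            then show ?thesis using beta_diff[of x c "-k"] c DA by (simp add: that(1) diff_cmul_minus subset_iff)
          qed
          then show ?thesis using x y False by (metis mult_cancel_right)
        qed (use x y in auto)
        then have "x = y" using x y by simp
        then show "m = n" using x y sv by (auto simp: single_valued_def)
      qed
    next
      fix z m w n j assume "(z, m) \<in> G'" "(w, n) \<in> G'"
      then obtain x k y l where x: "z = x + frag_cmul k c" "(x, m) \<in> G" "\<beta> c = 0 \<longrightarrow> k = 0"
        and y: "w = y + frag_cmul l c" "(y, n) \<in> G" "\<beta> c = 0 \<longrightarrow> l = 0" unfolding G'_def by blast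
      have "z - frag_cmul j w = (x - frag_cmul j y) + frag_cmul (k - j * l) c"
        by (simp add: x y frag_cmul_distrib2 frag_cmul_diff_distrib)
      then show "(z - frag_cmul j w, m - j * n) \<in> G'"
        unfolding G'_def using lin[OF x(2) y(2), of j] x(3) y(3)
        by (intro CollectI exI[of _ "x - frag_cmul j y"] exI[of _ "k - j * l"] exI[of _ "m - j * n"]) simp
    next
      fix x assume "x \<in> A" "d x = 0"
      from ext[OF this] have "(x + frag_cmul 0 c, f x) \<in> G'" unfolding G'_def by blast
      then show "(x, f x) \<in> G'" by simp
    qed
    moreover have "G \<subseteq> G'"
    proof clarify
      fix x m assume "(x, m) \<in> G"
      then have "(x + frag_cmul 0 c, m) \<in> G'" unfolding G'_def by blast
      then show "(x, m) \<in> G'" by simp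
    qed
    ultimately have "J' = J" using max[of J' G'] by (auto simp: J'_def)
    then show False using b by (auto simp: J'_def)
  qed
  then have DJ: "D J = A" by (auto simp: D_def)
  define g where "g x = (THE m. (x, m) \<in> G)" for x
  have g: "(x, m) \<in> G \<Longrightarrow> g x = m" for x m
    using sv unfolding g_def single_valued_def by blast
  have gG: "(x, g x) \<in> G" if "x \<in> A" for x using that dom DJ g by fastforce
  show ?thesis
  proof (intro exI[of _ g] conjI ballI impI)
    show "chain_linear A g" unfolding chain_linear_def using g lin gG by blast
  qed (use g ext in blast)
qed

text \<open>A homomorphism \<open>\<eta>\<close> presenting homology as a free abelian group also lets functionals on the boundaries
  extend to the cycles; together with the previous lemma this is the vanishing of \<open>Ext\<close>.\<close>

locale free_homology =
  fixes p :: nat and X :: "'a topology" and S :: "'s set" and \<eta> :: "'a chain \<Rightarrow> 's \<Rightarrow>\<^sub>0 int"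
  assumes add: "\<And>x y. singular_relcycle p X {} x \<Longrightarrow> singular_relcycle p X {} y \<Longrightarrow> \<eta> (x + y) = \<eta> x + \<eta> y"
    and range: "\<eta> ` singular_relcycle_set p X {} = {c. Poly_Mapping.keys c \<subseteq> S}"
    and kernel: "\<And>x. singular_relcycle p X {} x \<Longrightarrow> \<eta> x = 0 \<longleftrightarrow> singular_relboundary p X {} x"

lemma free_homologyI:
  assumes h: "h \<in> iso (homology_group (int p) X) (free_Abelian_group S)"
  shows "free_homology p X S (\<lambda>x. h (homologous_rel_set p X {} x))"
proof
  let ?H = "homology_group (int p) X" and ?c = "homologous_rel_set p X {}"
  interpret group_hom ?H "free_Abelian_group S" h
    using h by (auto simp: group_hom_def group_hom_axioms_def iso_def)
  have bij: "bij_betw h (carrier ?H) (carrier (free_Abelian_group S))" using h by (auto simp: iso_def)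
  have carr: "carrier ?H = ?c ` singular_relcycle_set p X {}" by (rule carrier_relative_homology_group)
  fix x assume x: "singular_relcycle p X {} x"
  show "h (?c x) = 0 \<longleftrightarrow> singular_relboundary p X {} x"
  proof -
    have "?c x \<in> carrier ?H" unfolding carr using x by blast
    then have "h (?c x) = h \<one>\<^bsub>?H\<^esub> \<longleftrightarrow> ?c x = \<one>\<^bsub>?H\<^esub>"
      using inj_on_eq_iff[OF bij_betw_imp_inj_on[OF bij]] G.one_closed by blast
    moreover have "h \<one>\<^bsub>?H\<^esub> = 0" using hom_one by (simp only: one_free_Abelian_group)
    ultimately have "h (?c x) = 0 \<longleftrightarrow> ?c x = \<one>\<^bsub>?H\<^esub>" by (simp only:)
    then show ?thesis by (simp add: homologous_rel_set_eq_relboundary)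
  qed
  fix y assume y: "singular_relcycle p X {} y"
  have "?c x \<otimes>\<^bsub>?H\<^esub> ?c y = ?c (x + y)"
    unfolding mult_relative_homology_group
  proof (rule Set.set_eqI)
    fix z
    show "z \<in> (\<Union>r\<in>?c x. \<Union>s\<in>?c y. {r + s}) \<longleftrightarrow> z \<in> ?c (x + y)"
    proof
      assume "z \<in> ?c (x + y)"
      then have "homologous_rel p X {} (x + y - y) (z - y)"
        unfolding mem_Collect_eq by (rule homologous_rel_diff) simp
      then show "z \<in> (\<Union>r\<in>?c x. \<Union>s\<in>?c y. {r + s})"
        by (intro UN_I[of "z - y"] UN_I[of y]) auto
    qed (auto intro: homologous_rel_add)
  qed
  then show "h (?c (x + y)) = h (?c x) + h (?c y)"
    using hom_mult[of "?c x" "?c y"] x y unfolding carr by simp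
next
  show "(\<lambda>x. h (homologous_rel_set p X {} x)) ` singular_relcycle_set p X {} = {c. Poly_Mapping.keys c \<subseteq> S}"
    using h unfolding iso_def bij_betw_def carrier_relative_homology_group
    by (auto simp: image_image free_Abelian_group_def)
qed

context free_homology
begin

abbreviation (input) "Z \<equiv> singular_relcycle_set p X {}"

lemma closed_Z: "chain_closed Z"
  by (auto simp: chain_closed_def frag_cmul_sum intro!: singular_relcycle_diff singular_relcycle_cmul)

lemma eta_diff: "x \<in> Z \<Longrightarrow> y \<in> Z \<Longrightarrow> \<eta> (x - y) = \<eta> x - \<eta> y"
  using add[of "x - y" y] singular_relcycle_diff[of p X "{}" x y] by simp

definition lift :: "'s \<Rightarrow> 'a chain" where
  "lift s = (SOME z. z \<in> Z \<and> \<eta> z = frag_of s)"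

lemma lift: "s \<in> S \<Longrightarrow> lift s \<in> Z \<and> \<eta> (lift s) = frag_of s"
proof -
  assume "s \<in> S"
  then have "frag_of s \<in> \<eta> ` Z" using range by simp
  then have "\<exists>z. z \<in> Z \<and> \<eta> z = frag_of s" by force
  then show ?thesis unfolding lift_def by (rule someI_ex)
qed

text \<open>A section of the projection from cycles to homology: representatives are chosen for the
  basis classes and extended linearly, which is possible because homology is free.\<close>

lemma splitting:
  assumes "Poly_Mapping.keys c \<subseteq> S"
  shows "frag_extend lift c \<in> Z \<and> \<eta> (frag_extend lift c) = c"
  using assms
proof (induction c rule: frag_induction)
  case (one s) then show ?case using lift by simp
next
  case zero
  show ?case using add[of 0 0] by simp
next
  case (diff a b)
  then show ?case using eta_diff[of "frag_extend lift a" "frag_extend lift b"]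
    by (auto simp: frag_extend_diff singular_relcycle_diff)
qed

lemma keys_eta: "x \<in> Z \<Longrightarrow> Poly_Mapping.keys (\<eta> x) \<subseteq> S"
  using range by blast

lemma extend_cocycle:
  assumes f: "chain_linear Z f"
  shows "\<exists>g. chain_linear (singular_chain_set p X) g \<and> (\<forall>z\<in>Z. g z = f z)"
proof -
  have "\<exists>g. chain_linear (singular_chain_set p X) g \<and>
      (\<forall>x\<in>singular_chain_set p X. chain_boundary p x = 0 \<longrightarrow> g x = f x)"
    by (rule chain_linear_extend_from_kernel)
      (use f in \<open>auto simp: chain_closed_def chain_boundary_diff chain_boundary_cmul singular_cycle[abs_def]
        intro!: singular_chain_diff singular_chain_cmul\<close>)
  then show ?thesis by (auto simp: singular_cycle)
qed

text \<open>\<open>\<pi>\<close> subtracts from a cycle the chosen representative of its class, so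
  it projects cycles onto boundaries. Composing \<open>f\<close> with \<open>\<pi>\<close> extends
  \<open>f\<close> to all cycles, and \<open>extend_cocycle\<close> takes it on to all
  chains.\<close>

lemma extend_from_boundaries:
  assumes f: "chain_linear (singular_relboundary_set p X {}) f"
  shows "\<exists>g. chain_linear (singular_chain_set p X) g \<and> (\<forall>z\<in>singular_relboundary_set p X {}. g z = f z)"
proof -
  let ?B = "singular_relboundary_set p X {}"
  define \<pi> where "\<pi> z = z - frag_extend lift (\<eta> z)" for z
  have closed_B: "chain_closed ?B"
    by (auto simp: chain_closed_def intro!: singular_relboundary_diff singular_relboundary_cmul)
  have \<pi>: "\<pi> z \<in> ?B" if z: "z \<in> Z" for z
  proof -
    note s = splitting[OF keys_eta[OF z]]
    then have "\<pi> z \<in> Z" using z singular_relcycle_diff by (auto simp: \<pi>_def)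
    moreover have "\<eta> (\<pi> z) = 0" using s z by (simp add: \<pi>_def eta_diff)
    ultimately show ?thesis using kernel by simp
  qed
  have "chain_linear Z (\<lambda>z. f (\<pi> z))"
  proof (rule chain_linearI[OF closed_Z])
    fix x y assume xy: "x \<in> Z" "y \<in> Z"
    then have "\<pi> (x + y) = \<pi> x + \<pi> y" by (simp add: \<pi>_def add frag_extend_add)
    then show "f (\<pi> (x + y)) = f (\<pi> x) + f (\<pi> y)"
      using chain_linear_add[OF closed_B f] \<pi> xy by simp
  qed
  from extend_cocycle[OF this] obtain g where
    g: "chain_linear (singular_chain_set p X) g" "\<And>z. z \<in> Z \<Longrightarrow> g z = f (\<pi> z)" by blast
  moreover have "\<pi> z = z" "z \<in> Z" if "z \<in> ?B" for z
  proof -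
    show "z \<in> Z" using that singular_relboundary_imp_relcycle by blast
    then have "\<eta> z = 0" using that kernel by blast
    then show "\<pi> z = z" by (simp add: \<pi>_def)
  qed
  ultimately show ?thesis by metis
qed

end

section \<open>Cochains as linear functionals, and the rank of cohomology\<close>

lemma chain_closed_chains: "chain_closed (singular_chain_set p X)"
  by (auto simp: chain_closed_def intro!: singular_chain_diff singular_chain_cmul)

lemma cochain_iff:
  "\<phi> \<in> carrier (cochain_group p X) \<longleftrightarrow>
     chain_linear (singular_chain_set p X) \<phi> \<and> \<phi> \<in> extensional (singular_chain_set p X)"
proof
  assume "\<phi> \<in> carrier (cochain_group p X)"
  then show "chain_linear (singular_chain_set p X) \<phi> \<and> \<phi> \<in> extensional (singular_chain_set p X)"
    by (auto simp: cochain_group_def hom_def integer_group_def intro!: chain_linearI[OF chain_closed_chains])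
next
  assume "chain_linear (singular_chain_set p X) \<phi> \<and> \<phi> \<in> extensional (singular_chain_set p X)"
  then show "\<phi> \<in> carrier (cochain_group p X)"
    using chain_linear_add[OF chain_closed_chains, of p X \<phi>]
    by (auto simp: cochain_group_def hom_def integer_group_def)
qed

lemma restrict_cochain:
  assumes "chain_linear (singular_chain_set p X) g"
  shows "restrict g (singular_chain_set p X) \<in> carrier (cochain_group p X)"
  unfolding cochain_iff using assms chain_closed_chains[of p X]
  by (auto simp: chain_linear_def chain_closed_def)

lemma cochain_group_simps:
  "\<phi> \<otimes>\<^bsub>cochain_group p X\<^esub> \<psi> = (\<lambda>c\<in>singular_chain_set p X. \<phi> c + \<psi> c)"
  "\<one>\<^bsub>cochain_group p X\<^esub> = (\<lambda>c\<in>singular_chain_set p X. 0)"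
  by (simp_all add: cochain_group_def)

lemma comm_group_cochain_group: "comm_group (cochain_group p X)"
proof (rule comm_groupI)
  let ?C = "singular_chain_set p X"
  have add: "chain_linear ?C (\<lambda>c. \<phi> c + \<psi> c)" if "chain_linear ?C \<phi>" "chain_linear ?C \<psi>" for \<phi> \<psi>
    using that by (simp add: chain_linear_def algebra_simps)
  fix \<phi> assume \<phi>: "\<phi> \<in> carrier (cochain_group p X)"
  then have lin: "chain_linear ?C \<phi>" and ext: "\<phi> \<in> extensional ?C" by (simp_all add: cochain_iff)
  show "\<one>\<^bsub>cochain_group p X\<^esub> \<otimes>\<^bsub>cochain_group p X\<^esub> \<phi> = \<phi>"
    using ext by (auto simp: cochain_group_simps extensional_def)
  have "chain_linear ?C (\<lambda>c. - \<phi> c)" using lin by (simp add: chain_linear_def algebra_simps)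
  from restrict_cochain[OF this]
  show "\<exists>\<psi>\<in>carrier (cochain_group p X). \<psi> \<otimes>\<^bsub>cochain_group p X\<^esub> \<phi> = \<one>\<^bsub>cochain_group p X\<^esub>"
    by (rule rev_bexI) (auto simp: cochain_group_simps)
  fix \<psi> assume \<psi>: "\<psi> \<in> carrier (cochain_group p X)"
  show "\<phi> \<otimes>\<^bsub>cochain_group p X\<^esub> \<psi> \<in> carrier (cochain_group p X)"
    unfolding cochain_group_simps using \<phi> \<psi> by (intro restrict_cochain add) (simp_all add: cochain_iff)
  show "\<phi> \<otimes>\<^bsub>cochain_group p X\<^esub> \<psi> = \<psi> \<otimes>\<^bsub>cochain_group p X\<^esub> \<phi>"
    by (auto simp: cochain_group_simps add.commute)
  fix \<theta>
  show "\<phi> \<otimes>\<^bsub>cochain_group p X\<^esub> \<psi> \<otimes>\<^bsub>cochain_group p X\<^esub> \<theta>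
      = \<phi> \<otimes>\<^bsub>cochain_group p X\<^esub> (\<psi> \<otimes>\<^bsub>cochain_group p X\<^esub> \<theta>)"
    by (auto simp: cochain_group_simps)
next
  have "chain_linear (singular_chain_set p X) (\<lambda>_. 0)" by (simp add: chain_linear_def)
  from restrict_cochain[OF this] show "\<one>\<^bsub>cochain_group p X\<^esub> \<in> carrier (cochain_group p X)"
    by (simp add: cochain_group_simps)
qed

lemma singular_cocycle_set_iff:
  "\<phi> \<in> singular_cocycle_set p X \<longleftrightarrow> \<phi> \<in> carrier (cochain_group p X) \<and>
     (\<forall>z. singular_relboundary p X {} z \<longrightarrow> \<phi> z = 0)"
  unfolding singular_cocycle_set_def kernel_def coboundary_def cochain_group_simps singular_boundary
  by (auto simp: fun_eq_iff restrict_def)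

text \<open>\<open>E\<close> records the values of a cocycle on the chosen representatives, that is,
  the functional it induces on homology. Freeness in degree \<open>p\<close> makes \<open>E\<close>
  surjective; freeness in degree \<open>p - 1\<close> makes every cocycle in its kernel a
  coboundary.\<close>

lemma (in free_homology) abelian_rank_cohomology:
  assumes S: "finite S" and prev: "p = 0 \<or> free_homology (p - 1) X S' \<eta>'"
  shows "abelian_rank (cohomology_group p X) = enat (card S)"
proof -
  let ?C = "singular_chain_set p X" and ?Co = "cochain_group p X"
  interpret Co: comm_group ?Co by (rule comm_group_cochain_group)
  have lin: "chain_linear ?C \<phi>" if "\<phi> \<in> singular_cocycle_set p X" for \<phi>
    using that by (simp add: singular_cocycle_set_iff cochain_iff)
  have ZC: "Z \<subseteq> ?C" by (auto simp: singular_cycle)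
  have sub: "subgroup (singular_cocycle_set p X) ?Co"
  proof (rule Co.subgroupI)
    show "singular_cocycle_set p X \<subseteq> carrier ?Co" by (auto simp: singular_cocycle_set_iff)
    have "\<one>\<^bsub>?Co\<^esub> \<in> singular_cocycle_set p X"
      using Co.one_closed singular_boundary_imp_chain by (auto simp: singular_cocycle_set_iff cochain_group_simps)
    then show "singular_cocycle_set p X \<noteq> {}" by blast
    fix \<phi> assume \<phi>: "\<phi> \<in> singular_cocycle_set p X"
    then have \<phi>': "\<phi> \<in> carrier ?Co" by (simp add: singular_cocycle_set_iff)
    show "inv\<^bsub>?Co\<^esub> \<phi> \<in> singular_cocycle_set p X"
      unfolding singular_cocycle_set_iff
    proof (intro conjI allI impI)
      fix z assume z: "singular_relboundary p X {} z"
      have "(inv\<^bsub>?Co\<^esub> \<phi> \<otimes>\<^bsub>?Co\<^esub> \<phi>) z = \<one>\<^bsub>?Co\<^esub> z" using \<phi>' by simp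
      then show "(inv\<^bsub>?Co\<^esub> \<phi>) z = 0"
        using z \<phi> singular_boundary_imp_chain[OF z] by (simp add: cochain_group_simps singular_cocycle_set_iff)
    qed (use \<phi>' in simp)
    fix \<psi> assume \<psi>: "\<psi> \<in> singular_cocycle_set p X"
    show "\<phi> \<otimes>\<^bsub>?Co\<^esub> \<psi> \<in> singular_cocycle_set p X"
      using \<phi> \<psi> Co.m_closed[of \<phi> \<psi>] singular_boundary_imp_chain[of p X]
      by (auto simp: singular_cocycle_set_iff cochain_group_simps)
  qed
  define G where "G = subgroup_generated ?Co (singular_cocycle_set p X)"
  have carrG: "carrier G = singular_cocycle_set p X"
    unfolding G_def by (rule subgroup.carrier_subgroup_generated_subgroup[OF sub])
  have commG: "comm_group G"
    unfolding G_def by (rule Co.abelian_subgroup_generated) (rule Co.comm_group_axioms)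
  define E where "E \<phi> = (\<Sum>s\<in>S. frag_cmul (\<phi> (lift s)) (frag_of s))" for \<phi>
  have lookup_E: "Poly_Mapping.lookup (E \<phi>) s = (if s \<in> S then \<phi> (lift s) else 0)" for \<phi> s
    using S by (simp add: E_def lookup_sum when_def if_distrib cong: if_cong)
  have E_keys: "Poly_Mapping.keys (E \<phi>) \<subseteq> S" for \<phi>
    by (auto simp: in_keys_iff lookup_E split: if_splits)
  have liftZ: "lift s \<in> Z" "lift s \<in> ?C" if "s \<in> S" for s using lift[OF that] ZC by auto
  have homE: "E \<in> hom G (free_Abelian_group S)"
  proof (rule homI)
    fix \<phi> \<psi> assume "\<phi> \<in> carrier G" "\<psi> \<in> carrier G"
    show "E (\<phi> \<otimes>\<^bsub>G\<^esub> \<psi>) = E \<phi> \<otimes>\<^bsub>free_Abelian_group S\<^esub> E \<psi>"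
      using liftZ by (intro poly_mapping_eqI) (simp add: lookup_E lookup_add G_def cochain_group_simps)
  qed (use E_keys in simp)
  interpret E: group_hom G "free_Abelian_group S" E
    by (simp add: group_hom_def group_hom_axioms_def homE comm_group.axioms(2) commG)
  have surjE: "E ` carrier G = carrier (free_Abelian_group S)"
  proof
    show "carrier (free_Abelian_group S) \<subseteq> E ` carrier G"
    proof
      fix c assume "c \<in> carrier (free_Abelian_group S)"
      then have c: "Poly_Mapping.keys c \<subseteq> S" by simp
      define f where "f z = (\<Sum>s\<in>S. Poly_Mapping.lookup c s * Poly_Mapping.lookup (\<eta> z) s)" for z
      have "chain_linear Z f"
        by (rule chain_linearI[OF closed_Z]) (simp add: f_def add lookup_add sum.distrib algebra_simps)
      from extend_cocycle[OF this] obtain g where g: "chain_linear ?C g" "\<And>z. z \<in> Z \<Longrightarrow> g z = f z" by blast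
      have "restrict g ?C \<in> singular_cocycle_set p X"
        unfolding singular_cocycle_set_iff
      proof (intro conjI allI impI restrict_cochain g(1))
        fix z assume z: "singular_relboundary p X {} z"
        then have "z \<in> Z" using singular_relboundary_imp_relcycle by blast
        moreover from this have "\<eta> z = 0" using kernel z by blast
        ultimately show "restrict g ?C z = 0" using g(2)[of z] ZC by (auto simp: f_def)
      qed
      moreover have "E (restrict g ?C) = c"
      proof (rule poly_mapping_eqI)
        fix s
        show "Poly_Mapping.lookup (E (restrict g ?C)) s = Poly_Mapping.lookup c s"
        proof (cases "s \<in> S")
          case True
          have "Poly_Mapping.lookup (E (restrict g ?C)) s = f (lift s)"
            using True liftZ[OF True] g(2) by (simp add: lookup_E)
          also have "\<dots> = (\<Sum>t\<in>S. if s = t then Poly_Mapping.lookup c t else 0)"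
            unfolding f_def using lift[OF True] by (intro sum.cong) (auto simp: when_def)
          finally show ?thesis using S True by simp
        next
          case False
          then show ?thesis using c by (auto simp: lookup_E in_keys_iff)
        qed
      qed
      ultimately show "c \<in> E ` carrier G" unfolding carrG by (metis image_eqI)
    qed
  qed (use E.hom_closed in blast)
  \<comment> \<open>A cocycle kills boundaries, so on a cycle it depends only on the homology class
    and hence on the values at the lifts.\<close>
  have on_cycles: "\<phi> z = (\<Sum>s\<in>S. Poly_Mapping.lookup (\<eta> z) s * \<phi> (lift s))"
    if \<phi>: "\<phi> \<in> singular_cocycle_set p X" and z: "z \<in> Z" for \<phi> z
  proof -
    note l = lin[OF \<phi>]
    let ?z = "frag_extend lift (\<eta> z)"
    note s = splitting[OF keys_eta[OF z]]
    have "\<eta> (z - ?z) = 0" "z - ?z \<in> Z"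
      using s z eta_diff singular_relcycle_diff by auto
    then have "\<phi> (z - ?z) = 0" using kernel[of "z - ?z"] \<phi> by (auto simp: singular_cocycle_set_iff)
    then have 1: "\<phi> z = \<phi> ?z"
      using chain_linear_add[OF chain_closed_chains l, of "z - ?z" ?z] s \<open>z - ?z \<in> Z\<close> ZC by auto
    have "frag_extend lift c \<in> ?C \<and>
        \<phi> (frag_extend lift c) = (\<Sum>s\<in>S. Poly_Mapping.lookup c s * \<phi> (lift s))"
      if "Poly_Mapping.keys c \<subseteq> S" for c
      using that
    proof (induction c rule: frag_induction)
      case zero
      then show ?case using chain_linear_0[OF chain_closed_chains l] by simp
    next
      case (one t)
      have "(\<Sum>s\<in>S. Poly_Mapping.lookup (frag_of t) s * \<phi> (lift s)) = (\<Sum>s\<in>S. if t = s then \<phi> (lift s) else 0)"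
        by (intro sum.cong) (auto simp: when_def)
      then show ?case using one S liftZ by simp
    next
      case (diff a b)
      then have "frag_extend lift a \<in> ?C" "frag_extend lift b \<in> ?C" by blast+
      then have "\<phi> (frag_extend lift a - frag_cmul 1 (frag_extend lift b))
          = \<phi> (frag_extend lift a) - 1 * \<phi> (frag_extend lift b)"
        using l unfolding chain_linear_def by blast
      then show ?case using diff
        by (simp add: frag_extend_diff lookup_minus algebra_simps sum_subtractf singular_chain_diff)
    qed
    from this[OF keys_eta[OF z]] 1 show ?thesis by simp
  qed
  have kerE: "kernel G (free_Abelian_group S) E = singular_coboundary_set p X"
  proof
    show "singular_coboundary_set p X \<subseteq> kernel G (free_Abelian_group S) E"
    proof (cases p)
      case 0
      then show ?thesis using E.hom_one E.G.one_closed
        by (simp add: singular_coboundary_set_def kernel_def G_def)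
    next
      case (Suc q)
      show ?thesis
      proof
        fix \<phi> assume "\<phi> \<in> singular_coboundary_set p X"
        then obtain \<psi> where \<psi>: "\<psi> \<in> carrier (cochain_group q X)" "\<phi> = coboundary q X \<psi>"
          by (auto simp: singular_coboundary_set_def Suc)
        note lpsi = \<psi>(1)[unfolded cochain_iff, THEN conjunct1]
        have psi0: "\<psi> 0 = 0" by (rule chain_linear_0[OF chain_closed_chains lpsi])
        have \<phi>z: "\<phi> z = 0" if "z \<in> Z" for z
          using that psi0 by (auto simp: \<psi>(2) coboundary_def Suc singular_cycle)
        have bd: "singular_chain q X (chain_boundary (Suc q) c)" if "singular_chain (Suc q) X c" for c
          using singular_chain_boundary_alt[OF that] by simp
        have "chain_linear ?C (\<lambda>c. \<psi> (chain_boundary (Suc q) c))"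
          using lpsi bd unfolding chain_linear_def
          by (auto simp: Suc chain_boundary_diff chain_boundary_cmul)
        from restrict_cochain[OF this] have "\<phi> \<in> carrier ?Co"
          by (simp add: \<psi>(2) coboundary_def Suc)
        then have "\<phi> \<in> carrier G"
          unfolding carrG singular_cocycle_set_iff using \<phi>z singular_relboundary_imp_relcycle by blast
        moreover have "E \<phi> = 0"
          using \<phi>z liftZ by (intro poly_mapping_eqI) (auto simp: lookup_E)
        ultimately show "\<phi> \<in> kernel G (free_Abelian_group S) E" by (simp add: kernel_def)
      qed
    qed
    show "kernel G (free_Abelian_group S) E \<subseteq> singular_coboundary_set p X"
    proof
      fix \<phi> assume "\<phi> \<in> kernel G (free_Abelian_group S) E"
      then have \<phi>: "\<phi> \<in> singular_cocycle_set p X" and E0: "E \<phi> = 0" by (auto simp: kernel_def carrG)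
      have "\<phi> (lift s) = 0" if "s \<in> S" for s
        using arg_cong[OF E0, of "\<lambda>c. Poly_Mapping.lookup c s"] that by (simp add: lookup_E)
      then have \<phi>Z: "\<phi> z = 0" if "z \<in> Z" for z using on_cycles[OF \<phi> that] by simp
      have ext: "\<phi> \<in> extensional ?C" using \<phi> by (simp add: singular_cocycle_set_iff cochain_iff)
      show "\<phi> \<in> singular_coboundary_set p X"
      proof (cases p)
        case 0
        have "singular_relcycle 0 X {} z" if "singular_chain 0 X z" for z
          using that by (simp add: singular_cycle chain_boundary_def)
        then have "\<phi> = \<one>\<^bsub>?Co\<^esub>"
          using ext \<phi>Z by (auto simp: cochain_group_simps extensional_def fun_eq_iff 0)
        then show ?thesis by (simp add: singular_coboundary_set_def 0)
      next
        case (Suc q)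
        then interpret Q: free_homology q X S' \<eta>' using prev by simp
        \<comment> \<open>A cocycle that vanishes on cycles factors through the boundary map.
          \<open>f\<close> is the resulting functional on boundaries, independent of the bounding
          chain chosen.\<close>
        define f where "f b = \<phi> (SOME c. singular_chain (Suc q) X c \<and> chain_boundary (Suc q) c = b)" for b
        have f: "f (chain_boundary (Suc q) c) = \<phi> c" if c: "singular_chain (Suc q) X c" for c
        proof -
          let ?b = "chain_boundary (Suc q) c"
          let ?c = "SOME c. singular_chain (Suc q) X c \<and> chain_boundary (Suc q) c = ?b"
          have c': "singular_chain (Suc q) X ?c \<and> chain_boundary (Suc q) ?c = ?b"
            by (rule someI[of _ c]) (use c in auto)
          have "?c - c \<in> Z"
            using c' c by (simp add: Suc singular_cycle chain_boundary_diff singular_chain_diff)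
          then have "\<phi> (?c - c) = 0" by (rule \<phi>Z)
          then have "\<phi> ?c = \<phi> c"
            using chain_linear_add[OF chain_closed_chains lin[OF \<phi>], of "?c - c" c] c c'
              singular_chain_diff[of "Suc q" X ?c c] by (simp add: Suc)
          then show ?thesis by (simp add: f_def)
        qed
        have closed: "chain_closed (singular_relboundary_set q X {})"
          by (auto simp: chain_closed_def intro!: singular_relboundary_diff singular_relboundary_cmul)
        have "chain_linear (singular_relboundary_set q X {}) f"
        proof (rule chain_linearI[OF closed])
          fix x y assume "x \<in> singular_relboundary_set q X {}" "y \<in> singular_relboundary_set q X {}"
          then obtain c e where c: "singular_chain (Suc q) X c" "x = chain_boundary (Suc q) c"
            and e: "singular_chain (Suc q) X e" "y = chain_boundary (Suc q) e"
            by (auto simp: singular_boundary)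
          have "f (x + y) = \<phi> (c + e)"
            unfolding c e chain_boundary_add[symmetric] by (rule f) (simp add: c e singular_chain_add)
          also have "\<dots> = \<phi> c + \<phi> e"
            using c e by (intro chain_linear_add[OF chain_closed_chains lin[OF \<phi>]]) (simp_all add: Suc)
          finally show "f (x + y) = f x + f y" using c e f by simp
        qed
        from Q.extend_from_boundaries[OF this] obtain g where
          g: "chain_linear (singular_chain_set q X) g"
            "\<And>z. singular_relboundary q X {} z \<Longrightarrow> g z = f z" by auto
        have "\<phi> = coboundary q X (restrict g (singular_chain_set q X))"
        proof
          fix c
          show "\<phi> c = coboundary q X (restrict g (singular_chain_set q X)) c"
          proof (cases "singular_chain (Suc q) X c")
            case True
            then have "singular_relboundary q X {} (chain_boundary (Suc q) c)" by (auto simp: singular_boundary)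
            moreover from this have "singular_chain q X (chain_boundary (Suc q) c)"
              by (rule singular_boundary_imp_chain)
            ultimately show ?thesis using True g(2) f[OF True] by (simp add: coboundary_def)
          next
            case False
            then show ?thesis using ext by (simp add: coboundary_def extensional_def Suc)
          qed
        qed
        then show ?thesis using restrict_cochain[OF g(1)] by (simp add: singular_coboundary_set_def Suc)
      qed
    qed
  qed
  have eq: "cohomology_group p X = G Mod kernel G (free_Abelian_group S) E"
    unfolding cohomology_group_def G_def[symmetric] kerE ..
  have "comm_group (cohomology_group p X)"
    unfolding eq by (rule comm_group.abelian_FactGroup[OF commG E.subgroup_kernel])
  moreover have "(\<lambda>X. the_elem (E ` X)) \<in> iso (cohomology_group p X) (free_Abelian_group S)"
    unfolding eq by (rule E.FactGroup_iso_set[OF surjE])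
  ultimately show ?thesis using S by (rule abelian_rank_free)
qed

section \<open>Homology of a space filtered by open sets\<close>

lemma continuous_map_Euclidean_spaceI:
  assumes "\<And>i. continuous_map T euclideanreal (\<lambda>x. f x i)"
    and "\<And>x i. x \<in> topspace T \<Longrightarrow> n \<le> i \<Longrightarrow> f x i = 0"
  shows "continuous_map T (Euclidean_space n) f"
  using assms unfolding Euclidean_space_def continuous_map_in_subtopology continuous_map_componentwise_UNIV
  by auto

lemma continuous_map_Euclidean_space_coordinate:
  "continuous_map (Euclidean_space n) euclideanreal (\<lambda>x. x i)"
  unfolding Euclidean_space_def
  by (intro continuous_map_from_subtopology continuous_map_product_projection) simp

lemma continuous_map_real_fst: "continuous_map (prod_topology (top_of_set {0..1::real}) T) euclideanreal fst"
  by (metis continuous_map_fst continuous_map_in_subtopology)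

lemma contractible_Euclidean_space: "contractible_space (Euclidean_space n)"
proof -
  let ?P = "prod_topology (top_of_set {0..1::real}) (Euclidean_space n)"
  have "continuous_map ?P (Euclidean_space n) (\<lambda>z i. (1 - fst z) * snd z i)"
  proof (rule continuous_map_Euclidean_spaceI)
    fix i
    have "continuous_map ?P euclideanreal (\<lambda>z. snd z i)"
      using continuous_map_compose[OF continuous_map_snd continuous_map_Euclidean_space_coordinate]
      by (simp add: o_def)
    then show "continuous_map ?P euclideanreal (\<lambda>z. (1 - fst z) * snd z i)"
      by (intro continuous_intros continuous_map_real_fst)
  qed (auto simp: topspace_Euclidean_space)
  then have "homotopic_with (\<lambda>x. True) (Euclidean_space n) (Euclidean_space n) id (\<lambda>x i. 0)"
    by (auto simp: homotopic_with fun_eq_iff intro!: exI[of _ "\<lambda>z i. (1 - fst z) * snd z i"])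
  then show ?thesis unfolding contractible_space_def by blast
qed

lemma punctured_Euclidean_space_homotopy_equivalent:
  "subtopology (Euclidean_space (Suc n)) (topspace (Euclidean_space (Suc n)) - {\<lambda>_. 0})
     homotopy_equivalent_space nsphere n"
proof -
  let ?E = "Euclidean_space (Suc n)"
  let ?Y = "subtopology ?E (topspace ?E - {\<lambda>_. 0})"
  let ?P = "prod_topology (top_of_set {0..1::real}) ?Y"
  define N where "N x = sqrt (\<Sum>j\<le>n. (x j)\<^sup>2)" for x :: "nat \<Rightarrow> real"
  have Npos: "N x > 0" if "x \<in> topspace ?Y" for x
  proof -
    have x: "\<forall>i\<ge>Suc n. x i = 0" "x \<noteq> (\<lambda>_. 0)" using that by (auto simp: topspace_Euclidean_space)
    then obtain i where "x i \<noteq> 0" by auto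
    then have "i \<le> n" using x by (meson not_less_eq_eq)
    then have "(\<Sum>j\<le>n. (x j)\<^sup>2) > 0" using \<open>x i \<noteq> 0\<close> by (intro sum_pos2[of _ i]) auto
    then show ?thesis by (simp add: N_def)
  qed
  have coordY: "continuous_map ?Y euclideanreal (\<lambda>x. x i)" for i
    by (intro continuous_map_from_subtopology continuous_map_Euclidean_space_coordinate)
  have N_cont: "continuous_map ?Y euclideanreal N"
    unfolding N_def by (intro continuous_intros coordY) auto
  have zeroY: "x i = 0" if "x \<in> topspace ?Y" "Suc n \<le> i" for x i
    using that by (auto simp: topspace_Euclidean_space)
  have f: "continuous_map ?Y (nsphere n) (\<lambda>x i. x i / N x)"
    unfolding nsphere_def continuous_map_in_subtopology
  proof
    show "continuous_map ?Y ?E (\<lambda>x i. x i / N x)"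
      by (rule continuous_map_Euclidean_spaceI)
        (use Npos zeroY in \<open>fastforce intro!: continuous_map_real_divide coordY N_cont\<close>)+
    have "(\<Sum>i\<le>n. (x i / N x)\<^sup>2) = 1" if "x \<in> topspace ?Y" for x
    proof -
      have "(\<Sum>i\<le>n. (x i / N x)\<^sup>2) = (\<Sum>i\<le>n. (x i)\<^sup>2) / (N x)\<^sup>2"
        by (simp add: power_divide sum_divide_distrib)
      also have "(N x)\<^sup>2 = (\<Sum>i\<le>n. (x i)\<^sup>2)" by (simp add: N_def sum_nonneg)
      finally show ?thesis using Npos[OF that] by (simp add: N_def)
    qed
    then show "(\<lambda>x i. x i / N x) \<in> topspace ?Y \<rightarrow> {x. (\<Sum>i\<le>n. (x i)\<^sup>2) = 1}" by auto
  qed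
  have g: "continuous_map (nsphere n) ?Y id"
  proof -
    have "x \<noteq> (\<lambda>_. 0)" if "x \<in> topspace (nsphere n)" for x
      using that by (auto simp: nsphere)
    then show ?thesis
      unfolding continuous_map_in_subtopology
      using continuous_map_in_subtopology[of "nsphere n" ?E] continuous_map_id[of "nsphere n"]
      by (auto simp: nsphere_def continuous_map_from_subtopology)
  qed
  have fg: "homotopic_with (\<lambda>x. True) (nsphere n) (nsphere n) ((\<lambda>x i. x i / N x) \<circ> id) id"
  proof (rule homotopic_with_equal)
    fix x assume "x \<in> topspace (nsphere n)"
    then have "N x = 1" by (simp add: nsphere N_def)
    then show "((\<lambda>x i. x i / N x) \<circ> id) x = id x" by simp
  qed (use continuous_map_compose[OF g f] in auto)
  \<comment> \<open>Linear interpolation between radial projection and the identity. The factor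
    stays positive, so the origin is never met.\<close>
  define h where "h z i = snd z i * ((1 - fst z) / N (snd z) + fst z)" for z :: "real \<times> (nat \<Rightarrow> real)" and i
  have comp: "continuous_map ?P euclideanreal (\<lambda>z. k (snd z))" if "continuous_map ?Y euclideanreal k" for k
    using continuous_map_compose[OF continuous_map_snd that] by (simp add: o_def)
  have h: "continuous_map ?P ?Y h"
    unfolding continuous_map_in_subtopology
  proof
    have eq: "(1 - fst z) / N (snd z) + fst z > 0" if "z \<in> topspace ?P" for z
    proof -
      have "snd z \<in> topspace ?Y" using that by (simp only: topspace_prod_topology mem_Times_iff)
      from Npos[OF this] have z: "0 \<le> fst z" "fst z \<le> 1" "N (snd z) > 0" using that by auto
      then show ?thesis by (cases "fst z = 0") (auto intro!: add_nonneg_pos)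
    qed
    show h1: "continuous_map ?P ?E h"
    proof (rule continuous_map_Euclidean_spaceI)
      fix i
      have "N (snd z) \<noteq> 0" if "z \<in> topspace ?P" for z
      proof -
        have "snd z \<in> topspace ?Y" using that by (simp only: topspace_prod_topology mem_Times_iff)
        from Npos[OF this] show ?thesis by simp
      qed
      then show "continuous_map ?P euclideanreal (\<lambda>z. h z i)"
        unfolding h_def
        by (intro continuous_intros continuous_map_real_fst comp coordY N_cont) auto
    qed (auto simp: h_def zeroY)
    show "h \<in> topspace ?P \<rightarrow> topspace ?E - {\<lambda>_. 0}"
    proof
      fix z assume z: "z \<in> topspace ?P"
      have "h z \<in> topspace ?E" using continuous_map_image_subset_topspace[OF h1] z by blast
      moreover have "h z \<noteq> (\<lambda>_. 0)"
      proof
        assume hz: "h z = (\<lambda>_. 0)"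
        have "snd z i = 0" for i
        proof -
          have "h z i = 0" using hz by simp
          moreover have "(1 - fst z) / N (snd z) + fst z \<noteq> 0" using eq[OF z] by (rule less_imp_neq[symmetric])
          ultimately show ?thesis unfolding h_def mult_eq_0_iff by blast
        qed
        then have "snd z = (\<lambda>_. 0)" by (rule ext)
        moreover have "snd z \<in> topspace ?Y" using z by (simp only: topspace_prod_topology mem_Times_iff)
        ultimately show False by simp
      qed
      ultimately show "h z \<in> topspace ?E - {\<lambda>_. 0}" by simp
    qed
  qed
  have gf: "homotopic_with (\<lambda>x. True) ?Y ?Y (id \<circ> (\<lambda>x i. x i / N x)) id"
    unfolding homotopic_with_def
    by (intro exI[of _ h] conjI h allI ballI) (simp_all add: h_def fun_eq_iff)
  show ?thesis
    unfolding homotopy_equivalent_space_def using f g gf fg by blast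
qed

text \<open>Trivial groups are the free groups on the empty basis, so that vanishing and
  nonvanishing homology are covered by one formula.\<close>

lemma is_iso_free_Abelian_empty: "group G \<Longrightarrow> trivial_group G \<longleftrightarrow> G \<cong> free_Abelian_group {}"
proof -
  assume G: "group G"
  have "carrier (free_Abelian_group {}) = {0}" by (auto simp: free_Abelian_group_def)
  then have t: "trivial_group (free_Abelian_group {})" by (simp add: trivial_group_def)
  show ?thesis
  proof
    assume "trivial_group G"
    then have "(\<lambda>_. 0) \<in> iso G (free_Abelian_group {})"
      using \<open>carrier (free_Abelian_group {}) = {0}\<close>
      by (auto simp: iso_def hom_def bij_betw_def trivial_group_def)
    then show "G \<cong> free_Abelian_group {}" by (auto simp: is_iso_def)
  next
    assume "G \<cong> free_Abelian_group {}"
    then show "trivial_group G"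
      using isomorphic_group_triviality[OF _ G group_free_Abelian_group] t by blast
  qed
qed

text \<open>For positive \<open>n\<close> contractibility shifts the question to the reduced
  homology of the sphere of dimension \<open>n - 1\<close>. For \<open>n = 0\<close> the punctured
  space is empty and the homology of a point remains; this is the case of the very first chart, of
  which nothing is covered yet.\<close>

lemma punctured_Euclidean_space_relative_homology:
  "relative_homology_group p (Euclidean_space n) (topspace (Euclidean_space n) - {\<lambda>_. 0})
     \<cong> free_Abelian_group (if p = int n then {s} else {})"
proof (cases n)
  case 0
  have top: "topspace (Euclidean_space 0) = {\<lambda>_. 0}" by (auto simp: topspace_Euclidean_space)
  show ?thesis
  proof (cases "p = 0")
    case True
    then show ?thesis using homology_coefficients[OF top] iso_trans[OF _ isomorphic_group_integer_free_Abelian_group_singleton]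
      by (auto simp: 0 top)
  next
    case False
    then show ?thesis
      using homology_dimension_axiom[OF top, of p] is_iso_free_Abelian_empty[of "homology_group p (Euclidean_space 0)"]
      by (simp add: 0 top)
  qed
next
  case (Suc m)
  let ?E = "Euclidean_space n" and ?S = "topspace (Euclidean_space n) - {\<lambda>_. 0}"
  have "(\<lambda>i. if i = 0 then 1 else 0) \<in> ?S" by (auto simp: topspace_Euclidean_space Suc fun_eq_iff)
  then have "topspace ?E \<inter> ?S \<noteq> {}" by blast
  then have "relative_homology_group p ?E ?S \<cong> reduced_homology_group (p - 1) (subtopology ?E ?S)"
    by (intro isomorphic_group_relative_homology_of_contractible contractible_Euclidean_space)
  also have "\<dots> \<cong> reduced_homology_group (p - 1) (nsphere m)"
    unfolding Suc
    by (intro homotopy_equivalent_space_imp_isomorphic_reduced_homology_groups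
        punctured_Euclidean_space_homotopy_equivalent)
  also have "\<dots> \<cong> free_Abelian_group (if p = int n then {s} else {})"
  proof (cases "p = int n")
    case True
    then have "p - 1 = int m" using Suc by simp
    then show ?thesis using reduced_homology_group_nsphere(1)[of m] True
        iso_trans[OF _ isomorphic_group_integer_free_Abelian_group_singleton] by auto
  next
    case False
    then have "p - 1 \<noteq> int m" using Suc by simp
    then show ?thesis using reduced_homology_group_nsphere(2)[of "p - 1" m] False
        is_iso_free_Abelian_empty[of "reduced_homology_group (p - 1) (nsphere m)"] by simp
  qed
  finally show ?thesis .
qed

section \<open>Attaching one generator\<close>

text \<open>The sequence splits because \<open>C\<close> is free: \<open>b0\<close> lifts a
  generator, and removing its \<open>k b\<close>-th power moves \<open>b\<close> into the image of
  \<open>A\<close>. The components \<open>r\<close> and \<open>k\<close> give the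
  isomorphism.\<close>

lemma free_Abelian_extension:
  assumes A: "group A" and B: "comm_group B" and C: "group C"
    and i: "i \<in> hom A B" "inj_on i (carrier A)"
    and j: "j \<in> hom B C" "j ` carrier B = carrier C"
    and ker: "kernel B C j = i ` carrier A"
    and fA: "A \<cong> free_Abelian_group S" and fC: "C \<cong> free_Abelian_group {s}" and s: "s \<notin> S"
  shows "B \<cong> free_Abelian_group (insert s S)"
proof -
  interpret B: comm_group B by (rule B)
  interpret i: group_hom A B i by (simp add: group_hom_def group_hom_axioms_def i A B.group_axioms)
  interpret j: group_hom B C j by (simp add: group_hom_def group_hom_axioms_def j C B.group_axioms)
  obtain \<alpha> where \<alpha>: "\<alpha> \<in> iso A (free_Abelian_group S)" using fA by (auto simp: is_iso_def)
  obtain \<gamma> where \<gamma>: "\<gamma> \<in> iso C (free_Abelian_group {s})" using fC by (auto simp: is_iso_def)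
  have \<alpha>_hom: "\<alpha> \<in> hom A (free_Abelian_group S)" and \<gamma>_hom: "\<gamma> \<in> hom C (free_Abelian_group {s})"
    and \<alpha>_bij: "bij_betw \<alpha> (carrier A) (carrier (free_Abelian_group S))"
    and \<gamma>_bij: "bij_betw \<gamma> (carrier C) (carrier (free_Abelian_group {s}))"
    using \<alpha> \<gamma> by (auto simp: iso_def)
  define k where "k b = Poly_Mapping.lookup (\<gamma> (j b)) s" for b
  have k_mult: "k (b \<otimes>\<^bsub>B\<^esub> b') = k b + k b'" if "b \<in> carrier B" "b' \<in> carrier B" for b b'
    using that \<gamma>_hom by (simp add: k_def hom_mult lookup_add)
  have k_pow: "k (b [^]\<^bsub>B\<^esub> (n::int)) = n * k b" if b: "b \<in> carrier B" for b n
  proof -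
    have "\<gamma> (j (b [^]\<^bsub>B\<^esub> n)) = frag_cmul n (\<gamma> (j b))"
      using b j.hom_int_pow[OF b] hom_free_Abelian_int_pow[OF C \<gamma>_hom, of "j b"] by simp
    then show ?thesis by (simp add: k_def)
  qed
  have k_zero: "k b = 0 \<longleftrightarrow> b \<in> i ` carrier A" if b: "b \<in> carrier B" for b
  proof -
    have jb: "j b \<in> carrier C" using b by simp
    have "Poly_Mapping.keys (\<gamma> (j b)) \<subseteq> {s}"
      using hom_in_carrier[OF \<gamma>_hom jb] by simp
    then have "k b = 0 \<longleftrightarrow> \<gamma> (j b) = 0"
      unfolding k_def by (metis (no_types, opaque_lifting) in_keys_iff keys_eq_empty lookup_zero subset_singletonD singletonI)
    also have "\<gamma> \<one>\<^bsub>C\<^esub> = 0" using hom_one[OF \<gamma>_hom C] by simp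
    then have "\<gamma> (j b) = 0 \<longleftrightarrow> j b = \<one>\<^bsub>C\<^esub>"
      using inj_on_eq_iff[OF bij_betw_imp_inj_on[OF \<gamma>_bij] jb, of "\<one>\<^bsub>C\<^esub>"] C by (simp add: group.is_monoid)
    also have "\<dots> \<longleftrightarrow> b \<in> i ` carrier A" using b ker by (auto simp: kernel_def)
    finally show ?thesis .
  qed
  obtain b0 where b0: "b0 \<in> carrier B" "k b0 = 1"
  proof -
    have "frag_of s \<in> \<gamma> ` j ` carrier B" using \<gamma>_bij j(2) by (simp add: bij_betw_def)
    then obtain b where "b \<in> carrier B" "\<gamma> (j b) = frag_of s" by force
    then show ?thesis using that[of b] by (simp add: k_def)
  qed
  define e where "e b = b \<otimes>\<^bsub>B\<^esub> b0 [^]\<^bsub>B\<^esub> (- k b)" for b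
  have e_carr: "e b \<in> carrier B" if "b \<in> carrier B" for b using that b0 by (simp add: e_def)
  have e_ker: "\<exists>a\<in>carrier A. i a = e b" if b: "b \<in> carrier B" for b
  proof -
    have "k (e b) = 0" using b b0 by (simp add: e_def k_mult k_pow)
    then show ?thesis using k_zero[OF e_carr[OF b]] by auto
  qed
  define r where "r b = (SOME a. a \<in> carrier A \<and> i a = e b)" for b
  have r: "r b \<in> carrier A" "i (r b) = e b" if b: "b \<in> carrier B" for b
    using someI_ex[of "\<lambda>a. a \<in> carrier A \<and> i a = e b"] e_ker[OF b] by (auto simp: r_def Bex_def)
  have r_eq: "r b = a" if "b \<in> carrier B" "a \<in> carrier A" "i a = e b" for a b
    using r[OF that(1)] that i(2) by (metis inj_on_def)
  have e_mult: "e (b \<otimes>\<^bsub>B\<^esub> b') = e b \<otimes>\<^bsub>B\<^esub> e b'" if "b \<in> carrier B" "b' \<in> carrier B" for b b'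
  proof -
    have pow: "b0 [^]\<^bsub>B\<^esub> (- (k b + k b')) = b0 [^]\<^bsub>B\<^esub> (- k b) \<otimes>\<^bsub>B\<^esub> b0 [^]\<^bsub>B\<^esub> (- k b')"
      unfolding minus_add_distrib by (rule B.int_pow_mult[OF b0(1)])
    have "e (b \<otimes>\<^bsub>B\<^esub> b') = (b \<otimes>\<^bsub>B\<^esub> b') \<otimes>\<^bsub>B\<^esub> (b0 [^]\<^bsub>B\<^esub> (- k b) \<otimes>\<^bsub>B\<^esub> b0 [^]\<^bsub>B\<^esub> (- k b'))"
      unfolding e_def k_mult[OF that] pow ..
    also have "\<dots> = e b \<otimes>\<^bsub>B\<^esub> e b'"
      unfolding e_def using that B.int_pow_closed[OF b0(1)] by (simp add: B.m_ac)
    finally show ?thesis .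
  qed
  have r_mult: "r (b \<otimes>\<^bsub>B\<^esub> b') = r b \<otimes>\<^bsub>A\<^esub> r b'" if "b \<in> carrier B" "b' \<in> carrier B" for b b'
    using that r e_mult by (intro r_eq) auto
  define \<theta> where "\<theta> b = \<alpha> (r b) + frag_cmul (k b) (frag_of s)" for b
  have \<alpha>_keys: "Poly_Mapping.keys (\<alpha> a) \<subseteq> S" if "a \<in> carrier A" for a
    using hom_in_carrier[OF \<alpha>_hom that] by simp
  have \<theta>_s: "Poly_Mapping.lookup (\<theta> b) s = k b" if "b \<in> carrier B" for b
  proof -
    have "Poly_Mapping.lookup (\<alpha> (r b)) s = 0"
      using \<alpha>_keys[OF r(1)[OF that]] s by (meson in_keys_iff subsetD)
    then show ?thesis by (simp add: \<theta>_def lookup_add)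
  qed
  have "\<theta> \<in> iso B (free_Abelian_group (insert s S))"
  proof (rule isoI)
    show "\<theta> \<in> hom B (free_Abelian_group (insert s S))"
    proof (rule homI)
      fix b assume b: "b \<in> carrier B"
      have "Poly_Mapping.keys (\<theta> b) \<subseteq> Poly_Mapping.keys (\<alpha> (r b)) \<union> Poly_Mapping.keys (frag_cmul (k b) (frag_of s))"
        unfolding \<theta>_def by (rule Poly_Mapping.keys_add)
      also have "\<dots> \<subseteq> insert s S" using \<alpha>_keys[OF r(1)[OF b]] keys_cmul[of "k b" "frag_of s"] by auto
      finally show "\<theta> b \<in> carrier (free_Abelian_group (insert s S))" by simp
      fix b' assume b': "b' \<in> carrier B"
      have "\<alpha> (r b \<otimes>\<^bsub>A\<^esub> r b') = \<alpha> (r b) + \<alpha> (r b')"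
        using hom_mult[OF \<alpha>_hom r(1)[OF b] r(1)[OF b']] by simp
      then show "\<theta> (b \<otimes>\<^bsub>B\<^esub> b') = \<theta> b \<otimes>\<^bsub>free_Abelian_group (insert s S)\<^esub> \<theta> b'"
        using b b' by (simp add: \<theta>_def r_mult k_mult frag_cmul_distrib)
    qed
    show "bij_betw \<theta> (carrier B) (carrier (free_Abelian_group (insert s S)))"
      unfolding bij_betw_def
    proof
      show "inj_on \<theta> (carrier B)"
      proof (rule inj_onI)
        fix b b' assume b: "b \<in> carrier B" "b' \<in> carrier B" "\<theta> b = \<theta> b'"
        have kk: "k b = k b'" using \<theta>_s[OF b(1)] \<theta>_s[OF b(2)] b(3) by simp
        then have "\<alpha> (r b) = \<alpha> (r b')" using b(3) by (simp add: \<theta>_def)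
        then have "r b = r b'" using bij_betw_imp_inj_on[OF \<alpha>_bij] r(1)[OF b(1)] r(1)[OF b(2)] by (meson inj_onD)
        then have "e b = e b'" using r(2) b by metis
        then show "b = b'" using b b0(1) kk by (simp add: e_def)
      qed
      show "\<theta> ` carrier B = carrier (free_Abelian_group (insert s S))"
      proof
        show "\<theta> ` carrier B \<subseteq> carrier (free_Abelian_group (insert s S))"
          using hom_in_carrier[OF \<open>\<theta> \<in> hom B _\<close>] by blast
        show "carrier (free_Abelian_group (insert s S)) \<subseteq> \<theta> ` carrier B"
        proof
          fix c assume c: "c \<in> carrier (free_Abelian_group (insert s S))"
          let ?n = "Poly_Mapping.lookup c s"
          let ?c = "c - frag_cmul ?n (frag_of s)"
          have "Poly_Mapping.lookup ?c s = 0" by (simp add: lookup_minus)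
          moreover have "Poly_Mapping.keys ?c \<subseteq> insert s S"
            using c keys_diff[of c "frag_cmul ?n (frag_of s)"] keys_cmul[of ?n "frag_of s"] by auto
          ultimately have "Poly_Mapping.keys ?c \<subseteq> S"
            by (metis in_keys_iff subset_insert)
          then obtain a where a: "a \<in> carrier A" "\<alpha> a = ?c"
            using \<alpha>_bij unfolding bij_betw_def by (metis carrier_free_Abelian_group_iff imageE)
          define b where "b = i a \<otimes>\<^bsub>B\<^esub> b0 [^]\<^bsub>B\<^esub> ?n"
          have b: "b \<in> carrier B" using a b0 by (simp add: b_def)
          have "k (i a) = 0" using k_zero[of "i a"] a by simp
          then have kb: "k b = ?n" using a b0 by (simp add: b_def k_mult k_pow)
          have "e b = i a" using a b0(1) unfolding e_def kb unfolding b_def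
            by (simp add: B.m_assoc B.int_pow_neg)
          then have "r b = a" using r_eq[OF b a(1)] by simp
          then have "\<theta> b = c" using a(2) kb by (simp add: \<theta>_def)
          then show "c \<in> \<theta> ` carrier B" using b by blast
        qed
      qed
    qed
  qed
  then show ?thesis by (auto simp: is_iso_def)
qed

text \<open>Excise \<open>U - C\<close>, which is closed in the union and lies in the open set
  \<open>U\<close>. The relative homology of a step is thereby computed inside the new chart
  alone.\<close>

lemma homology_excision_open_cover:
  assumes U: "openin X U" and C: "openin X C"
  shows "relative_homology_group p (subtopology X C) (C \<inter> U) \<cong> relative_homology_group p (subtopology X (U \<union> C)) U"
proof -
  let ?X = "subtopology X (U \<union> C)"
  have sub: "U \<subseteq> topspace X" "C \<subseteq> topspace X" using assms openin_subset by auto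
  have top: "topspace ?X = U \<union> C" using sub by auto
  have "openin ?X C" "openin ?X U" using openin_open_subtopology[OF openin_Un[OF U C]] U C by auto
  then have cl: "closedin ?X (U - C)" and int: "?X interior_of U = U"
    using closedin_diff[of ?X "topspace ?X" C] top
    by (auto simp: interior_of_openin Un_Diff)
  have "?X closure_of (U - C) \<subseteq> ?X interior_of U"
    unfolding int closure_of_closedin[OF cl] by blast
  from homology_excision_axiom[OF this, of "U \<union> C" p]
  have "hom_induced p (subtopology ?X (U \<union> C - (U - C))) (U - (U - C)) (subtopology ?X (U \<union> C)) U id
    \<in> iso (relative_homology_group p (subtopology ?X (U \<union> C - (U - C))) (U - (U - C)))
        (relative_homology_group p (subtopology ?X (U \<union> C)) U)"
    by blast
  moreover have "U \<union> C - (U - C) = C" "U - (U - C) = C \<inter> U" by auto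
  moreover have "subtopology ?X C = subtopology X C" "subtopology ?X (U \<union> C) = ?X"
    by (auto simp: subtopology_subtopology Int_absorb1)
  ultimately show ?thesis by (auto simp: is_iso_def)
qed

text \<open>The long exact sequence of the pair breaks up: the relative group sits in an even degree
  and the homology of \<open>U\<close> vanishes in odd degrees, so every connecting map is zero. The
  second conclusion serves to show that each fixed degree stabilises.\<close>

lemma homology_attach_even_cell:
  fixes c :: "'s \<Rightarrow> nat"
  assumes U: "openin X U" and C: "openin X C"
    and rel: "\<And>p. relative_homology_group p (subtopology X C) (C \<inter> U)
                \<cong> free_Abelian_group (if p = int (2 * c s) then {s} else {})"
    and hom: "\<And>p. homology_group p (subtopology X U) \<cong> free_Abelian_group {t \<in> F. p = int (2 * c t)}"
    and s: "s \<notin> F"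
  shows "homology_group p (subtopology X (U \<union> C)) \<cong> free_Abelian_group {t \<in> insert s F. p = int (2 * c t)}"
    and "p \<noteq> int (2 * c s) \<Longrightarrow> p \<noteq> int (2 * c s) - 1 \<Longrightarrow>
      hom_induced p (subtopology X U) {} (subtopology X (U \<union> C)) {} id
        \<in> iso (homology_group p (subtopology X U)) (homology_group p (subtopology X (U \<union> C)))"
proof -
  let ?X = "subtopology X (U \<union> C)" and ?n = "int (2 * c s)"
  have sub: "subtopology ?X U = subtopology X U"
    by (simp add: subtopology_subtopology Int_absorb1)
  have relX: "relative_homology_group p ?X U \<cong> free_Abelian_group (if p = ?n then {s} else {})" for p
    using iso_trans[OF group.iso_sym[OF _ homology_excision_open_cover[OF U C]] rel] by simp
  have triv: "trivial_group (relative_homology_group p ?X U)" if "p \<noteq> ?n" for p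
  proof -
    have "relative_homology_group p ?X U \<cong> free_Abelian_group ({} :: 's set)" using relX[of p] that by simp
    then show ?thesis by (rule iffD2[OF is_iso_free_Abelian_empty[OF group_relative_homology_group]])
  qed
  have odd: "trivial_group (homology_group p (subtopology X U))" if "odd p" for p
  proof -
    have "{t \<in> F. p = int (2 * c t)} = {}" using that by auto
    then have "homology_group p (subtopology X U) \<cong> free_Abelian_group ({} :: 's set)" using hom[of p] by (simp only:)
    then show ?thesis by (rule iffD2[OF is_iso_free_Abelian_empty[OF group_relative_homology_group]])
  qed
  let ?i = "\<lambda>p. hom_induced p (subtopology X U) {} ?X {} id"
  let ?j = "\<lambda>p. hom_induced p ?X {} ?X U id"
  note ex1 = homology_exactness_axiom_1[of _ ?X U, unfolded sub]
  note ex2 = homology_exactness_axiom_2[of "p + 1" ?X U for p, unfolded sub, simplified add_diff_cancel_right']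
  note ex3 = homology_exactness_axiom_3[of _ ?X U, unfolded sub]
  have i_hom: "?i p \<in> hom (homology_group p (subtopology X U)) (homology_group p ?X)" for p
    by (rule hom_induced_empty_hom)
  have inj: "inj_on (?i p) (carrier (homology_group p (subtopology X U)))" if "p + 1 \<noteq> ?n" for p
  proof -
    interpret group_hom "homology_group p (subtopology X U)" "homology_group p ?X" "?i p"
      by (simp add: group_hom_def group_hom_axioms_def i_hom)
    have "kernel (homology_group p (subtopology X U)) (homology_group p ?X) (?i p)
        = hom_boundary (p + 1) ?X U ` carrier (relative_homology_group (p + 1) ?X U)"
      using ex2[of p] by simp
    also have "\<dots> = {hom_boundary (p + 1) ?X U \<one>\<^bsub>relative_homology_group (p + 1) ?X U\<^esub>}"
      using triv[OF that] by (simp add: trivial_group_def)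
    also have "\<dots> = {\<one>\<^bsub>homology_group p (subtopology X U)\<^esub>}"
      using Group.hom_one[OF hom_boundary_hom[of "p + 1" ?X U]] by (simp add: sub)
    finally show ?thesis by (rule trivial_ker_imp_inj)
  qed
  have im: "kernel (homology_group p ?X) (relative_homology_group p ?X U) (?j p)
      = ?i p ` carrier (homology_group p (subtopology X U))" for p
    using ex3[of p] by simp
  have surj: "?i p ` carrier (homology_group p (subtopology X U)) = carrier (homology_group p ?X)" if "p \<noteq> ?n" for p
    unfolding im[symmetric]
    by (rule group_hom.kernel_to_trivial_group[OF _ triv[OF that]])
      (simp add: group_hom_def group_hom_axioms_def hom_induced_hom)
  show iso: "?i p \<in> iso (homology_group p (subtopology X U)) (homology_group p ?X)"
    if "p \<noteq> ?n" "p \<noteq> ?n - 1" for p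
    using inj[of p] surj[OF that(1)] i_hom that(2) by (auto simp: iso_def bij_betw_def)
  consider "p = ?n" | "p = ?n - 1" | "p \<noteq> ?n" "p \<noteq> ?n - 1" by blast
  then show "homology_group p ?X \<cong> free_Abelian_group {t \<in> insert s F. p = int (2 * c t)}"
  proof cases
    case 1
    have "homology_group p ?X \<cong> free_Abelian_group (insert s {t \<in> F. p = int (2 * c t)})"
    proof (rule free_Abelian_extension[OF _ _ _ i_hom _ hom_induced_hom _ im])
      show "inj_on (?i p) (carrier (homology_group p (subtopology X U)))" by (rule inj) (simp add: 1)
      have "?j p ` carrier (homology_group p ?X) = kernel (relative_homology_group p ?X U)
          (homology_group (p - 1) (subtopology X U)) (hom_boundary p ?X U)"
        using ex1[of p] by simp
      also have "\<dots> = carrier (relative_homology_group p ?X U)"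
        by (rule group_hom.kernel_to_trivial_group[OF _ odd])
          (use hom_boundary_hom[of p ?X U] in \<open>simp_all add: group_hom_def group_hom_axioms_def sub 1\<close>)
      finally show "?j p ` carrier (homology_group p ?X) = carrier (relative_homology_group p ?X U)" .
      show "relative_homology_group p ?X U \<cong> free_Abelian_group {s}" using relX[of p] 1 by simp
    qed (use hom abelian_homology_group s in auto)
    moreover have "insert s {t \<in> F. p = int (2 * c t)} = {t \<in> insert s F. p = int (2 * c t)}" using 1 by auto
    ultimately show ?thesis by simp
  next
    \<comment> \<open>Just below the new generator the inclusion is still surjective, and its source
      has odd degree and vanishes.\<close>
    case 2
    then have "odd p" by simp
    have "carrier (homology_group p ?X) = {\<one>\<^bsub>homology_group p ?X\<^esub>}"
      using surj[of p] odd[OF \<open>odd p\<close>] hom_one[OF i_hom[of p]] 2 by (simp add: trivial_group_def)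
    then have t: "trivial_group (homology_group p ?X)" by (simp add: trivial_group_def)
    have e: "{t \<in> insert s F. p = int (2 * c t)} = {}" using \<open>odd p\<close> by auto
    show ?thesis unfolding e
      by (rule iffD1[OF is_iso_free_Abelian_empty[OF group_relative_homology_group] t])
  next
    case 3
    have "homology_group p (subtopology X U) \<cong> homology_group p ?X" using iso[OF 3] by (auto simp: is_iso_def)
    from iso_trans[OF group.iso_sym[OF _ this] hom]
    have "homology_group p ?X \<cong> free_Abelian_group {t \<in> F. p = int (2 * c t)}" by simp
    moreover have "{t \<in> insert s F. p = int (2 * c t)} = {t \<in> F. p = int (2 * c t)}" using 3 by auto
    ultimately show ?thesis by simp
  qed
qed

section \<open>Passage to the union of the stages\<close>

text \<open>Each of the finitely many simplices has a compact image, which lies in one open stage.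
  The sum of these stage numbers bounds them all.\<close>

lemma singular_chain_in_increasing_union:
  fixes U :: "nat \<Rightarrow> 'a set"
  assumes op: "\<And>m. openin X (U m)" and mono: "mono U" and un: "(\<Union>m. U m) = topspace X"
    and c: "singular_chain p X c"
  shows "\<exists>m. \<forall>m'\<ge>m. singular_chain p (subtopology X (U m')) c"
proof -
  have "\<exists>m. \<sigma> ` standard_simplex p \<subseteq> U m" if \<sigma>: "\<sigma> \<in> Poly_Mapping.keys c" for \<sigma>
  proof -
    have "continuous_map (subtopology (powertop_real UNIV) (standard_simplex p)) X \<sigma>"
      using c \<sigma> by (auto simp: singular_chain_def singular_simplex_def)
    moreover have "compactin (subtopology (powertop_real UNIV) (standard_simplex p)) (standard_simplex p)"
      using compactin_standard_simplex by (simp add: compactin_subtopology)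
    ultimately have comp: "compactin X (\<sigma> ` standard_simplex p)" by (blast intro: image_compactin)
    have "\<sigma> ` standard_simplex p \<subseteq> \<Union>(range U)"
      unfolding un by (rule compactin_subset_topspace[OF comp])
    from compactinD[OF comp _ this]
    obtain \<F> where F: "finite \<F>" "\<F> \<subseteq> range U" "\<sigma> ` standard_simplex p \<subseteq> \<Union>\<F>"
      using op by (metis imageE)
    then obtain M where M: "finite M" "\<F> = U ` M" by (meson finite_subset_image)
    have "U m \<subseteq> U (Max M)" if "m \<in> M" for m using monoD[OF mono] M that by auto
    then have "\<sigma> ` standard_simplex p \<subseteq> U (Max M)" using F M by blast
    then show ?thesis by blast
  qed
  then obtain m where m: "\<And>\<sigma>. \<sigma> \<in> Poly_Mapping.keys c \<Longrightarrow> \<sigma> ` standard_simplex p \<subseteq> U (m \<sigma>)" by metis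
  let ?M = "\<Sum>\<sigma>\<in>Poly_Mapping.keys c. m \<sigma>"
  show ?thesis
  proof (intro exI[of _ ?M] allI impI)
    fix m' assume m': "?M \<le> m'"
    have "\<sigma> ` standard_simplex p \<subseteq> U m'" if "\<sigma> \<in> Poly_Mapping.keys c" for \<sigma>
    proof -
      have "m \<sigma> \<le> ?M" using that by (intro member_le_sum) auto
      then have "U (m \<sigma>) \<subseteq> U m'" using m' by (intro monoD[OF mono]) simp
      then show ?thesis using m[OF that] by blast
    qed
    then show "singular_chain p (subtopology X (U m')) c"
      using c by (auto simp: singular_chain_subtopology)
  qed
qed

lemma hom_induced_id_iso:
  "hom_induced p X {} X {} id \<in> iso (homology_group p X) (homology_group p X)"
proof -
  have "bij_betw (hom_induced p X {} X {} id) (carrier (homology_group p X)) (carrier (homology_group p X))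
      \<longleftrightarrow> bij_betw (\<lambda>x. x) (carrier (homology_group p X)) (carrier (homology_group p X))"
    by (rule bij_betw_cong) (rule hom_induced_id)
  then show ?thesis unfolding iso_def using hom_induced_empty_hom[of p X X id] by (simp add: bij_betw_def)
qed

text \<open>Cycles and bounding chains have compact support, so each lies in a finite stage. From
  stage \<open>M\<close> on all inclusions are isomorphisms in degree \<open>p\<close>, so stage
  \<open>M\<close> already computes the homology of the union.\<close>

lemma homology_increasing_union:
  assumes op: "\<And>m. openin X (U m)" and mono: "mono U" and un: "(\<Union>m. U m) = topspace X"
    and iso: "\<And>m. m \<ge> M \<Longrightarrow> hom_induced (int p) (subtopology X (U m)) {} (subtopology X (U (Suc m))) {} id
        \<in> iso (homology_group (int p) (subtopology X (U m))) (homology_group (int p) (subtopology X (U (Suc m))))"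
  shows "homology_group (int p) (subtopology X (U M)) \<cong> homology_group (int p) X"
proof -
  let ?X = "\<lambda>m. subtopology X (U m)"
  let ?H = "\<lambda>m. homology_group (int p) (?X m)"
  let ?i = "\<lambda>m m'. hom_induced (int p) (?X m) {} (?X m') {} id"
  let ?I = "\<lambda>m. hom_induced (int p) (?X m) {} X {} id"
  have cont: "continuous_map (?X m) (?X m') id" if "m \<le> m'" for m m'
    using monoD[OF mono that] by (auto simp: continuous_map_in_subtopology continuous_map_from_subtopology)
  have contX: "continuous_map (?X m) X id" for m by (simp add: continuous_map_from_subtopology)
  have iM: "?i M m \<in> iso (?H M) (?H m)" if "M \<le> m" for m
    using that
  proof (induction m rule: dec_induct)
    case base
    show ?case by (rule hom_induced_id_iso)
  next
    case (step m)
    have "?i M (Suc m) = ?i m (Suc m) \<circ> ?i M m"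
      using hom_induced_compose_empty[OF cont[of M m] cont[of m "Suc m"]] step.hyps by simp
    then show ?case using iso_set_trans[OF step.IH iso[OF step.hyps(1)]] by (simp only:)
  qed
  have comp: "?I m (?i M m x) = ?I M x" if "M \<le> m" for m x
    using hom_induced_compose_empty[OF cont[OF that] contX, of "int p"] by simp
  have cls: "?I m (homologous_rel_set p (?X m) {} z) = homologous_rel_set p X {} z"
    if "singular_relcycle p (?X m) {} z" for m z
    using hom_induced_chain_map[OF contX, of "{}" "{}", OF _ that] chain_map_id_gen[of p "?X m" z id] that
    by (simp add: singular_cycle)
  have classM: "?i M m (homologous_rel_set p (?X M) {} z) = homologous_rel_set p (?X m) {} z"
    if "singular_relcycle p (?X M) {} z" "M \<le> m" for m z
    using hom_induced_chain_map[OF cont[OF that(2)], of "{}" "{}", OF _ that(1)]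
      chain_map_id_gen[of p "?X M" z id] that
    by (simp add: singular_cycle)
  have hom: "?I M \<in> hom (?H M) (homology_group (int p) X)" by (rule hom_induced_empty_hom)
  interpret group_hom "?H M" "homology_group (int p) X" "?I M"
    by (simp add: group_hom_def group_hom_axioms_def hom)
  have "?I M \<in> iso (?H M) (homology_group (int p) X)"
  proof (rule isoI[OF hom], unfold bij_betw_def, intro conjI)
    show "inj_on (?I M) (carrier (?H M))"
      unfolding inj_on_one_iff
    proof (intro allI impI)
      fix y assume y: "y \<in> carrier (?H M)" and y0: "?I M y = \<one>\<^bsub>homology_group (int p) X\<^esub>"
      obtain z where z: "singular_relcycle p (?X M) {} z" "y = homologous_rel_set p (?X M) {} z"
        using y by (auto simp: carrier_relative_homology_group)
      have "singular_relboundary p X {} z"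
        using y0 cls[OF z(1)] z(2) by (simp add: homologous_rel_set_eq_relboundary)
      then obtain d where d: "singular_chain (Suc p) X d" "chain_boundary (Suc p) d = z"
        by (auto simp: singular_boundary)
      obtain m where m: "\<And>m'. m' \<ge> m \<Longrightarrow> singular_chain (Suc p) (?X m') d"
        using singular_chain_in_increasing_union[OF op mono un d(1)] by blast
      let ?m = "max m M"
      have "singular_relboundary p (?X ?m) {} z" using m[of ?m] d(2) by (auto simp: singular_boundary)
      then have "?i M ?m y = \<one>\<^bsub>?H ?m\<^esub>"
        using classM[OF z(1), of ?m] z(2) by (simp add: homologous_rel_set_eq_relboundary)
      moreover have "?i M ?m \<one>\<^bsub>?H M\<^esub> = \<one>\<^bsub>?H ?m\<^esub>" by (rule Group.hom_one[OF hom_induced_empty_hom]) simp_all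
      moreover have "inj_on (?i M ?m) (carrier (?H M))" using iM[of ?m] by (simp add: iso_def bij_betw_def)
      ultimately show "y = \<one>\<^bsub>?H M\<^esub>" using y G.one_closed by (metis inj_onD)
    qed
    show "?I M ` carrier (?H M) = carrier (homology_group (int p) X)"
    proof
      show "?I M ` carrier (?H M) \<subseteq> carrier (homology_group (int p) X)" using hom_closed by blast
      show "carrier (homology_group (int p) X) \<subseteq> ?I M ` carrier (?H M)"
      proof
        fix x assume "x \<in> carrier (homology_group (int p) X)"
        then obtain z where z: "singular_relcycle p X {} z" "x = homologous_rel_set p X {} z"
          by (auto simp: carrier_relative_homology_group)
        then obtain m where m: "\<And>m'. m' \<ge> m \<Longrightarrow> singular_chain p (?X m') z"
          using singular_chain_in_increasing_union[OF op mono un, of p z] by (auto simp: singular_cycle)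
        let ?m = "max m M"
        have zm: "singular_relcycle p (?X ?m) {} z" using m[of ?m] z(1) by (simp add: singular_cycle)
        have "homologous_rel_set p (?X ?m) {} z \<in> carrier (?H ?m)"
          unfolding carrier_relative_homology_group using zm by blast
        moreover have "?i M ?m ` carrier (?H M) = carrier (?H ?m)"
          using iM[of ?m] by (simp add: iso_def bij_betw_def)
        ultimately have "homologous_rel_set p (?X ?m) {} z \<in> ?i M ?m ` carrier (?H M)" by (simp only:)
        then obtain y where y: "y \<in> carrier (?H M)" "?i M ?m y = homologous_rel_set p (?X ?m) {} z"
          by blast
        have "?I M y = x" using comp[of ?m y] y(2) cls[OF zm] z(2) by simp
        then show "x \<in> ?I M ` carrier (?H M)" using y(1) by blast
      qed
    qed
  qed
  then show ?thesis by (auto simp: is_iso_def)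
qed

text \<open>Steps outside \<open>K\<close> change nothing; they allow for gaps in the numbering of
  the charts. By \<open>fin\<close> only finitely many steps affect a given degree, so its homology
  is reached at a finite stage.\<close>

theorem homology_filtered_space:
  fixes c :: "nat \<Rightarrow> nat"
  assumes op: "\<And>k. openin X (U k)" and U0: "U 0 = {}" and un: "(\<Union>k. U k) = topspace X"
    and step: "\<And>k. k \<notin> K \<Longrightarrow> U (Suc k) = U k"
    and cell: "\<And>k. k \<in> K \<Longrightarrow> \<exists>C. openin X C \<and> U (Suc k) = U k \<union> C \<and>
        (\<forall>p. relative_homology_group p (subtopology X C) (C \<inter> U k)
               \<cong> free_Abelian_group (if p = int (2 * c k) then {k} else {}))"
    and fin: "\<And>m. finite {k \<in> K. c k = m}"
  shows "homology_group (int p) X \<cong> free_Abelian_group {k \<in> K. p = 2 * c k}"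
proof -
  have mono: "mono U"
  proof (rule mono_iff_le_Suc[THEN iffD2], rule allI)
    fix k show "U k \<subseteq> U (Suc k)" using step[of k] cell[of k] by (cases "k \<in> K") auto
  qed
  let ?F = "\<lambda>k. {j \<in> K. j < k}"
  have insert_F: "insert k (?F k) = ?F (Suc k)" if "k \<in> K" for k using that by (auto simp: less_Suc_eq)
  have IH: "homology_group q (subtopology X (U k)) \<cong> free_Abelian_group {t \<in> ?F k. q = int (2 * c t)}" for q k
  proof (induction k arbitrary: q)
    case 0
    have "trivial_group (homology_group q (subtopology X (U 0)))"
      by (rule trivial_homology_group_empty) (simp add: U0)
    moreover have e: "{t \<in> ?F 0. q = int (2 * c t)} = {}" by simp
    ultimately show ?case unfolding e
      using iffD1[OF is_iso_free_Abelian_empty[OF group_relative_homology_group]] by blast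
  next
    case (Suc k)
    show ?case
    proof (cases "k \<in> K")
      case False
      then have "?F (Suc k) = ?F k" by (auto simp: less_Suc_eq)
      then show ?thesis using Suc[of q] step[OF False] by simp
    next
      case True
      then obtain C where C: "openin X C" "U (Suc k) = U k \<union> C"
        "\<And>p. relative_homology_group p (subtopology X C) (C \<inter> U k)
               \<cong> free_Abelian_group (if p = int (2 * c k) then {k} else {})"
        using cell by blast
      have "k \<notin> ?F k" by simp
      from homology_attach_even_cell(1)[OF op C(1) C(3) Suc this, of q] show ?thesis
        unfolding C(2) insert_F[OF True] .
    qed
  qed
  have "{k \<in> K. c k \<le> p} = (\<Union>m\<le>p. {k \<in> K. c k = m})" by auto
  then have finp: "finite {k \<in> K. c k \<le> p}" using fin by simp
  \<comment> \<open>From \<open>M\<close> on the steps in \<open>K\<close> have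
    \<open>c k > p\<close>, so both critical degrees \<open>2 * c k\<close> and
    \<open>2 * c k - 1\<close> exceed \<open>p\<close>.\<close>
  then obtain M where M: "\<And>k. k \<in> K \<Longrightarrow> c k \<le> p \<Longrightarrow> k < M"
    using finite_nat_set_iff_bounded[of "{k \<in> K. c k \<le> p}"] by auto
  have "homology_group (int p) (subtopology X (U M)) \<cong> homology_group (int p) X"
  proof (rule homology_increasing_union[OF op mono un])
    fix m assume m: "m \<ge> M"
    show "hom_induced (int p) (subtopology X (U m)) {} (subtopology X (U (Suc m))) {} id
        \<in> iso (homology_group (int p) (subtopology X (U m))) (homology_group (int p) (subtopology X (U (Suc m))))"
    proof (cases "m \<in> K")
      case False
      show ?thesis unfolding step[OF False] by (rule hom_induced_id_iso)
    next
      case True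
      then obtain C where C: "openin X C" "U (Suc m) = U m \<union> C"
        "\<And>p. relative_homology_group p (subtopology X C) (C \<inter> U m)
               \<cong> free_Abelian_group (if p = int (2 * c m) then {m} else {})"
        using cell by blast
      have "p < c m" using M[OF True] m by fastforce
      then have "int p \<noteq> int (2 * c m)" "int p \<noteq> int (2 * c m) - 1" by auto
      moreover have "m \<notin> ?F m" by simp
      ultimately show ?thesis
        using homology_attach_even_cell(2)[OF op C(1) C(3) IH, of "int p"] unfolding C(2) by blast
    qed
  qed
  moreover have "{t \<in> ?F M. int p = int (2 * c t)} = {k \<in> K. p = 2 * c k}"
    using M by auto
  ultimately show ?thesis
    using IH[of "int p" M] group.iso_sym[of "homology_group (int p) (subtopology X (U M))"] iso_trans
    by (metis (no_types, lifting) group_relative_homology_group)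
qed

lemma cohomology_rank_of_free_homology:
  assumes H: "\<And>p. homology_group (int p) X \<cong> free_Abelian_group (S p)" and fin: "\<And>p. finite (S p)"
  shows "abelian_rank (cohomology_group p X) = enat (card (S p))"
proof -
  obtain h where h: "\<And>p. h p \<in> iso (homology_group (int p) X) (free_Abelian_group (S p))"
  proof -
    have "\<exists>h. h \<in> iso (homology_group (int p) X) (free_Abelian_group (S p))" for p
      using H[of p] by (auto simp: is_iso_def)
    then show ?thesis using that by metis
  qed
  show ?thesis
    by (rule free_homology.abelian_rank_cohomology[OF free_homologyI[OF h] fin])
      (use free_homologyI[OF h] in blast)
qed

section \<open>Points of the Quot scheme as tuples of matrices and vectors\<close>

declare One_nat_def [simp del]

lemma poly_mapping_induct_keys:
  assumes "P 0" and "\<And>k c. k \<in> A \<Longrightarrow> P (Poly_Mapping.single k c)"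
    and "\<And>p q. P p \<Longrightarrow> P q \<Longrightarrow> P (p + q)" and "Poly_Mapping.keys p \<subseteq> A"
  shows "P (p :: 'a \<Rightarrow>\<^sub>0 'b::comm_monoid_add)"
proof -
  have "P (\<Sum>m\<in>S. Poly_Mapping.single m (Poly_Mapping.lookup p m))" if "finite S" "S \<subseteq> A" for S
    using that by (induction S rule: finite_induct) (use assms(1-3) in auto)
  from this[OF finite_keys assms(4)] have "P (\<Sum>m\<in>Poly_Mapping.keys p. Poly_Mapping.single m (Poly_Mapping.lookup p m))" .
  then show ?thesis unfolding poly_mapping_sum_singles .
qed

lemma lookup_map_zero: "f 0 = 0 \<Longrightarrow> Poly_Mapping.lookup (Poly_Mapping.map f p) k = f (Poly_Mapping.lookup p k)"
  by (simp add: map.rep_eq when_def)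

subsection \<open>Evaluation at matrices\<close>

text \<open>A \<open>2 \<times> 2\<close> matrix is the pair of its columns.\<close>

type_synonym cvec = "complex \<times> complex"
type_synonym cmat = "cvec \<times> cvec"

definition csc :: "complex \<Rightarrow> cvec \<Rightarrow> cvec" where
  "csc c w = (c * fst w, c * snd w)"

definition app :: "cmat \<Rightarrow> cvec \<Rightarrow> cvec" where
  "app A w = csc (fst w) (fst A) + csc (snd w) (snd A)"

lemma csc_simps [simp]: "fst (csc c w) = c * fst w" "snd (csc c w) = c * snd w"
  by (simp_all add: csc_def)

lemma app_simps [simp]:
  "fst (app A w) = fst w * fst (fst A) + snd w * fst (snd A)"
  "snd (app A w) = fst w * snd (fst A) + snd w * snd (snd A)"
  by (simp_all add: app_def)

lemma csc_algebra:
  "csc (c + c') w = csc c w + csc c' w" "csc c (w + w') = csc c w + csc c w'"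
  "csc c (csc c' w) = csc (c * c') w" "csc 0 w = 0" "csc c 0 = 0" "csc 1 w = w"
  by (simp_all add: prod_eq_iff algebra_simps)

lemma csc_sum: "csc c (\<Sum>x\<in>A. f x) = (\<Sum>x\<in>A. csc c (f x))"
  by (induction A rule: infinite_finite_induct) (simp_all add: csc_algebra)

lemma app_linear:
  "app A (w + w') = app A w + app A w'" "app A (csc c w) = csc c (app A w)" "app A 0 = 0" "app 0 w = 0"
  by (simp_all add: prod_eq_iff algebra_simps)

text \<open>The action of the monomial \<open>x\<^sup>m\<close>, in which variables other than \<open>x\<^sub>1, \<dots>, x\<^sub>n\<close> act as the identity.\<close>

primrec mact :: "(nat \<Rightarrow> cmat) \<Rightarrow> (nat \<Rightarrow>\<^sub>0 nat) \<Rightarrow> nat \<Rightarrow>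
    cvec \<Rightarrow> cvec" where
  "mact X m 0 w = w"
| "mact X m (Suc n) w = mact X m n ((app (X (Suc n)) ^^ Poly_Mapping.lookup m (Suc n)) w)"

definition pev :: "(nat \<Rightarrow> cmat) \<Rightarrow> nat \<Rightarrow> complex mpoly \<Rightarrow>
    cvec \<Rightarrow> cvec" where
  "pev X n p w = (\<Sum>m\<in>Poly_Mapping.keys p. csc (Poly_Mapping.lookup p m) (mact X m n w))"

text \<open>The module homomorphism to C^2 that sends the \<open>j\<close>-th unit vector to
  \<open>v j\<close> and lets x_b act as \<open>X b\<close>. For a tuple coming from a point of the
  Quot scheme it is the surjection whose kernel is that point.\<close>

definition ev :: "(nat \<Rightarrow> cmat) \<Rightarrow> (nat \<Rightarrow> cvec) \<Rightarrow>
    nat \<Rightarrow> (nat \<Rightarrow>\<^sub>0 complex mpoly) \<Rightarrow> cvec" where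
  "ev X v n g = (\<Sum>j\<in>Poly_Mapping.keys g. pev X n (Poly_Mapping.lookup g j) (v j))"

text \<open>Stated through the action on vectors, so that no matrix product has to be
  introduced.\<close>

definition commuting :: "(nat \<Rightarrow> cmat) \<Rightarrow> bool" where
  "commuting X \<longleftrightarrow> (\<forall>b c w. app (X b) (app (X c) w) = app (X c) (app (X b) w))"

lemma funpow_app_linear:
  "(app A ^^ k) (w + w') = (app A ^^ k) w + (app A ^^ k) w'" "(app A ^^ k) (csc c w) = csc c ((app A ^^ k) w)"
  by (induction k) (simp_all add: app_linear)

lemma mact_linear:
  "mact X m n (w + w') = mact X m n w + mact X m n w'" "mact X m n (csc c w) = csc c (mact X m n w)"
  by (induction n arbitrary: w w') (simp_all add: funpow_app_linear)

lemma mact_0 [simp]: "mact X m n 0 = 0"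
  using mact_linear(2)[of X m n 0 0] by (simp add: csc_algebra)

lemma mact_app: "commuting X \<Longrightarrow> mact X m n (app (X b) w) = app (X b) (mact X m n w)"
proof (induction n arbitrary: w)
  case (Suc n)
  have "(app (X c) ^^ k) (app (X b) w) = app (X b) ((app (X c) ^^ k) w)" for c k
  proof (induction k)
    case (Suc k)
    have "(app (X c) ^^ Suc k) (app (X b) w) = app (X c) (app (X b) ((app (X c) ^^ k) w))"
      using Suc by simp
    also have "\<dots> = app (X b) (app (X c) ((app (X c) ^^ k) w))"
      using \<open>commuting X\<close> unfolding commuting_def by blast
    finally show ?case by simp
  qed simp
  then show ?case using Suc by simp
qed simp

lemma mact_funpow: "commuting X \<Longrightarrow> mact X m n ((app (X b) ^^ k) w) = (app (X b) ^^ k) (mact X m n w)"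
  by (induction k) (simp_all add: mact_app)

lemma mact_add: "commuting X \<Longrightarrow> mact X (m + m') n w = mact X m n (mact X m' n w)"
  by (induction n arbitrary: w) (simp_all add: lookup_add funpow_add mact_funpow)

lemma mact_zero [simp]: "mact X 0 n w = w"
  by (induction n) simp_all

lemma mact_var: "1 \<le> b \<Longrightarrow> b \<le> n \<Longrightarrow> mact X (Poly_Mapping.single b 1) n w = app (X b) w"
proof (induction n arbitrary: w)
  case (Suc n)
  have *: "mact X (Poly_Mapping.single (Suc n) 1) k w = w" if "k \<le> n" for k w
    using that by (induction k) (simp_all add: lookup_single when_def)
  show ?case
  proof (cases "b = Suc n")
    case True
    then show ?thesis using *[of n] by (simp add: One_nat_def)
  next
    case False
    then show ?thesis using Suc by (simp add: lookup_single when_def)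
  qed
qed simp

lemma pev_superset:
  assumes "finite A" "Poly_Mapping.keys p \<subseteq> A"
  shows "pev X n p w = (\<Sum>m\<in>A. csc (Poly_Mapping.lookup p m) (mact X m n w))"
  unfolding pev_def using assms
  by (intro sum.mono_neutral_left) (auto simp: in_keys_iff csc_algebra)

lemma pev_add: "pev X n (p + q) w = pev X n p w + pev X n q w"
proof -
  let ?A = "Poly_Mapping.keys p \<union> Poly_Mapping.keys q"
  have "pev X n (p + q) w = (\<Sum>m\<in>?A. csc (Poly_Mapping.lookup (p + q) m) (mact X m n w))"
    by (rule pev_superset) (use Poly_Mapping.keys_add[of p q] in auto)
  also have "\<dots> = (\<Sum>m\<in>?A. csc (Poly_Mapping.lookup p m) (mact X m n w))
      + (\<Sum>m\<in>?A. csc (Poly_Mapping.lookup q m) (mact X m n w))"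
    by (simp add: lookup_add csc_algebra sum.distrib)
  finally show ?thesis using pev_superset[of ?A p X n w] pev_superset[of ?A q X n w] by simp
qed

lemma pev_zero [simp]: "pev X n 0 w = 0" by (simp add: pev_def)

lemma pev_single: "pev X n (Poly_Mapping.single m c) w = csc c (mact X m n w)"
  using pev_superset[of "{m}" "Poly_Mapping.single m c" X n w] by (simp split: if_splits)

lemma pev_linear:
  "pev X n p (w + w') = pev X n p w + pev X n p w'" "pev X n p (csc c w) = csc c (pev X n p w)"
  by (simp_all add: pev_def mact_linear csc_algebra sum.distrib csc_sum mult.commute)

lemma pev_0 [simp]: "pev X n p 0 = 0"
  by (simp add: pev_def csc_algebra)

lemma pev_mult:
  assumes X: "commuting X"
  shows "pev X n (p * q) w = pev X n p (pev X n q w)"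
proof (induction p rule: poly_mapping_induct_keys[where A = UNIV])
  case (2 m c)
  show ?case
  proof (induction q rule: poly_mapping_induct_keys[where A = UNIV])
    case (2 m' c')
    then show ?case using X by (simp add: mult_single pev_single mact_add mact_linear csc_algebra)
  qed (simp_all add: pev_add pev_linear distrib_left)
qed (simp_all add: pev_add distrib_right)

lemma ev_superset:
  assumes "finite A" "Poly_Mapping.keys g \<subseteq> A"
  shows "ev X v n g = (\<Sum>j\<in>A. pev X n (Poly_Mapping.lookup g j) (v j))"
  unfolding ev_def using assms
  by (intro sum.mono_neutral_left) (auto simp: in_keys_iff)

lemma ev_add: "ev X v n (g + h) = ev X v n g + ev X v n h"
proof -
  let ?A = "Poly_Mapping.keys g \<union> Poly_Mapping.keys h"
  have "ev X v n (g + h) = (\<Sum>j\<in>?A. pev X n (Poly_Mapping.lookup (g + h) j) (v j))"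
    by (rule ev_superset) (use Poly_Mapping.keys_add[of g h] in auto)
  also have "\<dots> = (\<Sum>j\<in>?A. pev X n (Poly_Mapping.lookup g j) (v j))
      + (\<Sum>j\<in>?A. pev X n (Poly_Mapping.lookup h j) (v j))"
    by (simp add: lookup_add pev_add sum.distrib)
  finally show ?thesis using ev_superset[of ?A g X v n] ev_superset[of ?A h X v n] by simp
qed

lemma ev_zero [simp]: "ev X v n 0 = 0" by (simp add: ev_def)

lemma ev_diff: "ev X v n (g - h) = ev X v n g - ev X v n h"
  using ev_add[of X v n "g - h" h] by simp

lemma ev_single: "ev X v n (Poly_Mapping.single j p) = pev X n p (v j)"
  using ev_superset[of "{j}" "Poly_Mapping.single j p" X v n] by (simp split: if_splits)

abbreviation smul :: "complex mpoly \<Rightarrow> (nat \<Rightarrow>\<^sub>0 complex mpoly) \<Rightarrow> (nat \<Rightarrow>\<^sub>0 complex mpoly)" where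
  "smul p \<equiv> Poly_Mapping.map ((*) p)"

lemma lookup_smul: "Poly_Mapping.lookup (smul p g) j = p * Poly_Mapping.lookup g j"
  by (simp add: lookup_map_zero)

lemma smul_algebra:
  "smul p (g + h) = smul p g + smul p h" "smul (p + q) g = smul p g + smul q g"
  "smul p (smul q g) = smul (p * q) g" "smul 1 g = g" "smul 0 g = 0"
  by (rule poly_mapping_eqI; simp add: lookup_smul lookup_add algebra_simps)+

lemma smul_uminus: "smul (mconst (- 1)) g = - g"
proof -
  have "mconst (- 1) = (- 1 :: complex mpoly)" by (simp add: mconst_def single_uminus flip: single_one)
  then show ?thesis by (intro poly_mapping_eqI) (simp add: lookup_smul)
qed

lemma smul_diff: "smul p (g - h) = smul p g - smul p h"
  by (rule poly_mapping_eqI) (simp add: lookup_smul lookup_minus algebra_simps)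

lemma ev_smul:
  assumes X: "commuting X"
  shows "ev X v n (smul p g) = pev X n p (ev X v n g)"
proof (induction g rule: poly_mapping_induct_keys[where A = UNIV])
  case 1
  have "smul p 0 = 0" by (rule poly_mapping_eqI) (simp add: lookup_smul)
  then show ?case by simp
next
  case (2 k c)
  have "smul p (Poly_Mapping.single k c) = Poly_Mapping.single k (p * c)"
    by (rule poly_mapping_eqI) (simp add: lookup_smul lookup_single when_def)
  then show ?case using X by (simp add: ev_single pev_mult)
qed (simp_all add: smul_algebra ev_add pev_linear)

lemma pev_mconst: "pev X n (mconst c) w = csc c w"
  by (simp add: mconst_def pev_single)

lemma ev_mconst: "commuting X \<Longrightarrow> ev X v n (smul (mconst c) g) = csc c (ev X v n g)"
  by (simp add: ev_smul pev_mconst)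

lemma ev_mvar: "commuting X \<Longrightarrow> 1 \<le> b \<Longrightarrow> b \<le> n \<Longrightarrow> ev X v n (smul (mvar b) g) = app (X b) (ev X v n g)"
  by (simp add: ev_smul mvar_def pev_single mact_var csc_algebra)

subsection \<open>The module of vectors\<close>

abbreviation Vec :: "nat \<Rightarrow> nat \<Rightarrow> (nat \<Rightarrow>\<^sub>0 complex mpoly) set" where
  "Vec n r \<equiv> carrier (vec_module n r)"

abbreviation unit_vec :: "nat \<Rightarrow> (nat \<Rightarrow>\<^sub>0 complex mpoly)" where
  "unit_vec k \<equiv> Poly_Mapping.single k 1"

lemma Vec_iff: "g \<in> Vec n r \<longleftrightarrow> Poly_Mapping.keys g \<subseteq> {1..r} \<and>
    (\<forall>j. Poly_Mapping.lookup g j \<in> carrier (mpoly_ring {1..n}))"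
  by (simp add: vec_module_def)

lemma mpoly_ring_closed:
  "p \<in> carrier (mpoly_ring V) \<Longrightarrow> q \<in> carrier (mpoly_ring V) \<Longrightarrow> p + q \<in> carrier (mpoly_ring V)"
  "p \<in> carrier (mpoly_ring V) \<Longrightarrow> - p \<in> carrier (mpoly_ring V)"
  "p \<in> carrier (mpoly_ring V) \<Longrightarrow> q \<in> carrier (mpoly_ring V) \<Longrightarrow> p * q \<in> carrier (mpoly_ring V)"
  "0 \<in> carrier (mpoly_ring V)" "1 \<in> carrier (mpoly_ring V)" "mconst c \<in> carrier (mpoly_ring V)"
  "b \<in> V \<Longrightarrow> mvar b \<in> carrier (mpoly_ring V)"
proof -
  show "p + q \<in> carrier (mpoly_ring V)" if "p \<in> carrier (mpoly_ring V)" "q \<in> carrier (mpoly_ring V)"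
    using that Poly_Mapping.keys_add[of p q] unfolding mpoly_ring_def by fastforce
  show "- p \<in> carrier (mpoly_ring V)" if "p \<in> carrier (mpoly_ring V)"
    using that by (simp add: mpoly_ring_def in_keys_iff)
  show "p * q \<in> carrier (mpoly_ring V)" if pq: "p \<in> carrier (mpoly_ring V)" "q \<in> carrier (mpoly_ring V)"
    unfolding mpoly_ring_def
  proof (simp, rule ballI)
    fix m assume "m \<in> Poly_Mapping.keys (p * q)"
    then obtain a b where "m = a + b" "a \<in> Poly_Mapping.keys p" "b \<in> Poly_Mapping.keys q"
      using keys_mult[of p q] by blast
    then show "Poly_Mapping.keys m \<subseteq> V"
      using pq Poly_Mapping.keys_add[of a b] unfolding mpoly_ring_def by fastforce
  qed
  show "b \<in> V \<Longrightarrow> mvar b \<in> carrier (mpoly_ring V)"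
    by (simp add: mpoly_ring_def mvar_def)
qed (simp_all add: mpoly_ring_def mconst_def)

lemma Vec_closed:
  "g \<in> Vec n r \<Longrightarrow> h \<in> Vec n r \<Longrightarrow> g + h \<in> Vec n r"
  "p \<in> carrier (mpoly_ring {1..n}) \<Longrightarrow> g \<in> Vec n r \<Longrightarrow> smul p g \<in> Vec n r"
  "0 \<in> Vec n r"
  "1 \<le> k \<Longrightarrow> k \<le> r \<Longrightarrow> unit_vec k \<in> Vec n r"
  "g \<in> Vec n r \<Longrightarrow> - g \<in> Vec n r"
  "g \<in> Vec n r \<Longrightarrow> h \<in> Vec n r \<Longrightarrow> g - h \<in> Vec n r"
proof -
  show add: "g + h \<in> Vec n r" if "g \<in> Vec n r" "h \<in> Vec n r" for g h
    using that Poly_Mapping.keys_add[of g h] by (auto simp: Vec_iff lookup_add intro!: mpoly_ring_closed)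
  show smul: "smul p g \<in> Vec n r" if "p \<in> carrier (mpoly_ring {1..n})" "g \<in> Vec n r" for p g
  proof -
    have "Poly_Mapping.keys (smul p g) \<subseteq> Poly_Mapping.keys g" by (auto simp: in_keys_iff lookup_smul)
    then show ?thesis using that by (auto simp: Vec_iff lookup_smul intro!: mpoly_ring_closed)
  qed
  show "0 \<in> Vec n r" by (simp add: Vec_iff mpoly_ring_closed)
  show "unit_vec k \<in> Vec n r" if "1 \<le> k" "k \<le> r"
    using that by (simp add: Vec_iff lookup_single when_def mpoly_ring_closed)
  show neg: "- g \<in> Vec n r" if "g \<in> Vec n r" for g
    unfolding smul_uminus[symmetric] by (rule smul[OF mpoly_ring_closed(6) that])
  show "g - h \<in> Vec n r" if "g \<in> Vec n r" "h \<in> Vec n r"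
    using add[OF that(1) neg[OF that(2)]] by simp
qed

lemma vec_module_simps:
  "\<zero>\<^bsub>vec_module n r\<^esub> = 0" "g \<oplus>\<^bsub>vec_module n r\<^esub> h = g + h" "p \<odot>\<^bsub>vec_module n r\<^esub> g = smul p g"
  by (simp_all add: vec_module_def)

lemma inv_vec_module: "g \<in> Vec n r \<Longrightarrow> inv\<^bsub>add_monoid (vec_module n r)\<^esub> g = - g"
  unfolding m_inv_def
proof (rule the_equality)
  assume g: "g \<in> Vec n r"
  show "- g \<in> carrier (add_monoid (vec_module n r)) \<and>
      g \<otimes>\<^bsub>add_monoid (vec_module n r)\<^esub> - g = \<one>\<^bsub>add_monoid (vec_module n r)\<^esub> \<and>
      - g \<otimes>\<^bsub>add_monoid (vec_module n r)\<^esub> g = \<one>\<^bsub>add_monoid (vec_module n r)\<^esub>"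
    using Vec_closed(5)[OF g] by (simp add: vec_module_simps)
  fix y assume "y \<in> carrier (add_monoid (vec_module n r)) \<and>
      g \<otimes>\<^bsub>add_monoid (vec_module n r)\<^esub> y = \<one>\<^bsub>add_monoid (vec_module n r)\<^esub> \<and>
      y \<otimes>\<^bsub>add_monoid (vec_module n r)\<^esub> g = \<one>\<^bsub>add_monoid (vec_module n r)\<^esub>"
  then have "g + y = 0" by (simp add: vec_module_simps)
  then show "y = - g" by (rule minus_unique[symmetric])
qed

lemma submodule_vec_iff:
  "submodule K (mpoly_ring {1..n}) (vec_module n r) \<longleftrightarrow> K \<subseteq> Vec n r \<and> 0 \<in> K \<and>
     (\<forall>g\<in>K. \<forall>h\<in>K. g + h \<in> K) \<and> (\<forall>p\<in>carrier (mpoly_ring {1..n}). \<forall>g\<in>K. smul p g \<in> K)"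
proof
  assume "submodule K (mpoly_ring {1..n}) (vec_module n r)"
  then show "K \<subseteq> Vec n r \<and> 0 \<in> K \<and>
     (\<forall>g\<in>K. \<forall>h\<in>K. g + h \<in> K) \<and> (\<forall>p\<in>carrier (mpoly_ring {1..n}). \<forall>g\<in>K. smul p g \<in> K)"
    unfolding submodule_def submodule_axioms_def subgroup_def by (auto simp: vec_module_simps)
next
  assume K: "K \<subseteq> Vec n r \<and> 0 \<in> K \<and>
     (\<forall>g\<in>K. \<forall>h\<in>K. g + h \<in> K) \<and> (\<forall>p\<in>carrier (mpoly_ring {1..n}). \<forall>g\<in>K. smul p g \<in> K)"
  have "- g \<in> K" if "g \<in> K" for g
    unfolding smul_uminus[symmetric] using K that mpoly_ring_closed(6) by blast
  moreover have "inv\<^bsub>add_monoid (vec_module n r)\<^esub> g = - g" if "g \<in> K" for g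
    using K that by (intro inv_vec_module) blast
  ultimately show "submodule K (mpoly_ring {1..n}) (vec_module n r)"
    unfolding submodule_def submodule_axioms_def subgroup_def using K
    by (simp add: vec_module_simps)
qed

subsection \<open>The kernel of evaluation\<close>

definition cdet :: "cvec \<Rightarrow> cvec \<Rightarrow> complex" where
  "cdet w w' = fst w * snd w' - snd w * fst w'"

definition cramer :: "cvec \<Rightarrow> cvec \<Rightarrow> cvec \<Rightarrow> cvec" where
  "cramer w w' z = (cdet z w' / cdet w w', cdet w z / cdet w w')"

lemma cramer_iff:
  assumes "cdet w w' \<noteq> 0"
  shows "z = csc (fst c) w + csc (snd c) w' \<longleftrightarrow> c = cramer w w' z"
proof
  assume "z = csc (fst c) w + csc (snd c) w'"
  then show "c = cramer w w' z"
    using assms by (simp add: cramer_def prod_eq_iff cdet_def field_simps)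
next
  assume c: "c = cramer w w' z"
  have "fst z * cdet w w' = cdet z w' * fst w + cdet w z * fst w'"
    "snd z * cdet w w' = cdet z w' * snd w + cdet w z * snd w'"
    by (simp_all add: cdet_def algebra_simps)
  then show "z = csc (fst c) w + csc (snd c) w'"
    using assms by (simp add: c cramer_def prod_eq_iff field_simps)
qed

lemma cdet_zero_dependent:
  assumes "cdet w w' = 0"
  shows "\<exists>c. c \<noteq> 0 \<and> csc (fst c) w + csc (snd c) w' = 0"
proof (cases "w = 0 \<and> w' = 0")
  case True
  then show ?thesis by (intro exI[of _ "(1, 0)"]) (simp add: csc_algebra prod_eq_iff)
next
  case False
  then consider "fst w \<noteq> 0 \<or> fst w' \<noteq> 0" | "snd w \<noteq> 0 \<or> snd w' \<noteq> 0" by (auto simp: prod_eq_iff)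
  then show ?thesis
  proof cases
    case 1
    then show ?thesis using assms
      by (intro exI[of _ "(fst w', - fst w)"]) (auto simp: prod_eq_iff cdet_def algebra_simps)
  next
    case 2
    then show ?thesis using assms
      by (intro exI[of _ "(snd w', - snd w)"]) (auto simp: prod_eq_iff cdet_def algebra_simps)
  qed
qed

definition ker_ev :: "nat \<Rightarrow> nat \<Rightarrow> (nat \<Rightarrow> cmat) \<Rightarrow>
    (nat \<Rightarrow> cvec) \<Rightarrow> (nat \<Rightarrow>\<^sub>0 complex mpoly) set" where
  "ker_ev n r X v = {g \<in> Vec n r. ev X v n g = 0}"

lemma submodule_ker_ev: "commuting X \<Longrightarrow> submodule (ker_ev n r X v) (mpoly_ring {1..n}) (vec_module n r)"
  unfolding submodule_vec_iff by (auto simp: ker_ev_def ev_add ev_smul Vec_closed)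

lemma quotient_coords_ker_ev:
  assumes X: "commuting X" and "e \<in> Vec n r" "e' \<in> Vec n r" "g \<in> Vec n r"
  shows "quotient_coords (ker_ev n r X v) e e' g c \<longleftrightarrow>
     ev X v n g = csc (fst c) (ev X v n e) + csc (snd c) (ev X v n e')"
  unfolding quotient_coords_def ker_ev_def using assms
  by (auto simp: ev_diff ev_add ev_mconst intro!: Vec_closed mpoly_ring_closed)

text \<open>\<open>ev\<close> embeds the quotient by its kernel into C^2. Uniqueness of the
  coordinates of 0 means that the two images are independent, and two independent vectors of C^2
  already give coordinates to every vector.\<close>

lemma quotient_basis_ker_ev:
  assumes X: "commuting X"
  shows "quotient_basis n r (ker_ev n r X v) e e' \<longleftrightarrow>
     e \<in> Vec n r \<and> e' \<in> Vec n r \<and> cdet (ev X v n e) (ev X v n e') \<noteq> 0"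
proof (cases "e \<in> Vec n r \<and> e' \<in> Vec n r")
  case True
  then have e: "e \<in> Vec n r" "e' \<in> Vec n r" by auto
  let ?E = "ev X v n e" and ?E' = "ev X v n e'"
  have "(\<forall>g\<in>Vec n r. \<exists>!c. quotient_coords (ker_ev n r X v) e e' g c) \<longleftrightarrow> cdet ?E ?E' \<noteq> 0"
  proof
    assume *: "\<forall>g\<in>Vec n r. \<exists>!c. quotient_coords (ker_ev n r X v) e e' g c"
    show "cdet ?E ?E' \<noteq> 0"
    proof
      assume "cdet ?E ?E' = 0"
      then obtain c where c: "c \<noteq> 0" "csc (fst c) ?E + csc (snd c) ?E' = 0"
        using cdet_zero_dependent by blast
      have "quotient_coords (ker_ev n r X v) e e' 0 c" "quotient_coords (ker_ev n r X v) e e' 0 0"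
        using c by (simp_all add: quotient_coords_ker_ev[OF X e] Vec_closed csc_algebra)
      then show False using * Vec_closed(3)[of n r] c(1) by blast
    qed
  next
    assume d: "cdet ?E ?E' \<noteq> 0"
    show "\<forall>g\<in>Vec n r. \<exists>!c. quotient_coords (ker_ev n r X v) e e' g c"
      by (simp add: quotient_coords_ker_ev[OF X e] cramer_iff[OF d])
  qed
  then show ?thesis using e by (simp add: quotient_basis_def)
qed (auto simp: quotient_basis_def)

lemma ker_ev_in_Quot2:
  assumes "commuting X" "e \<in> Vec n r" "e' \<in> Vec n r" "cdet (ev X v n e) (ev X v n e') \<noteq> 0"
  shows "ker_ev n r X v \<in> Quot2_points n r"
proof -
  have "quotient_basis n r (ker_ev n r X v) e e'" using assms by (simp add: quotient_basis_ker_ev)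
  then show ?thesis using submodule_ker_ev[OF assms(1)] by (auto simp: Quot2_points_def)
qed

text \<open>Indices out of range carry 0. Thus one tuple makes sense at every larger
  \<open>n\<close>, and equality of tuples is equality of functions.\<close>

definition supported :: "nat \<Rightarrow> nat \<Rightarrow> (nat \<Rightarrow> cmat) \<Rightarrow>
    (nat \<Rightarrow> cvec) \<Rightarrow> bool" where
  "supported n r X v \<longleftrightarrow> (\<forall>b. b \<notin> {1..n} \<longrightarrow> X b = 0) \<and> (\<forall>k. k \<notin> {1..r} \<longrightarrow> v k = 0) \<and> commuting X"

text \<open>\<open>THE\<close> is only meaningful if the classes of \<open>e\<close>, \<open>e'\<close> form a basis modulo \<open>K\<close>.\<close>

definition crd :: "(nat \<Rightarrow>\<^sub>0 complex mpoly) set \<Rightarrow> (nat \<Rightarrow>\<^sub>0 complex mpoly) \<Rightarrow> (nat \<Rightarrow>\<^sub>0 complex mpoly) \<Rightarrow>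
    (nat \<Rightarrow>\<^sub>0 complex mpoly) \<Rightarrow> cvec" where
  "crd K e e' g = (THE c. quotient_coords K e e' g c)"

definition op_of :: "nat \<Rightarrow> (nat \<Rightarrow>\<^sub>0 complex mpoly) set \<Rightarrow> (nat \<Rightarrow>\<^sub>0 complex mpoly) \<Rightarrow> (nat \<Rightarrow>\<^sub>0 complex mpoly) \<Rightarrow>
    nat \<Rightarrow> cmat" where
  "op_of n K e e' b = (if b \<in> {1..n} then (crd K e e' (smul (mvar b) e), crd K e e' (smul (mvar b) e')) else 0)"

definition vec_of :: "nat \<Rightarrow> (nat \<Rightarrow>\<^sub>0 complex mpoly) set \<Rightarrow> (nat \<Rightarrow>\<^sub>0 complex mpoly) \<Rightarrow> (nat \<Rightarrow>\<^sub>0 complex mpoly) \<Rightarrow>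
    nat \<Rightarrow> cvec" where
  "vec_of r K e e' k = (if k \<in> {1..r} then crd K e e' (unit_vec k) else 0)"

locale quot_basis =
  fixes n r :: nat and K and e e' :: "nat \<Rightarrow>\<^sub>0 complex mpoly"
  assumes K: "K \<in> Quot2_points n r" and basis: "quotient_basis n r K e e'"
begin

lemma e: "e \<in> Vec n r" "e' \<in> Vec n r" using basis by (auto simp: quotient_basis_def)

lemma sub: "K \<subseteq> Vec n r" "0 \<in> K" "g \<in> K \<Longrightarrow> h \<in> K \<Longrightarrow> g + h \<in> K"
  "p \<in> carrier (mpoly_ring {1..n}) \<Longrightarrow> g \<in> K \<Longrightarrow> smul p g \<in> K"
  using K by (auto simp: Quot2_points_def submodule_vec_iff)

definition comb :: "cvec \<Rightarrow> (nat \<Rightarrow>\<^sub>0 complex mpoly)" where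
  "comb c = smul (mconst (fst c)) e + smul (mconst (snd c)) e'"

lemma crd_iff: "g \<in> Vec n r \<Longrightarrow> crd K e e' g = c \<longleftrightarrow> g - comb c \<in> K"
proof -
  assume "g \<in> Vec n r"
  then have "\<exists>!c. quotient_coords K e e' g c" using basis by (simp add: quotient_basis_def)
  then show ?thesis unfolding crd_def comb_def quotient_coords_def[symmetric]
    by (metis theI')
qed

lemma crd: "g \<in> Vec n r \<Longrightarrow> g - comb (crd K e e' g) \<in> K"
  using crd_iff by blast

lemma mconst_algebra: "mconst (a + b) = mconst a + mconst b" "mconst (a * b) = mconst a * (mconst b :: complex mpoly)"
  "mconst 1 = (1 :: complex mpoly)" "mconst 0 = (0 :: complex mpoly)"
  by (simp_all add: mconst_def single_add mult_single)

lemma comb_Vec: "comb c \<in> Vec n r"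
  unfolding comb_def by (intro Vec_closed mpoly_ring_closed e)

lemma crd_add: "g \<in> Vec n r \<Longrightarrow> h \<in> Vec n r \<Longrightarrow> crd K e e' (g + h) = crd K e e' g + crd K e e' h"
proof -
  assume g: "g \<in> Vec n r" and h: "h \<in> Vec n r"
  have "comb (c + d) = comb c + comb d" for c d by (simp add: comb_def mconst_algebra smul_algebra)
  then have "g + h - comb (crd K e e' g + crd K e e' h) = (g - comb (crd K e e' g)) + (h - comb (crd K e e' h))"
    by simp
  also have "\<dots> \<in> K" using sub(3) crd g h by blast
  finally show ?thesis using crd_iff[OF Vec_closed(1)[OF g h]] by blast
qed

lemma crd_mconst: "g \<in> Vec n r \<Longrightarrow> crd K e e' (smul (mconst c) g) = csc c (crd K e e' g)"
proof -
  assume g: "g \<in> Vec n r"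
  have "comb (csc c d) = smul (mconst c) (comb d)" for d
    by (simp add: comb_def mconst_algebra smul_algebra)
  then have "smul (mconst c) g - comb (csc c (crd K e e' g)) = smul (mconst c) (g - comb (crd K e e' g))"
    by (simp add: smul_diff)
  also have "\<dots> \<in> K" using sub(4) mpoly_ring_closed(6) crd g by blast
  finally show ?thesis using crd_iff[OF Vec_closed(2)[OF mpoly_ring_closed(6) g]] by blast
qed

lemma crd_0_iff: "g \<in> Vec n r \<Longrightarrow> crd K e e' g = 0 \<longleftrightarrow> g \<in> K"
proof -
  have "comb 0 = 0" by (simp add: comb_def mconst_algebra smul_algebra)
  then show "g \<in> Vec n r \<Longrightarrow> crd K e e' g = 0 \<longleftrightarrow> g \<in> K" using crd_iff[of g 0] by simp
qed

lemma crd_comb: "crd K e e' (comb c) = c"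
  using crd_iff[OF comb_Vec] sub(2) by simp

lemma crd_basis: "crd K e e' e = (1, 0)" "crd K e e' e' = (0, 1)"
  using crd_comb[of "(1, 0)"] crd_comb[of "(0, 1)"] by (simp_all add: comb_def mconst_algebra smul_algebra)

lemma crd_cong: "g \<in> Vec n r \<Longrightarrow> h \<in> Vec n r \<Longrightarrow> g - h \<in> K \<Longrightarrow> crd K e e' g = crd K e e' h"
proof -
  assume g: "g \<in> Vec n r" and h: "h \<in> Vec n r" and d: "g - h \<in> K"
  have "crd K e e' ((g - h) + h) = crd K e e' (g - h) + crd K e e' h"
    using crd_add[OF Vec_closed(6)[OF g h] h] .
  then show ?thesis using crd_0_iff[OF Vec_closed(6)[OF g h]] d by simp
qed

lemma crd_smul_comb: "g \<in> Vec n r \<Longrightarrow> p \<in> carrier (mpoly_ring {1..n}) \<Longrightarrow>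
    crd K e e' (smul p g) = crd K e e' (smul p (comb (crd K e e' g)))"
proof (rule crd_cong)
  assume g: "g \<in> Vec n r" and p: "p \<in> carrier (mpoly_ring {1..n})"
  show "smul p g - smul p (comb (crd K e e' g)) \<in> K"
    unfolding smul_diff[symmetric] using sub(4) crd g p by blast
qed (simp_all add: Vec_closed comb_Vec)

abbreviation (input) "X \<equiv> op_of n K e e'"
abbreviation (input) "v \<equiv> vec_of r K e e'"

lemma crd_mvar:
  assumes g: "g \<in> Vec n r" and b: "b \<in> {1..n}"
  shows "crd K e e' (smul (mvar b) g) = app (X b) (crd K e e' g)"
proof -
  let ?c = "crd K e e' g"
  note mv = mpoly_ring_closed(7)[OF b]
  have "smul (mvar b) (comb ?c) = smul (mconst (fst ?c)) (smul (mvar b) e) + smul (mconst (snd ?c)) (smul (mvar b) e')"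
    by (simp add: comb_def smul_algebra mult.commute)
  moreover have m: "smul (mvar b) e \<in> Vec n r" "smul (mvar b) e' \<in> Vec n r"
    by (rule Vec_closed(2)[OF mv e(1)], rule Vec_closed(2)[OF mv e(2)])
  ultimately have "crd K e e' (smul (mvar b) (comb ?c))
      = crd K e e' (smul (mconst (fst ?c)) (smul (mvar b) e)) + crd K e e' (smul (mconst (snd ?c)) (smul (mvar b) e'))"
    using crd_add[OF Vec_closed(2)[OF mpoly_ring_closed(6) m(1)] Vec_closed(2)[OF mpoly_ring_closed(6) m(2)]]
    by (simp only:)
  then have "crd K e e' (smul (mvar b) (comb ?c))
      = csc (fst ?c) (crd K e e' (smul (mvar b) e)) + csc (snd ?c) (crd K e e' (smul (mvar b) e'))"
    unfolding crd_mconst[OF m(1)] crd_mconst[OF m(2)] .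
  then show ?thesis using crd_smul_comb[OF g mv] b by (simp add: app_def op_of_def)
qed

lemma commuting_X: "commuting X"
  unfolding commuting_def
proof (intro allI)
  fix b c w
  show "app (X b) (app (X c) w) = app (X c) (app (X b) w)"
  proof (cases "b \<in> {1..n} \<and> c \<in> {1..n}")
    case True
    then have b: "b \<in> {1..n}" and c: "c \<in> {1..n}" by auto
    have *: "crd K e e' (smul (mvar b') (smul (mvar c') (comb w))) = app (X b') (app (X c') w)"
      if "b' \<in> {1..n}" "c' \<in> {1..n}" for b' c'
      using that by (simp add: crd_mvar crd_comb comb_Vec Vec_closed mpoly_ring_closed)
    have "smul (mvar b) (smul (mvar c) (comb w)) = smul (mvar c) (smul (mvar b) (comb w))"
      by (simp add: smul_algebra mult.commute)
    then show ?thesis using *[OF b c] *[OF c b] by simp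
  next
    case False
    then have "X b = 0 \<or> X c = 0" by (auto simp: op_of_def)
    then show ?thesis by (auto simp: app_linear)
  qed
qed

lemma supported: "supported n r X v"
  unfolding supported_def using commuting_X by (auto simp: op_of_def vec_of_def)

lemma crd_smul:
  assumes p: "p \<in> carrier (mpoly_ring {1..n})" and h: "h \<in> Vec n r"
  shows "crd K e e' (smul p h) = pev X n p (crd K e e' h)"
proof -
  \<comment> \<open>Membership in the ring belongs to the predicate: in a product of monomials the
    outer one acts on the result of the inner one, which must be known to lie in the module.\<close>
  define ok where "ok m \<longleftrightarrow> Poly_Mapping.single m 1 \<in> carrier (mpoly_ring {1..n} :: complex mpoly ring) \<and>
      (\<forall>h\<in>Vec n r. crd K e e' (smul (Poly_Mapping.single m 1) h) = mact X m n (crd K e e' h))" for m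
  have add: "ok (m + m')" if "ok m" "ok m'" for m m'
  proof -
    have eq: "Poly_Mapping.single (m + m') 1 = Poly_Mapping.single m 1 * (Poly_Mapping.single m' 1 :: complex mpoly)"
      by (simp add: mult_single)
    show ?thesis unfolding ok_def
    proof (intro conjI ballI)
      show "Poly_Mapping.single (m + m') 1 \<in> carrier (mpoly_ring {1..n} :: complex mpoly ring)"
        unfolding eq by (rule mpoly_ring_closed(3)) (use that in \<open>auto simp: ok_def\<close>)
      fix h assume h: "h \<in> Vec n r"
      have h': "smul (Poly_Mapping.single m' 1) h \<in> Vec n r"
        by (rule Vec_closed(2)[OF _ h]) (use that in \<open>simp add: ok_def\<close>)
      have "crd K e e' (smul (Poly_Mapping.single (m + m') 1) h)
          = crd K e e' (smul (Poly_Mapping.single m 1) (smul (Poly_Mapping.single m' 1) h))"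
        by (simp only: eq smul_algebra(3))
      also have "\<dots> = mact X m n (crd K e e' (smul (Poly_Mapping.single m' 1) h))"
        using that(1) h' unfolding ok_def by blast
      also have "crd K e e' (smul (Poly_Mapping.single m' 1) h) = mact X m' n (crd K e e' h)"
        using that(2) h unfolding ok_def by blast
      finally show "crd K e e' (smul (Poly_Mapping.single (m + m') 1) h) = mact X (m + m') n (crd K e e' h)"
        by (simp only: mact_add[OF commuting_X])
    qed
  qed
  have zero: "ok 0" unfolding ok_def by (simp add: mpoly_ring_closed smul_algebra)
  have var: "ok (Poly_Mapping.single b 1)" if b: "b \<in> {1..n}" for b
    using b mpoly_ring_closed(7)[OF b] crd_mvar[OF _ b] mact_var[of b n]
    by (auto simp: ok_def mvar_def)
  have "ok (Poly_Mapping.single b k)" if b: "b \<in> {1..n}" for b k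
  proof (induction k)
    case (Suc k)
    then show ?case using add[OF Suc var[OF b]] by (simp add: One_nat_def flip: single_add)
  qed (simp add: zero)
  note sing = this
  have mono: "ok m" if m: "Poly_Mapping.keys m \<subseteq> {1..n}" for m :: "nat \<Rightarrow>\<^sub>0 nat"
    by (rule poly_mapping_induct_keys[where P = ok and A = "{1..n}" and p = m]) (fact zero, fact sing, fact add, fact m)
  have "p \<in> carrier (mpoly_ring {1..n}) \<and> crd K e e' (smul p h) = pev X n p (crd K e e' h)"
  proof (rule poly_mapping_induct_keys[where A = "{m. Poly_Mapping.keys m \<subseteq> {1..n}}" and p = p])
    show "0 \<in> carrier (mpoly_ring {1..n}) \<and> crd K e e' (smul 0 h) = pev X n 0 (crd K e e' h)"
      using crd_0_iff[OF Vec_closed(3)] sub(2) by (simp add: mpoly_ring_closed smul_algebra)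
    show "Poly_Mapping.keys p \<subseteq> {m. Poly_Mapping.keys m \<subseteq> {1..n}}" using p by (auto simp: mpoly_ring_def)
  next
    fix m :: "nat \<Rightarrow>\<^sub>0 nat" and c :: complex assume "m \<in> {m. Poly_Mapping.keys m \<subseteq> {1..n}}"
    then have m: "ok m" using mono by simp
    have eq: "Poly_Mapping.single m c = mconst c * Poly_Mapping.single m 1"
      by (simp add: mconst_def mult_single)
    show "Poly_Mapping.single m c \<in> carrier (mpoly_ring {1..n}) \<and>
        crd K e e' (smul (Poly_Mapping.single m c) h) = pev X n (Poly_Mapping.single m c) (crd K e e' h)"
    proof
      have m1: "Poly_Mapping.single m 1 \<in> carrier (mpoly_ring {1..n} :: complex mpoly ring)" using m by (simp add: ok_def)
      show "Poly_Mapping.single m c \<in> carrier (mpoly_ring {1..n})"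
        unfolding eq by (rule mpoly_ring_closed(3)[OF mpoly_ring_closed(6) m1])
      have "crd K e e' (smul (Poly_Mapping.single m c) h) = crd K e e' (smul (mconst c) (smul (Poly_Mapping.single m 1) h))"
        by (simp only: eq smul_algebra(3))
      also have "\<dots> = csc c (crd K e e' (smul (Poly_Mapping.single m 1) h))"
        by (rule crd_mconst[OF Vec_closed(2)[OF m1 h]])
      finally show "crd K e e' (smul (Poly_Mapping.single m c) h) = pev X n (Poly_Mapping.single m c) (crd K e e' h)"
        using m h by (simp add: ok_def pev_single)
    qed
  next
    fix p q
    assume "p \<in> carrier (mpoly_ring {1..n}) \<and> crd K e e' (smul p h) = pev X n p (crd K e e' h)"
      and "q \<in> carrier (mpoly_ring {1..n}) \<and> crd K e e' (smul q h) = pev X n q (crd K e e' h)"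
    then show "p + q \<in> carrier (mpoly_ring {1..n}) \<and> crd K e e' (smul (p + q) h) = pev X n (p + q) (crd K e e' h)"
      using h by (simp add: mpoly_ring_closed smul_algebra crd_add Vec_closed pev_add)
  qed
  then show ?thesis by blast
qed

text \<open>Taking coordinates is linear over the polynomial ring acting on C^2 through
  \<open>X\<close>, so it agrees with evaluation as soon as it does so on the unit vectors.\<close>

lemma crd_eq_ev: "g \<in> Vec n r \<Longrightarrow> crd K e e' g = ev X v n g"
proof -
  assume g: "g \<in> Vec n r"
  have part: "(\<Sum>j\<in>S. Poly_Mapping.single j (Poly_Mapping.lookup g j)) \<in> Vec n r \<and>
      crd K e e' (\<Sum>j\<in>S. Poly_Mapping.single j (Poly_Mapping.lookup g j))
        = (\<Sum>j\<in>S. pev X n (Poly_Mapping.lookup g j) (v j))"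
    if "finite S" "S \<subseteq> {1..r}" for S
    using that
  proof (induction S rule: finite_induct)
    case empty
    then show ?case using crd_0_iff[OF Vec_closed(3)] sub(2) by (simp add: Vec_closed)
  next
    case (insert j S)
    have eq: "Poly_Mapping.single j (Poly_Mapping.lookup g j) = smul (Poly_Mapping.lookup g j) (unit_vec j)"
      by (rule poly_mapping_eqI) (simp add: lookup_smul lookup_single when_def)
    have gj: "Poly_Mapping.lookup g j \<in> carrier (mpoly_ring {1..n})" using g by (simp add: Vec_iff)
    have j: "unit_vec j \<in> Vec n r" using insert.prems by (intro Vec_closed(4)) auto
    have "crd K e e' (unit_vec j) = v j" using insert.prems by (simp add: vec_of_def)
    moreover have "smul (Poly_Mapping.lookup g j) (unit_vec j) \<in> Vec n r" by (rule Vec_closed(2)[OF gj j])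
    ultimately show ?case
      using insert crd_smul[OF gj j] crd_add Vec_closed(1) unfolding sum.insert[OF insert.hyps] eq by simp
  qed
  have k: "finite (Poly_Mapping.keys g)" "Poly_Mapping.keys g \<subseteq> {1..r}" using g by (auto simp: Vec_iff)
  show ?thesis using part[OF k] unfolding ev_def poly_mapping_sum_singles by blast
qed

lemma K_eq: "K = ker_ev n r X v"
proof (rule Set.set_eqI)
  fix g
  show "g \<in> K \<longleftrightarrow> g \<in> ker_ev n r X v"
  proof (cases "g \<in> Vec n r")
    case True
    then show ?thesis using crd_0_iff[OF True] crd_eq_ev[OF True] by (simp add: ker_ev_def)
  next
    case False
    then show ?thesis using sub(1) by (auto simp: ker_ev_def)
  qed
qed

end

declare Poly_Mapping.map_single [simp del]

subsection \<open>The embeddings\<close>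

lemma lookup_set_zero:
  "Poly_Mapping.lookup (set_zero i p) m = (if Poly_Mapping.lookup m i = 0 then Poly_Mapping.lookup p m else 0)"
proof -
  have "Poly_Mapping.lookup (set_zero i p) m
      = (\<Sum>m'\<in>{m \<in> Poly_Mapping.keys p. Poly_Mapping.lookup m i = 0}. if m = m' then Poly_Mapping.lookup p m' else 0)"
    unfolding set_zero_def lookup_sum by (intro sum.cong) (auto simp: lookup_single when_def)
  also have "\<dots> = (if Poly_Mapping.lookup m i = 0 then Poly_Mapping.lookup p m else 0)"
    by (simp add: in_keys_iff)
  finally show ?thesis .
qed

lemma set_zero_0 [simp]: "set_zero i 0 = 0"
  by (simp add: set_zero_def)

text \<open>A monomial containing the last variable acts as 0, and dropping these monomials is what
  \<open>set_zero\<close> does.\<close>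

lemma pev_Suc:
  assumes "X (Suc n) = 0"
  shows "pev X (Suc n) p w = pev X n (set_zero (Suc n) p) w"
proof -
  have mact: "mact X m (Suc n) w = (if Poly_Mapping.lookup m (Suc n) = 0 then mact X m n w else 0)" for m
    using assms by (cases "Poly_Mapping.lookup m (Suc n)") (simp_all add: app_linear)
  have "pev X n (set_zero (Suc n) p) w
      = (\<Sum>m\<in>Poly_Mapping.keys p. csc (Poly_Mapping.lookup (set_zero (Suc n) p) m) (mact X m n w))"
    by (rule pev_superset) (auto simp: in_keys_iff lookup_set_zero split: if_splits)
  also have "\<dots> = pev X (Suc n) p w"
    unfolding pev_def by (intro sum.cong) (simp_all only: mact lookup_set_zero, simp add: csc_algebra)
  finally show ?thesis by simp
qed

lemma ev_Suc:
  assumes "X (Suc n) = 0"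
  shows "ev X v (Suc n) g = ev X v n (Poly_Mapping.map (set_zero (Suc n)) g)"
proof -
  have "ev X v n (Poly_Mapping.map (set_zero (Suc n)) g)
      = (\<Sum>j\<in>Poly_Mapping.keys g. pev X n (Poly_Mapping.lookup (Poly_Mapping.map (set_zero (Suc n)) g) j) (v j))"
    by (rule ev_superset) (auto simp: in_keys_iff lookup_map_zero)
  then show ?thesis unfolding ev_def by (simp add: lookup_map_zero pev_Suc[where X = X and n = n, OF assms])
qed

lemma map_set_zero_Vec: "g \<in> Vec (Suc n) r \<Longrightarrow> Poly_Mapping.map (set_zero (Suc n)) g \<in> Vec n r"
proof -
  assume g: "g \<in> Vec (Suc n) r"
  have "set_zero (Suc n) p \<in> carrier (mpoly_ring {1..n})" if p: "p \<in> carrier (mpoly_ring {1..Suc n})" for p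
  proof -
    have "Poly_Mapping.keys m \<subseteq> {1..n}" if "m \<in> Poly_Mapping.keys (set_zero (Suc n) p)" for m
    proof -
      have "m \<in> Poly_Mapping.keys p" "Suc n \<notin> Poly_Mapping.keys m"
        using that by (auto simp: in_keys_iff lookup_set_zero split: if_splits)
      then have "Poly_Mapping.keys m \<subseteq> {1..Suc n} - {Suc n}" using p by (auto simp: mpoly_ring_def)
      also have "\<dots> = {1..n}" by auto
      finally show ?thesis .
    qed
    then show ?thesis by (simp add: mpoly_ring_def)
  qed
  moreover have "Poly_Mapping.keys (Poly_Mapping.map (set_zero (Suc n)) g) \<subseteq> Poly_Mapping.keys g"
    by (auto simp: in_keys_iff lookup_map_zero)
  ultimately show ?thesis using g by (auto simp: Vec_iff lookup_map_zero)
qed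

text \<open>In terms of tuples the embedding is extension by a zero matrix, which leaves a supported
  tuple unchanged as a function.\<close>

lemma Quot2_embed_ker_ev:
  assumes "X (Suc n) = 0"
  shows "Quot2_embed r n (ker_ev n r X v) = ker_ev (Suc n) r X v"
  unfolding Quot2_embed_def ker_ev_def using ev_Suc[of X n v] assms map_set_zero_Vec by auto

section \<open>Charts and their coordinates\<close>

text \<open>The chart of a pivot pair \<open>i < J\<close>, \<open>1 \<le> i \<le> r\<close>: the first basis vector is the class of the \<open>i\<close>-th
  unit vector; the second is that of the \<open>J\<close>-th unit vector if \<open>J \<le> r\<close>, and of \<open>x\<^sub>J\<^sub>-\<^sub>r\<close> times the \<open>i\<close>-th
  unit vector otherwise.\<close>

definition piv_vec :: "nat \<Rightarrow> nat \<Rightarrow> nat \<Rightarrow> (nat \<Rightarrow>\<^sub>0 complex mpoly)" where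
  "piv_vec r i J = (if J \<le> r then unit_vec J else smul (mvar (J - r)) (unit_vec i))"

definition piv_det :: "nat \<Rightarrow> nat \<Rightarrow> nat \<Rightarrow> (nat \<Rightarrow> cmat) \<Rightarrow>
    (nat \<Rightarrow> cvec) \<Rightarrow> complex" where
  "piv_det r i J X v = cdet (v i) (if J \<le> r then v J else app (X (J - r)) (v i))"

definition pivot :: "nat \<Rightarrow> nat \<Rightarrow> nat \<Rightarrow> bool" where
  "pivot r i J \<longleftrightarrow> 1 \<le> i \<and> i \<le> r \<and> i < J"

definition chart :: "nat \<Rightarrow> nat \<Rightarrow> nat \<Rightarrow> nat \<Rightarrow> (nat \<Rightarrow>\<^sub>0 complex mpoly) set set" where
  "chart n r i J = {K \<in> Quot2_points n r. quotient_basis n r K (unit_vec i) (piv_vec r i J)}"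

lemma ev_unit_vec: "ev X v n (unit_vec k) = v k"
proof -
  have "(1 :: complex mpoly) = Poly_Mapping.single 0 1" by simp
  then show ?thesis unfolding ev_single using pev_single[of X n 0 1] by (simp add: csc_algebra)
qed

lemma ev_piv_vec:
  "commuting X \<Longrightarrow> J \<le> r + n \<Longrightarrow> ev X v n (piv_vec r i J) = (if J \<le> r then v J else app (X (J - r)) (v i))"
  by (simp add: piv_vec_def ev_unit_vec ev_mvar)

text \<open>The variable of index \<open>J - r\<close> is available only from level
  \<open>n = J - r\<close> on; at lower levels the chart is empty.\<close>

lemma piv_vec_Vec: "pivot r i J \<Longrightarrow> piv_vec r i J \<in> Vec n r \<longleftrightarrow> J \<le> r + n"
proof -
  assume P: "pivot r i J"
  show ?thesis
  proof (cases "J \<le> r")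
    case True
    then show ?thesis using P Vec_closed(4)[of J r n] by (simp add: piv_vec_def pivot_def)
  next
    case False
    have "J - r \<in> {1..n}" if "piv_vec r i J \<in> Vec n r"
    proof -
      have "Poly_Mapping.lookup (piv_vec r i J) i = mvar (J - r)"
        using False by (simp add: piv_vec_def lookup_smul)
      then have "mvar (J - r) \<in> carrier (mpoly_ring {1..n} :: complex mpoly ring)"
        using that by (metis Vec_iff)
      then show ?thesis by (simp add: mvar_def mpoly_ring_def)
    qed
    moreover have "piv_vec r i J \<in> Vec n r" if "J - r \<in> {1..n}"
      using that False P Vec_closed(2)[OF mpoly_ring_closed(7) Vec_closed(4)] by (simp add: piv_vec_def pivot_def)
    moreover have "J - r \<in> {1..n} \<longleftrightarrow> J \<le> r + n" using False by auto
    ultimately show ?thesis by blast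
  qed
qed

lemma unit_vec_Vec: "pivot r i J \<Longrightarrow> unit_vec i \<in> Vec n r"
  by (rule Vec_closed(4)) (auto simp: pivot_def)

lemma chart_iff:
  assumes S: "supported n r X v" and P: "pivot r i J"
  shows "ker_ev n r X v \<in> chart n r i J \<longleftrightarrow> piv_det r i J X v \<noteq> 0"
proof -
  have X: "commuting X" using S by (simp add: supported_def)
  show ?thesis
  proof (cases "J \<le> r + n")
    case True
    have e: "unit_vec i \<in> Vec n r" "piv_vec r i J \<in> Vec n r"
      using unit_vec_Vec[OF P] piv_vec_Vec[OF P] True by auto
    have "quotient_basis n r (ker_ev n r X v) (unit_vec i) (piv_vec r i J) \<longleftrightarrow> piv_det r i J X v \<noteq> 0"
      using e by (simp add: quotient_basis_ker_ev[OF X] ev_unit_vec ev_piv_vec[OF X True] piv_det_def)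
    moreover have "ker_ev n r X v \<in> Quot2_points n r" if "piv_det r i J X v \<noteq> 0"
      using that by (intro ker_ev_in_Quot2[OF X e]) (simp add: ev_unit_vec ev_piv_vec[OF X True] piv_det_def)
    ultimately show ?thesis by (auto simp: chart_def)
  next
    \<comment> \<open>Both sides fail here: the matrix of the missing variable is 0, so the
      determinant vanishes, and the second basis vector is not in the module.\<close>
    case False
    then have "J - r \<notin> {1..n}" by auto
    then have "X (J - r) = 0" using S unfolding supported_def by blast
    then have "piv_det r i J X v = 0" using False by (simp add: piv_det_def app_linear cdet_def)
    moreover have "piv_vec r i J \<notin> Vec n r" using piv_vec_Vec[OF P] False by simp
    ultimately show ?thesis by (auto simp: chart_def quotient_basis_def)
  qed
qed

lemma Quot2_points_cases:
  assumes "K \<in> Quot2_points n r"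
  obtains X v where "supported n r X v" "K = ker_ev n r X v"
proof -
  obtain e e' where "quotient_basis n r K e e'" using assms by (auto simp: Quot2_points_def)
  then interpret quot_basis n r K e e' using assms by unfold_locales
  show ?thesis using that supported K_eq by blast
qed

lemma mact_invariant:
  assumes "\<And>b w. w \<in> L \<Longrightarrow> app (X b) w \<in> L" "w \<in> L"
  shows "mact X m n w \<in> L"
  using assms(2)
proof (induction n arbitrary: w)
  case (Suc n)
  have "(app (X (Suc n)) ^^ k) w \<in> L" for k by (induction k) (use Suc.prems assms(1) in auto)
  then show ?case using Suc.IH by simp
qed simp

text \<open>If all pivot determinants vanish, the line through a nonzero \<open>v i\<close> contains
  every \<open>v k\<close> and is stable under every matrix. The evaluation map then takes values in
  that line, where no two vectors are independent.\<close>

lemma chart_cover: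
  assumes "K \<in> Quot2_points n r"
  shows "\<exists>i J. pivot r i J \<and> K \<in> chart n r i J"
proof (rule ccontr)
  assume no: "\<not> ?thesis"
  obtain X v where S: "supported n r X v" and K: "K = ker_ev n r X v" using Quot2_points_cases[OF assms] .
  have X: "commuting X" using S by (simp add: supported_def)
  have zero: "piv_det r i J X v = 0" if "pivot r i J" for i J
    using no that chart_iff[OF S that] K by auto
  obtain e e' where e: "quotient_basis n r (ker_ev n r X v) e e'" using assms K by (auto simp: Quot2_points_def)
  then have d: "cdet (ev X v n e) (ev X v n e') \<noteq> 0" by (simp add: quotient_basis_ker_ev[OF X])
  show False
  proof (cases "\<exists>i. v i \<noteq> 0")
    case False
    then have "ev X v n g = 0" for g by (simp add: ev_def)
    then show False using d by (simp add: cdet_def)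
  next
    case True
    then obtain i where i: "v i \<noteq> 0" by blast
    then have ir: "1 \<le> i" "i \<le> r" using S by (force simp: supported_def)+
    define L where "L = {w. cdet (v i) w = 0}"
    have L: "0 \<in> L" "w \<in> L \<Longrightarrow> w' \<in> L \<Longrightarrow> w + w' \<in> L" "w \<in> L \<Longrightarrow> csc c w \<in> L" for w w' c
      by (auto simp: L_def cdet_def algebra_simps)
    have vL: "v k \<in> L" for k
    proof (cases "k \<in> {1..r}")
      case True
      consider "k < i" | "k = i" | "i < k" by linarith
      then show ?thesis
      proof cases
        case 1
        then have "piv_det r k i X v = 0" using zero[of k i] True ir by (auto simp: pivot_def)
        then show ?thesis using ir by (simp add: L_def piv_det_def cdet_def algebra_simps)
      next
        case 3
        then have "piv_det r i k X v = 0" using zero[of i k] True ir by (auto simp: pivot_def)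
        then show ?thesis using True by (simp add: L_def piv_det_def cdet_def)
      qed (simp add: L_def cdet_def)
    next
      case False
      then have "v k = 0" using S by (simp add: supported_def)
      then show ?thesis using L(1) by simp
    qed
    have span: "\<exists>c. w = csc c (v i)" if "w \<in> L" for w
    proof -
      have eq: "fst (v i) * snd w = snd (v i) * fst w" using that by (simp add: L_def cdet_def)
      show ?thesis
      proof (cases "fst (v i) = 0")
        case True
        then have "snd (v i) \<noteq> 0" using i by (auto simp: prod_eq_iff)
        then show ?thesis using eq True by (intro exI[of _ "snd w / snd (v i)"]) (auto simp: prod_eq_iff)
      next
        case False
        then show ?thesis using eq by (intro exI[of _ "fst w / fst (v i)"]) (auto simp: prod_eq_iff field_simps)
      qed
    qed
    have Xv: "app (X b) (v i) \<in> L" for b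
    proof (cases "b \<in> {1..n}")
      case True
      have "pivot r i (r + b)" using True ir by (auto simp: pivot_def)
      from zero[OF this] show ?thesis using True by (simp add: L_def piv_det_def)
    next
      case False
      then have "X b = 0" using S by (simp add: supported_def)
      then show ?thesis using L(1) by (simp add: app_linear)
    qed
    have XL: "app (X b) w \<in> L" if w: "w \<in> L" for b w
    proof -
      obtain c where "w = csc c (v i)" using span[OF w] by blast
      then have "app (X b) w = csc c (app (X b) (v i))" by (simp only: app_linear)
      then show ?thesis using L(3)[OF Xv] by (simp only:)
    qed
    have sumL: "(\<Sum>x\<in>A. f x) \<in> L" if "\<And>x. x \<in> A \<Longrightarrow> f x \<in> L" for f :: "'z \<Rightarrow> cvec" and A
      using that by (induction A rule: infinite_finite_induct) (auto intro: L)
    have "pev X n p (v k) \<in> L" for p k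
      unfolding pev_def by (intro sumL L(3) mact_invariant XL vL)
    then have evL: "ev X v n g \<in> L" for g unfolding ev_def by (intro sumL)
    obtain c c' where "ev X v n e = csc c (v i)" "ev X v n e' = csc c' (v i)"
      using span[OF evL] by meson
    then show False using d by (simp add: cdet_def)
  qed
qed

text \<open>A normal form for the action of GL_2: the change of basis is used up by making the two
  pivot columns the standard basis.\<close>

definition slice :: "nat \<Rightarrow> nat \<Rightarrow> nat \<Rightarrow> (nat \<Rightarrow> cmat) \<Rightarrow>
    (nat \<Rightarrow> cvec) \<Rightarrow> bool" where
  "slice r i J X v \<longleftrightarrow> v i = (1, 0) \<and> (if J \<le> r then v J else fst (X (J - r))) = (0, 1)"

definition chart_op :: "nat \<Rightarrow> nat \<Rightarrow> nat \<Rightarrow> nat \<Rightarrow> (nat \<Rightarrow>\<^sub>0 complex mpoly) set \<Rightarrow>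
    nat \<Rightarrow> cmat" where
  "chart_op n r i J K = op_of n K (unit_vec i) (piv_vec r i J)"

definition chart_vec :: "nat \<Rightarrow> nat \<Rightarrow> nat \<Rightarrow> (nat \<Rightarrow>\<^sub>0 complex mpoly) set \<Rightarrow> nat \<Rightarrow> cvec" where
  "chart_vec r i J K = vec_of r K (unit_vec i) (piv_vec r i J)"

lemma app_unit: "app A (1, 0) = fst A" "app A (0, 1) = snd A"
  by (simp_all add: prod_eq_iff)

lemma slice_piv_det: "slice r i J X v \<Longrightarrow> piv_det r i J X v = 1"
  by (simp add: slice_def piv_det_def app_unit cdet_def split: if_splits)

lemma slice_bound: "supported n r X v \<Longrightarrow> slice r i J X v \<Longrightarrow> J \<le> r + n"
proof (rule ccontr)
  assume S: "supported n r X v" "slice r i J X v" "\<not> J \<le> r + n"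
  then have "J - r \<notin> {1..n}" by auto
  then have "X (J - r) = 0" using S(1) unfolding supported_def by blast
  then show False using S by (simp add: slice_def prod_eq_iff)
qed

lemma chart_coordinates:
  assumes P: "pivot r i J" and K: "K \<in> chart n r i J"
  shows "supported n r (chart_op n r i J K) (chart_vec r i J K)"
    and "slice r i J (chart_op n r i J K) (chart_vec r i J K)"
    and "ker_ev n r (chart_op n r i J K) (chart_vec r i J K) = K"
proof -
  interpret quot_basis n r K "unit_vec i" "piv_vec r i J"
    using K by unfold_locales (auto simp: chart_def)
  show "supported n r (chart_op n r i J K) (chart_vec r i J K)"
    unfolding chart_op_def chart_vec_def by (rule supported)
  show "ker_ev n r (chart_op n r i J K) (chart_vec r i J K) = K"
    unfolding chart_op_def chart_vec_def by (rule K_eq[symmetric])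
  have J: "J \<le> r + n" using e(2) piv_vec_Vec[OF P] by simp
  show "slice r i J (chart_op n r i J K) (chart_vec r i J K)"
  proof (cases "J \<le> r")
    case True
    then have "piv_vec r i J = unit_vec J" by (simp add: piv_vec_def)
    then show ?thesis using True P crd_basis
      by (simp add: slice_def chart_op_def chart_vec_def vec_of_def pivot_def)
  next
    case False
    then have eq: "piv_vec r i J = smul (mvar (J - r)) (unit_vec i)" by (simp add: piv_vec_def)
    have J': "J - r \<in> {1..n}" using False J by auto
    show ?thesis using False P crd_basis J'
      by (simp add: slice_def chart_op_def chart_vec_def vec_of_def op_of_def pivot_def flip: eq)
  qed
qed

text \<open>Together with \<open>chart_coordinates\<close> this identifies a chart with its
  normalised tuples. The pivot vectors evaluate to the standard basis of C^2, so coordinates modulo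
  the kernel are the values of \<open>ev\<close>.\<close>

lemma coordinates_ker_ev:
  assumes P: "pivot r i J" and S: "supported n r X v" and sl: "slice r i J X v"
  shows "chart_op n r i J (ker_ev n r X v) = X" and "chart_vec r i J (ker_ev n r X v) = v"
    and "ker_ev n r X v \<in> chart n r i J"
proof -
  have X: "commuting X" using S by (simp add: supported_def)
  have J: "J \<le> r + n" by (rule slice_bound[OF S sl])
  have e: "unit_vec i \<in> Vec n r" "piv_vec r i J \<in> Vec n r"
    using unit_vec_Vec[OF P] piv_vec_Vec[OF P] J by auto
  have ev: "ev X v n (unit_vec i) = (1, 0)" "ev X v n (piv_vec r i J) = (0, 1)"
    using sl by (simp_all add: ev_unit_vec ev_piv_vec[OF X J] slice_def app_unit split: if_splits)
  have crd: "crd (ker_ev n r X v) (unit_vec i) (piv_vec r i J) g = ev X v n g" if "g \<in> Vec n r" for g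
    unfolding crd_def
  proof (rule the_equality)
    have "csc (fst c) (1, 0) + csc (snd c) (0, 1) = c" for c by (simp add: prod_eq_iff)
    then show "quotient_coords (ker_ev n r X v) (unit_vec i) (piv_vec r i J) g (ev X v n g)"
      "\<And>c. quotient_coords (ker_ev n r X v) (unit_vec i) (piv_vec r i J) g c \<Longrightarrow> c = ev X v n g"
      by (simp_all add: quotient_coords_ker_ev[OF X e that] ev)
  qed
  show "ker_ev n r X v \<in> chart n r i J"
    using chart_iff[OF S P] slice_piv_det[OF sl] by simp
  show "chart_vec r i J (ker_ev n r X v) = v"
  proof
    fix k
    show "chart_vec r i J (ker_ev n r X v) k = v k"
    proof (cases "k \<in> {1..r}")
      case True
      then have "unit_vec k \<in> Vec n r" by (intro Vec_closed(4)) auto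
      then show ?thesis using True by (simp add: chart_vec_def vec_of_def crd ev_unit_vec)
    next
      case False
      then have "v k = 0" using S unfolding supported_def by blast
      then show ?thesis unfolding chart_vec_def vec_of_def if_not_P[OF False] by simp
    qed
  qed
  show "chart_op n r i J (ker_ev n r X v) = X"
  proof
    fix b
    show "chart_op n r i J (ker_ev n r X v) b = X b"
    proof (cases "b \<in> {1..n}")
      case True
      have m: "smul (mvar b) g \<in> Vec n r" if "g \<in> Vec n r" for g
        by (rule Vec_closed(2)[OF mpoly_ring_closed(7)[OF True] that])
      have b: "1 \<le> b" "b \<le> n" using True by auto
      show ?thesis using True e
        by (simp add: chart_op_def op_of_def crd m ev_mvar[OF X b] ev app_unit)
    next
      case False
      then have "X b = 0" using S unfolding supported_def by blast
      then show ?thesis unfolding chart_op_def op_of_def if_not_P[OF False] by simp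
    qed
  qed
qed

subsection \<open>Continuity\<close>

lemma continuous_map_tendsto:
  "continuous_map T euclidean f \<longleftrightarrow> (\<forall>x\<in>topspace T. (f \<longlongrightarrow> f x) (atin T x))"
  by (simp add: continuous_map_atin)

lemma continuous_map_fst_euclidean: "continuous_map T euclidean f \<Longrightarrow> continuous_map T euclidean (\<lambda>t. fst (f t))"
  by (simp add: continuous_map_tendsto tendsto_fst)

lemma continuous_map_snd_euclidean: "continuous_map T euclidean f \<Longrightarrow> continuous_map T euclidean (\<lambda>t. snd (f t))"
  by (simp add: continuous_map_tendsto tendsto_snd)

lemma continuous_map_Pair_euclidean:
  "continuous_map T euclidean f \<Longrightarrow> continuous_map T euclidean g \<Longrightarrow> continuous_map T euclidean (\<lambda>t. (f t, g t))"
  by (simp add: continuous_map_tendsto tendsto_Pair)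

lemma continuous_map_times_euclidean:
  fixes f :: "'a \<Rightarrow> 'b::real_normed_algebra"
  shows "continuous_map T euclidean f \<Longrightarrow> continuous_map T euclidean g \<Longrightarrow> continuous_map T euclidean (\<lambda>t. f t * g t)"
  by (simp add: continuous_map_tendsto tendsto_mult)

lemma continuous_map_minus_euclidean:
  fixes f :: "'a \<Rightarrow> 'b::real_normed_vector"
  shows "continuous_map T euclidean f \<Longrightarrow> continuous_map T euclidean g \<Longrightarrow> continuous_map T euclidean (\<lambda>t. f t - g t)"
  by (simp add: continuous_map_tendsto tendsto_diff)

lemma continuous_map_divide_euclidean:
  fixes f :: "'a \<Rightarrow> complex"
  shows "continuous_map T euclidean f \<Longrightarrow> continuous_map T euclidean g \<Longrightarrow> (\<And>t. t \<in> topspace T \<Longrightarrow> g t \<noteq> 0) \<Longrightarrow>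
    continuous_map T euclidean (\<lambda>t. f t / g t)"
  by (simp add: continuous_map_tendsto tendsto_divide)

lemma continuous_map_complex_of_real:
  "continuous_map T euclidean f \<Longrightarrow> continuous_map T euclidean (\<lambda>t. complex_of_real (f t))"
  by (simp add: continuous_map_tendsto tendsto_of_real)

lemma continuous_map_const_euclidean: "continuous_map T euclidean (\<lambda>t. c)"
  by simp

lemmas continuous_map_euclidean_intros =
  continuous_map_fst_euclidean continuous_map_snd_euclidean continuous_map_Pair_euclidean
  continuous_map_times_euclidean continuous_map_minus_euclidean continuous_map_add
  continuous_map_complex_of_real continuous_map_const_euclidean

lemma continuous_map_csc:
  "continuous_map T euclidean f \<Longrightarrow> continuous_map T euclidean g \<Longrightarrow> continuous_map T euclidean (\<lambda>t. csc (f t) (g t))"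
  unfolding csc_def by (intro continuous_map_euclidean_intros)

lemma continuous_map_app:
  "continuous_map T euclidean f \<Longrightarrow> continuous_map T euclidean g \<Longrightarrow> continuous_map T euclidean (\<lambda>t. app (f t) (g t))"
  unfolding app_def by (intro continuous_map_euclidean_intros continuous_map_csc)

lemma continuous_map_sum_euclidean:
  fixes f :: "'i \<Rightarrow> 'a \<Rightarrow> 'b::real_normed_vector"
  shows "(\<And>i. i \<in> A \<Longrightarrow> continuous_map T euclidean (f i)) \<Longrightarrow> continuous_map T euclidean (\<lambda>t. \<Sum>i\<in>A. f i t)"
  by (induction A rule: infinite_finite_induct) (auto intro: continuous_map_add)

lemma continuous_map_mact:
  assumes X: "\<And>b. continuous_map T euclidean (\<lambda>t. X t b)" and w: "continuous_map T euclidean w"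
  shows "continuous_map T euclidean (\<lambda>t. mact (X t) m n (w t))"
  using w
proof (induction n arbitrary: w)
  case (Suc n)
  have "continuous_map T euclidean (\<lambda>t. (app (X t (Suc n)) ^^ k) (w t))" for k
    by (induction k) (simp_all add: Suc.prems continuous_map_app X)
  then show ?case using Suc.IH by simp
qed simp

lemma continuous_map_ev:
  assumes "\<And>b. continuous_map T euclidean (\<lambda>t. X t b)" "\<And>k. continuous_map T euclidean (\<lambda>t. v t k)"
  shows "continuous_map T euclidean (\<lambda>t. ev (X t) (v t) n g)"
  unfolding ev_def pev_def
  by (intro continuous_map_sum_euclidean continuous_map_csc continuous_map_const_euclidean
      continuous_map_mact assms)

lemma continuous_map_cdet:
  "continuous_map T euclidean f \<Longrightarrow> continuous_map T euclidean g \<Longrightarrow> continuous_map T euclidean (\<lambda>t. cdet (f t) (g t))"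
  unfolding cdet_def by (intro continuous_map_euclidean_intros)

text \<open>By Cramer's rule the coordinates that define a subbasic set are quotients of
  determinants. They are continuous where the denominator \<open>D\<close> is nonzero, and that
  locus is open.\<close>

lemma continuous_map_ker_ev:
  assumes cont: "\<And>b. continuous_map T euclidean (\<lambda>t. X t b)" "\<And>k. continuous_map T euclidean (\<lambda>t. v t k)"
    and comm: "\<And>t. t \<in> topspace T \<Longrightarrow> commuting (X t)"
    and pts: "\<And>t. t \<in> topspace T \<Longrightarrow> ker_ev n r (X t) (v t) \<in> Quot2_points n r"
  shows "continuous_map T (Quot2 n r) (\<lambda>t. ker_ev n r (X t) (v t))"
  unfolding Quot2_def
proof (rule continuous_on_generated_topo)
  let ?S = "{Quot2_subbasic n r e e' g W |e e' g W. g \<in> Vec n r \<and> open W}"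
  have "\<Union>?S = Quot2_points n r"
    using topspace_Quot2[of n r] unfolding Quot2_def topology_generated_by_topspace .
  then show "(\<lambda>t. ker_ev n r (X t) (v t)) ` topspace T \<subseteq> \<Union>?S"
    using image_subsetI[of "topspace T" "\<lambda>t. ker_ev n r (X t) (v t)" "Quot2_points n r", OF pts] by (simp only:)
  fix U assume "U \<in> ?S"
  then obtain e e' g W where U: "U = Quot2_subbasic n r e e' g W" and g: "g \<in> Vec n r" and W: "open W"
    unfolding mem_Collect_eq by (elim exE conjE)
  show "openin T ((\<lambda>t. ker_ev n r (X t) (v t)) -` U \<inter> topspace T)"
  proof (cases "e \<in> Vec n r \<and> e' \<in> Vec n r")
    case False
    then have "U = {}" by (auto simp: U Quot2_subbasic_def quotient_basis_def)
    then show ?thesis by simp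
  next
    case True
    then have e: "e \<in> Vec n r" "e' \<in> Vec n r" by auto
    let ?E = "\<lambda>t. ev (X t) (v t) n e" and ?E' = "\<lambda>t. ev (X t) (v t) n e'" and ?G = "\<lambda>t. ev (X t) (v t) n g"
    define D where "D t = cdet (?E t) (?E' t)" for t
    note ev = continuous_map_ev[where X = X and v = v and n = n and T = T, OF cont]
    have D: "continuous_map T euclidean D"
      unfolding D_def by (intro continuous_map_cdet ev)
    define T0 where "T0 = {t \<in> topspace T. D t \<in> - {0}}"
    have T0: "openin T T0"
      unfolding T0_def by (rule openin_continuous_map_preimage[OF D]) auto
    have sub: "continuous_map (subtopology T T0) euclidean f" if "continuous_map T euclidean f" for f :: "_ \<Rightarrow> complex"
      using that by (rule continuous_map_from_subtopology)
    have "continuous_map (subtopology T T0) euclidean (\<lambda>t. cramer (?E t) (?E' t) (?G t))"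
      unfolding cramer_def
    proof (rule continuous_map_Pair_euclidean)
      have nz: "cdet (?E t) (?E' t) \<noteq> 0" if "t \<in> topspace (subtopology T T0)" for t
        using that by (simp add: T0_def D_def)
      show "continuous_map (subtopology T T0) euclidean (\<lambda>t. cdet (?G t) (?E' t) / cdet (?E t) (?E' t))"
        by (rule continuous_map_divide_euclidean[OF sub sub nz]) (intro continuous_map_cdet ev)+
      show "continuous_map (subtopology T T0) euclidean (\<lambda>t. cdet (?E t) (?G t) / cdet (?E t) (?E' t))"
        by (rule continuous_map_divide_euclidean[OF sub sub nz]) (intro continuous_map_cdet ev)+
    qed
    then have "openin (subtopology T T0) {t \<in> topspace (subtopology T T0). cramer (?E t) (?E' t) (?G t) \<in> W}"
      by (rule openin_continuous_map_preimage) (use W in simp)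
    then have "openin T {t \<in> topspace (subtopology T T0). cramer (?E t) (?E' t) (?G t) \<in> W}"
      by (rule openin_trans_full[OF _ T0])
    moreover have "(\<lambda>t. ker_ev n r (X t) (v t)) -` U \<inter> topspace T
        = {t \<in> topspace (subtopology T T0). cramer (?E t) (?E' t) (?G t) \<in> W}"
    proof -
      have "ker_ev n r (X t) (v t) \<in> U \<longleftrightarrow> D t \<noteq> 0 \<and> cramer (?E t) (?E' t) (?G t) \<in> W"
        if t: "t \<in> topspace T" for t
      proof -
        note X = comm[OF t]
        have "ker_ev n r (X t) (v t) \<in> U \<longleftrightarrow> D t \<noteq> 0 \<and> (\<exists>c\<in>W. ?G t = csc (fst c) (?E t) + csc (snd c) (?E' t))"
          using e pts[OF t] by (simp add: U Quot2_subbasic_def quotient_basis_ker_ev[OF X] D_def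
              quotient_coords_ker_ev[OF X e g])
        also have "\<dots> \<longleftrightarrow> D t \<noteq> 0 \<and> cramer (?E t) (?E' t) (?G t) \<in> W"
        proof (cases "D t = 0")
          case False
          show ?thesis unfolding cramer_iff[OF False[unfolded D_def], of "?G t"] by blast
        qed simp
        finally show ?thesis .
      qed
      then show ?thesis by (auto simp: T0_def)
    qed
    ultimately show ?thesis by simp
  qed
qed

lemma openin_Quot2_subbasic:
  "g \<in> Vec n r \<Longrightarrow> open W \<Longrightarrow> openin (Quot2 n r) (Quot2_subbasic n r e e' g W)"
  unfolding Quot2_def by (rule topology_generated_by_Basis) blast

lemma crd_unique: "quotient_basis n r K e e' \<Longrightarrow> g \<in> Vec n r \<Longrightarrow> quotient_coords K e e' g c \<longleftrightarrow> crd K e e' g = c"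
  unfolding quotient_basis_def crd_def by (metis theI')

lemma Quot2_subbasic_crd:
  assumes "g \<in> Vec n r"
  shows "Quot2_subbasic n r e e' g W
    = {K \<in> Quot2_points n r. quotient_basis n r K e e' \<and> crd K e e' g \<in> W}"
  unfolding Quot2_subbasic_def by (auto simp: crd_unique[OF _ assms])

text \<open>A chart is itself subbasic, with the void condition \<open>UNIV\<close> on the
  coordinates.\<close>

lemma openin_chart: "openin (Quot2 n r) (chart n r i J)"
proof (cases "unit_vec i \<in> Vec n r")
  case True
  have "chart n r i J = Quot2_subbasic n r (unit_vec i) (piv_vec r i J) (unit_vec i) UNIV"
    by (simp add: Quot2_subbasic_crd[OF True] chart_def)
  then show ?thesis using openin_Quot2_subbasic[OF True] by simp
next
  case False
  then have "chart n r i J = {}" by (auto simp: chart_def quotient_basis_def)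
  then show ?thesis by simp
qed

text \<open>Built into the topology: the preimage of an open set under a coordinate map is a
  subbasic set.\<close>

lemma continuous_map_crd:
  assumes g: "g \<in> Vec n r"
  shows "continuous_map (subtopology (Quot2 n r) (chart n r i J)) euclidean
    (\<lambda>K. crd K (unit_vec i) (piv_vec r i J) g)"
  unfolding continuous_map
proof (intro conjI allI impI)
  let ?T = "subtopology (Quot2 n r) (chart n r i J)"
  have top: "topspace ?T = chart n r i J" by (auto simp: topspace_Quot2 chart_def)
  fix W :: "cvec set" assume "openin euclidean W"
  then have W: "open W" by simp
  have "{K \<in> topspace ?T. crd K (unit_vec i) (piv_vec r i J) g \<in> W}
      = Quot2_subbasic n r (unit_vec i) (piv_vec r i J) g W"
    unfolding top by (auto simp: Quot2_subbasic_crd[OF g] chart_def)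
  moreover have "Quot2_subbasic n r (unit_vec i) (piv_vec r i J) g W \<subseteq> chart n r i J"
    by (auto simp: Quot2_subbasic_crd[OF g] chart_def)
  ultimately show "openin ?T {K \<in> topspace ?T. crd K (unit_vec i) (piv_vec r i J) g \<in> W}"
    using openin_Quot2_subbasic[OF g W] openin_open_subtopology[OF openin_chart] by simp
qed simp

lemma continuous_map_chart_vec:
  "continuous_map (subtopology (Quot2 n r) (chart n r i J)) euclidean (\<lambda>K. chart_vec r i J K k)"
proof (cases "k \<in> {1..r}")
  case True
  then have "unit_vec k \<in> Vec n r" by (intro Vec_closed(4)) auto
  from continuous_map_crd[OF this] show ?thesis using True by (simp add: chart_vec_def vec_of_def)
next
  case False
  show ?thesis unfolding chart_vec_def vec_of_def if_not_P[OF False] by simp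
qed

lemma continuous_map_chart_op:
  assumes P: "pivot r i J"
  shows "continuous_map (subtopology (Quot2 n r) (chart n r i J)) euclidean (\<lambda>K. chart_op n r i J K b)"
proof (cases "b \<in> {1..n} \<and> J \<le> r + n")
  case True
  have "smul (mvar b) g \<in> Vec n r" if "g \<in> Vec n r" for g
    using True that by (intro Vec_closed(2) mpoly_ring_closed(7)) auto
  note m = this
  have "piv_vec r i J \<in> Vec n r" using piv_vec_Vec[OF P] True by blast
  then have "smul (mvar b) (unit_vec i) \<in> Vec n r" "smul (mvar b) (piv_vec r i J) \<in> Vec n r"
    using m unit_vec_Vec[OF P] by blast+
  from continuous_map_Pair_euclidean[OF this[THEN continuous_map_crd]]
  show ?thesis unfolding chart_op_def op_of_def using True by (simp only: if_True conj_absorb)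
next
  case False
  then consider "b \<notin> {1..n}" | "chart n r i J = {}"
    using piv_vec_Vec[OF P] by (auto simp: chart_def quotient_basis_def)
  then show ?thesis
  proof cases
    case 1
    show ?thesis unfolding chart_op_def op_of_def if_not_P[OF 1] by simp
  next
    case 2
    then show ?thesis by (simp add: continuous_map_def)
  qed
qed

subsection \<open>Normal and tangential coordinates on a chart\<close>

text \<open>For a chart with pivots \<open>i < J\<close> think of the \<open>2 \<times> \<infinity>\<close> matrix with columns \<open>v\<^sub>1, \<dots>, v\<^sub>r\<close> followed by the
  first columns of the \<open>X\<^sub>b\<close>. The entries left of the pivots are the coordinates transverse to the locus
  where no smaller pivot pair is available; all other coordinates can be scaled to \<open>0\<close>.\<close>

definition ucol :: "nat \<Rightarrow> (nat \<Rightarrow> cmat) \<Rightarrow> (nat \<Rightarrow> cvec) \<Rightarrow>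
    nat \<Rightarrow> cvec" where
  "ucol r X v k = (if k \<le> r then v k else fst (X (k - r)))"

text \<open>A pivot and the entries to its left are kept, the entries to its right are scaled. The
  first row has its pivot in column \<open>i\<close>, the second in column \<open>J\<close>.\<close>

definition scale_vec :: "nat \<Rightarrow> nat \<Rightarrow> real \<Rightarrow> (nat \<Rightarrow> cvec) \<Rightarrow> nat \<Rightarrow> cvec" where
  "scale_vec i J \<tau> v k =
     (complex_of_real (if k \<le> i then 1 else \<tau>) * fst (v k), complex_of_real (if k \<le> J then 1 else \<tau>) * snd (v k))"

text \<open>On a chart of the second kind every \<open>X\<^sub>b\<close> is \<open>\<alpha> + \<beta> X\<^sub>a\<close>, where \<open>(\<alpha>, \<beta>)\<close> is its first column and
  \<open>a = J - r\<close>; scaling acts on the \<open>\<alpha>\<close>, \<open>\<beta>\<close> and on the second column \<open>(s, t)\<close> of \<open>X\<^sub>a\<close>.\<close>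

definition scale_op :: "nat \<Rightarrow> nat \<Rightarrow> real \<Rightarrow> (nat \<Rightarrow> cmat) \<Rightarrow>
    nat \<Rightarrow> cmat" where
  "scale_op r J \<tau> X b =
     (if J \<le> r then (csc (complex_of_real \<tau>) (fst (X b)), csc (complex_of_real \<tau>) (snd (X b)))
      else let \<alpha> = complex_of_real \<tau> * fst (fst (X b));
               \<beta> = complex_of_real (if r + b \<le> J then 1 else \<tau>) * snd (fst (X b));
               s = complex_of_real \<tau> * fst (snd (X (J - r)));
               t = complex_of_real \<tau> * snd (snd (X (J - r)))
           in ((\<alpha>, \<beta>), (\<beta> * s, \<alpha> + \<beta> * t)))"

lemma scale_op_second:
  assumes "\<not> J \<le> r"
  shows "fst (scale_op r J \<tau> X b) =
      (complex_of_real \<tau> * fst (fst (X b)), complex_of_real (if r + b \<le> J then 1 else \<tau>) * snd (fst (X b)))"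
    and "snd (scale_op r J \<tau> X b) =
      (snd (fst (scale_op r J \<tau> X b)) * (complex_of_real \<tau> * fst (snd (X (J - r)))),
       fst (fst (scale_op r J \<tau> X b)) + snd (fst (scale_op r J \<tau> X b)) * (complex_of_real \<tau> * snd (snd (X (J - r)))))"
  using assms by (simp_all add: scale_op_def Let_def)

text \<open>A common factor keeps a commuting tuple commuting. In the other case all scaled matrices
  are combinations of the identity and one companion matrix with columns (0, 1) and (s, t), so they
  commute for any coefficients.\<close>

lemma commuting_scale_op:
  assumes "commuting X"
  shows "commuting (scale_op r J \<tau> X)"
proof (cases "J \<le> r")
  case True
  have "scale_op r J \<tau> X b = (csc (complex_of_real \<tau>) (fst (X b)), csc (complex_of_real \<tau>) (snd (X b)))" for b
    using True by (simp add: scale_op_def)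
  then have eq: "app (scale_op r J \<tau> X b) w = csc (complex_of_real \<tau>) (app (X b) w)" for b w
    by (simp add: prod_eq_iff algebra_simps)
  have "app (X b) (app (X c) w) = app (X c) (app (X b) w)" for b c w
    using assms unfolding commuting_def by blast
  then show ?thesis unfolding commuting_def eq by (simp only: app_linear simp_thms)
next
  case False
  show ?thesis unfolding commuting_def
    by (intro allI prod_eqI) (simp_all add: scale_op_second(2)[OF False] algebra_simps)
qed

lemma supported_scale:
  assumes S: "supported n r X v"
  shows "supported n r (scale_op r J \<tau> X) (scale_vec i J \<tau> v)"
proof -
  have "scale_op r J \<tau> X b = 0" if "b \<notin> {1..n}" for b
  proof -
    have "X b = 0" using S that unfolding supported_def by blast
    then show ?thesis by (simp add: scale_op_def Let_def prod_eq_iff)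
  qed
  moreover have "scale_vec i J \<tau> v k = 0" if "k \<notin> {1..r}" for k
  proof -
    have "v k = 0" using S that unfolding supported_def by blast
    then show ?thesis by (simp add: scale_vec_def prod_eq_iff)
  qed
  moreover have "commuting (scale_op r J \<tau> X)"
    using S by (intro commuting_scale_op) (simp add: supported_def)
  ultimately show ?thesis unfolding supported_def by blast
qed

lemma slice_scale:
  assumes P: "pivot r i J" and sl: "slice r i J X v"
  shows "slice r i J (scale_op r J \<tau> X) (scale_vec i J \<tau> v)"
  using P sl unfolding slice_def pivot_def
  by (auto simp: scale_vec_def scale_op_second prod_eq_iff)

lemma scale_one:
  assumes P: "pivot r i J" and S: "supported n r X v" and sl: "slice r i J X v"
  shows "scale_op r J 1 X = X" and "scale_vec i J 1 v = v"
proof -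
  show "scale_vec i J 1 v = v" by (simp add: scale_vec_def fun_eq_iff prod_eq_iff)
  show "scale_op r J 1 X = X"
  proof (cases "J \<le> r")
    case True
    then show ?thesis by (simp add: scale_op_def fun_eq_iff csc_algebra)
  next
    case False
    have X: "commuting X" using S by (simp add: supported_def)
    have a: "fst (X (J - r)) = (0, 1)" using sl False by (simp add: slice_def)
    show ?thesis
    proof
      fix b
      \<comment> \<open>The vector (0, 1) is the image of (1, 0) under the pivot matrix, so by
        commutativity the first column of \<open>X b\<close> determines its second column.\<close>
      have "app (X b) (app (X (J - r)) (1, 0)) = app (X (J - r)) (app (X b) (1, 0))"
        using X unfolding commuting_def by blast
      then have "snd (X b) = app (X (J - r)) (fst (X b))" by (simp only: app_unit a)
      then show "scale_op r J 1 X b = X b"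
        by (intro prod_eqI) (simp_all add: scale_op_second[OF False] a)
    qed
  qed
qed

section \<open>The transverse coordinates and their section\<close>

text \<open>The list consists of the \<open>i - 1\<close> first-row entries of the columns before
  \<open>i\<close>, the second-row entries of the same columns, and the \<open>J - i - 1\<close>
  second-row entries of the columns strictly between \<open>i\<close> and \<open>J\<close>: together
  i + J - 3 complex numbers. Columns are numbered from 1, positions from 0.\<close>

definition normal_entry :: "nat \<Rightarrow> nat \<Rightarrow> (nat \<Rightarrow> cmat) \<Rightarrow>
    (nat \<Rightarrow> cvec) \<Rightarrow> nat \<Rightarrow> complex" where
  "normal_entry r i X v m =
     (if m < i - 1 then fst (ucol r X v (m + 1))
      else if m < 2 * (i - 1) then snd (ucol r X v (m - (i - 1) + 1))
      else snd (ucol r X v (m - (i - 1) + 2)))"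

text \<open>Real and imaginary parts are interleaved and padded by 0, as a point of
  \<open>Euclidean_space\<close> of dimension \<open>2 * (i + J - 3)\<close> requires.\<close>

definition normal_coords :: "nat \<Rightarrow> nat \<Rightarrow> nat \<Rightarrow> (nat \<Rightarrow> cmat) \<Rightarrow>
    (nat \<Rightarrow> cvec) \<Rightarrow> nat \<Rightarrow> real" where
  "normal_coords r i J X v l =
     (if l < 2 * (i + J - 3) then (if even l then Re else Im) (normal_entry r i X v (l div 2)) else 0)"

definition normal_complex :: "(nat \<Rightarrow> real) \<Rightarrow> nat \<Rightarrow> complex" where
  "normal_complex y m = Complex (y (2 * m)) (y (2 * m + 1))"

text \<open>Columns with the prescribed transverse entries, pivots 1 and all other entries 0.
  Between the pivots the shift is \<open>k - 2\<close>, because column \<open>i\<close> is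
  skipped.\<close>

definition section_col :: "nat \<Rightarrow> nat \<Rightarrow> (nat \<Rightarrow> real) \<Rightarrow> nat \<Rightarrow> cvec" where
  "section_col i J y k =
     (if k < i then normal_complex y (k - 1) else if k = i then 1 else 0,
      if k < i then normal_complex y (i - 1 + (k - 1)) else if k = i then 0
      else if k < J then normal_complex y (i - 1 + (k - 2)) else if k = J then 1 else 0)"

definition section_vec :: "nat \<Rightarrow> nat \<Rightarrow> nat \<Rightarrow> (nat \<Rightarrow> real) \<Rightarrow> nat \<Rightarrow> cvec" where
  "section_vec r i J y k = (if k \<in> {1..r} then section_col i J y k else 0)"

text \<open>Only the lower left entry can be nonzero, so the product of any two of these matrices is
  0 and the tuple commutes. Index 0 stands for no variable.\<close>

definition section_op :: "nat \<Rightarrow> nat \<Rightarrow> nat \<Rightarrow> (nat \<Rightarrow> real) \<Rightarrow> nat \<Rightarrow> cmat" where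
  "section_op r i J y b = (if b = 0 then 0 else ((0, snd (section_col i J y (r + b))), 0))"

lemma supported_section:
  assumes P: "pivot r i J" and J: "J \<le> r + n"
  shows "supported n r (section_op r i J y) (section_vec r i J y)"
proof -
  have "section_op r i J y b = 0" if "b \<notin> {1..n}" for b
  proof (cases "b = 0")
    case False
    then have "J < r + b" using that J by auto
    then show ?thesis using P False by (auto simp: section_op_def section_col_def pivot_def prod_eq_iff)
  qed (simp add: section_op_def)
  moreover have "section_vec r i J y k = 0" if "k \<notin> {1..r}" for k
    using that unfolding section_vec_def by (rule if_not_P)
  moreover have "commuting (section_op r i J y)"
    unfolding commuting_def by (intro allI prod_eqI) (simp_all add: section_op_def)
  ultimately show ?thesis unfolding supported_def by blast
qed

lemma slice_section:
  assumes P: "pivot r i J"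
  shows "slice r i J (section_op r i J y) (section_vec r i J y)"
  using P by (auto simp: slice_def section_vec_def section_op_def section_col_def pivot_def)

lemma ucol_section:
  assumes "pivot r i J" "1 \<le> k"
  shows "snd (ucol r (section_op r i J y) (section_vec r i J y) k) = snd (section_col i J y k)"
    and "k \<le> r \<Longrightarrow> fst (ucol r (section_op r i J y) (section_vec r i J y) k) = fst (section_col i J y k)"
  using assms by (auto simp: ucol_def section_vec_def section_op_def)

lemma normal_coords_section:
  assumes P: "pivot r i J" and y: "\<And>l. l \<ge> 2 * (i + J - 3) \<Longrightarrow> y l = 0"
  shows "normal_coords r i J (section_op r i J y) (section_vec r i J y) = y"
proof
  fix l
  have entry: "normal_entry r i (section_op r i J y) (section_vec r i J y) m = normal_complex y m"
    if m: "m < i + J - 3" for m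
  proof -
    consider "m < i - 1" | "i - 1 \<le> m" "m < 2 * (i - 1)" | "2 * (i - 1) \<le> m" by linarith
    then show ?thesis
    proof cases
      case 1
      then have "m + 1 < i" "m + 1 \<le> r" using P by (auto simp: pivot_def)
      then show ?thesis using 1 ucol_section(2)[OF P, of "m + 1" y]
        by (simp add: normal_entry_def section_col_def)
    next
      case 2
      then have "m - (i - 1) + 1 < i" "i - 1 + (m - (i - 1) + 1 - 1) = m" by auto
      then show ?thesis using 2 ucol_section(1)[OF P, of "m - (i - 1) + 1" y]
        by (simp add: normal_entry_def section_col_def)
    next
      case 3
      then have "i < m - (i - 1) + 2" "m - (i - 1) + 2 < J" "i - 1 + (m - (i - 1) + 2 - 2) = m"
        using m P by (auto simp: pivot_def)
      moreover have "normal_entry r i (section_op r i J y) (section_vec r i J y) m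
          = snd (section_col i J y (m - (i - 1) + 2))"
        using 3 ucol_section(1)[OF P, of "m - (i - 1) + 2" y] P by (auto simp: normal_entry_def pivot_def)
      ultimately show ?thesis by (simp add: section_col_def)
    qed
  qed
  show "normal_coords r i J (section_op r i J y) (section_vec r i J y) l = y l"
  proof (cases "l < 2 * (i + J - 3)")
    case True
    then have "l div 2 < i + J - 3" by auto
    then show ?thesis using True entry[of "l div 2"]
      by (auto simp: normal_coords_def normal_complex_def elim: oddE)
  next
    case False
    then show ?thesis using y[of l] by (simp add: normal_coords_def)
  qed
qed

lemma normal_complex_coords:
  "m < i + J - 3 \<Longrightarrow> normal_complex (normal_coords r i J X v) m = normal_entry r i X v m"
  by (auto simp: normal_complex_def normal_coords_def complex_eq_iff)

lemma section_col_normal_coords: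
  assumes P: "pivot r i J" and k: "1 \<le> k"
  shows "k < i \<Longrightarrow> fst (section_col i J (normal_coords r i J X v) k) = fst (ucol r X v k)"
    and "k < i \<Longrightarrow> snd (section_col i J (normal_coords r i J X v) k) = snd (ucol r X v k)"
    and "i < k \<Longrightarrow> k < J \<Longrightarrow> snd (section_col i J (normal_coords r i J X v) k) = snd (ucol r X v k)"
proof -
  have J: "i < J" "1 \<le> i" using P by (auto simp: pivot_def)
  {
    assume ki: "k < i"
    have "k - 1 < i + J - 3" "k - 1 < i - 1" "k - 1 + 1 = k" using ki k J by auto
    then show "fst (section_col i J (normal_coords r i J X v) k) = fst (ucol r X v k)"
      using ki by (simp add: section_col_def normal_complex_coords normal_entry_def)
    let ?m = "i - 1 + (k - 1)"
    have "?m < i + J - 3" "\<not> ?m < i - 1" "?m < 2 * (i - 1)" "?m - (i - 1) + 1 = k" using ki k J by auto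
    then have "normal_complex (normal_coords r i J X v) ?m = snd (ucol r X v k)"
      by (simp only: normal_complex_coords normal_entry_def if_True if_False)
    then show "snd (section_col i J (normal_coords r i J X v) k) = snd (ucol r X v k)"
      using ki by (simp add: section_col_def)
  }
  {
    assume ki: "i < k" "k < J"
    let ?m = "i - 1 + (k - 2)"
    have "?m < i + J - 3" "\<not> ?m < i - 1" "\<not> ?m < 2 * (i - 1)" "?m - (i - 1) + 2 = k" using ki k J by auto
    then have "normal_complex (normal_coords r i J X v) ?m = snd (ucol r X v k)"
      by (simp only: normal_complex_coords normal_entry_def if_True if_False)
    then show "snd (section_col i J (normal_coords r i J X v) k) = snd (ucol r X v k)"
      using ki by (simp add: section_col_def)
  }
qed

text \<open>At parameter 0 only the pivots and the transverse coordinates are left, so the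
  contraction ends on the section.\<close>

lemma scale_zero:
  assumes P: "pivot r i J" and S: "supported n r X v" and sl: "slice r i J X v"
  shows "scale_op r J 0 X = section_op r i J (normal_coords r i J X v)"
    and "scale_vec i J 0 v = section_vec r i J (normal_coords r i J X v)"
proof -
  have vi: "v i = (1, 0)" and piv: "1 \<le> i" "i \<le> r" "i < J" using sl P by (auto simp: slice_def pivot_def)
  note col = section_col_normal_coords[OF P]
  show "scale_vec i J 0 v = section_vec r i J (normal_coords r i J X v)"
  proof
    fix k
    show "scale_vec i J 0 v k = section_vec r i J (normal_coords r i J X v) k"
    proof (cases "k \<in> {1..r}")
      case False
      then have "v k = 0" using S unfolding supported_def by blast
      then show ?thesis unfolding section_vec_def if_not_P[OF False] by (simp add: scale_vec_def prod_eq_iff)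
    next
      case True
      then have k: "1 \<le> k" "k \<le> r" by auto
      have u: "ucol r X v k = v k" using k by (simp add: ucol_def)
      have sec: "section_vec r i J (normal_coords r i J X v) k = section_col i J (normal_coords r i J X v) k"
        using True by (simp add: section_vec_def)
      consider "k < i" | "k = i" | "i < k" "k < J" | "k = J" | "J < k" using piv by linarith
      then show ?thesis
      proof cases
        case 1
        then show ?thesis using col(1,2)[OF k(1) 1, of X v] piv
          by (intro prod_eqI) (simp_all add: sec u scale_vec_def)
      next
        case 2
        then show ?thesis using vi piv unfolding sec by (simp add: scale_vec_def section_col_def)
      next
        case 3
        then show ?thesis using col(3)[OF k(1) 3, of X v]
          by (intro prod_eqI) (simp_all add: sec u scale_vec_def, simp add: section_col_def)
      next
        case 4
        then have "v k = (0, 1)" using sl k by (simp add: slice_def)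
        then show ?thesis using 4 piv unfolding sec by (simp add: scale_vec_def section_col_def)
      next
        case 5
        then show ?thesis using piv unfolding sec by (simp add: scale_vec_def section_col_def)
      qed
    qed
  qed
  show "scale_op r J 0 X = section_op r i J (normal_coords r i J X v)"
  proof
    fix b
    show "scale_op r J 0 X b = section_op r i J (normal_coords r i J X v) b"
    proof (cases "b = 0")
      case True
      have "b \<notin> {1..n}" using True by simp
      then have "X b = 0" using S unfolding supported_def by blast
      then show ?thesis using True by (simp add: scale_op_def section_op_def prod_eq_iff Let_def)
    next
      case b: False
      then have k: "1 \<le> r + b" "i < r + b" "r < r + b" using piv by auto
      have u: "ucol r X v (r + b) = fst (X b)" using b by (simp add: ucol_def)
      have sec: "section_op r i J (normal_coords r i J X v) b
          = ((0, snd (section_col i J (normal_coords r i J X v) (r + b))), 0)"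
        using b by (simp add: section_op_def)
      show ?thesis
      proof (cases "J \<le> r")
        case True
        then have "snd (section_col i J (normal_coords r i J X v) (r + b)) = 0"
          using k by (simp add: section_col_def)
        then show ?thesis using True by (simp add: sec scale_op_def prod_eq_iff)
      next
        case False
        have "snd (section_col i J (normal_coords r i J X v) (r + b))
            = complex_of_real (if r + b \<le> J then 1 else 0) * snd (fst (X b))"
        proof -
          consider "r + b < J" | "r + b = J" | "J < r + b" by linarith
          then show ?thesis
          proof cases
            case 1
            then show ?thesis using col(3)[OF k(1,2) 1, of X v] u by simp
          next
            case 2
            then have "b = J - r" by simp
            then have "fst (X b) = (0, 1)" using sl False by (simp add: slice_def)
            then show ?thesis using 2 k by (simp add: section_col_def)
          next
            case 3
            then show ?thesis using k by (simp add: section_col_def)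
          qed
        qed
        then show ?thesis
          by (intro prod_eqI) (simp_all add: sec scale_op_second[OF False])
      qed
    qed
  qed
qed

text \<open>Only entries to the left of the pivots enter, and these are fixed by scaling. This makes
  the contraction a homotopy of pairs.\<close>

lemma normal_coords_scale:
  assumes P: "pivot r i J"
  shows "normal_coords r i J (scale_op r J \<tau> X) (scale_vec i J \<tau> v) = normal_coords r i J X v"
proof -
  have fst: "fst (ucol r (scale_op r J \<tau> X) (scale_vec i J \<tau> v) k) = fst (ucol r X v k)" if "k < i" for k
    using that P by (simp add: ucol_def scale_vec_def pivot_def)
  have snd: "snd (ucol r (scale_op r J \<tau> X) (scale_vec i J \<tau> v) k) = snd (ucol r X v k)" if "k < J" for k
  proof (cases "k \<le> r")
    case True
    then show ?thesis using that by (simp add: ucol_def scale_vec_def)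
  next
    case False
    then have "\<not> J \<le> r" "r + (k - r) \<le> J" using that by auto
    then show ?thesis using False by (simp add: ucol_def scale_op_second)
  qed
  have "normal_entry r i (scale_op r J \<tau> X) (scale_vec i J \<tau> v) m = normal_entry r i X v m"
    if m: "m < i + J - 3" for m
  proof -
    have J: "i < J" "1 \<le> i" using P by (auto simp: pivot_def)
    consider "m < i - 1" | "i - 1 \<le> m" "m < 2 * (i - 1)" | "2 * (i - 1) \<le> m" by linarith
    then show ?thesis
    proof cases
      case 1
      then show ?thesis using fst[of "m + 1"] by (simp add: normal_entry_def)
    next
      case 2
      then have "m - (i - 1) + 1 < J" using J by auto
      then show ?thesis using 2 snd[of "m - (i - 1) + 1"] by (simp add: normal_entry_def)
    next
      case 3
      then have "m - (i - 1) + 2 < J" using m J by auto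
      moreover have "\<not> m < i - 1" "\<not> m < 2 * (i - 1)" using 3 by auto
      ultimately show ?thesis using snd[of "m - (i - 1) + 2"] by (simp add: normal_entry_def)
    qed
  qed
  then show ?thesis by (intro ext) (simp add: normal_coords_def)
qed

section \<open>The order of the pivot pairs\<close>

text \<open>The pair (i + J, i) written in base \<open>r + 1\<close>, where \<open>i \<le> r\<close>
  is a legitimate digit. Numerical order is lexicographic order, and division by
  \<open>r + 1\<close> returns the sum.\<close>

definition pivot_rank :: "nat \<Rightarrow> nat \<Rightarrow> nat \<Rightarrow> nat" where
  "pivot_rank r i J = (i + J) * (r + 1) + i"

lemma pivot_rank_mono:
  assumes "pivot r i J" "pivot r i' J'"
  shows "i' + J' < i + J \<Longrightarrow> pivot_rank r i' J' < pivot_rank r i J"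
    and "i \<le> i' \<Longrightarrow> J \<le> J' \<Longrightarrow> pivot_rank r i J \<le> pivot_rank r i' J'"
proof -
  assume "i' + J' < i + J"
  then have "(i' + J' + 1) * (r + 1) \<le> (i + J) * (r + 1)" by (intro mult_right_mono) auto
  moreover have "(i' + J' + 1) * (r + 1) = (i' + J') * (r + 1) + (r + 1)" by (simp add: algebra_simps)
  moreover have "i' < r + 1" using assms by (simp add: pivot_def)
  ultimately show "pivot_rank r i' J' < pivot_rank r i J" unfolding pivot_rank_def by linarith
next
  assume "i \<le> i'" "J \<le> J'"
  then show "pivot_rank r i J \<le> pivot_rank r i' J'"
    unfolding pivot_rank_def by (intro add_mono mult_right_mono) auto
qed

lemma pivot_rank_inj:
  assumes P: "pivot r i J" "pivot r i' J'" and eq: "pivot_rank r i J = pivot_rank r i' J'"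
  shows "i = i' \<and> J = J'"
proof -
  have lt: "i < r + 1" "i' < r + 1" using P by (auto simp: pivot_def)
  have "pivot_rank r i J mod (r + 1) = i" "pivot_rank r i' J' mod (r + 1) = i'"
    using lt by (simp_all add: pivot_rank_def)
  then have i: "i = i'" using eq by simp
  then have "(i + J) * (r + 1) = (i + J') * (r + 1)" using eq by (simp add: pivot_rank_def)
  then show ?thesis using i by simp
qed

text \<open>A nonzero transverse entry yields a nonzero determinant for a pair of smaller sum. If
  all of them vanish, the columns before \<open>i\<close> are 0 and those before \<open>J\<close>
  have second entry 0, so a nonzero determinant forces \<open>i \<le> i'\<close> and
  \<open>J \<le> J'\<close>, and the rank cannot be smaller.\<close>

lemma smaller_pivot_iff:
  assumes P: "pivot r i J" and S: "supported n r X v" and sl: "slice r i J X v"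
  shows "(\<exists>i' J'. pivot r i' J' \<and> pivot_rank r i' J' < pivot_rank r i J \<and> piv_det r i' J' X v \<noteq> 0)
     \<longleftrightarrow> normal_coords r i J X v \<noteq> (\<lambda>_. 0)"
proof -
  have piv: "1 \<le> i" "i \<le> r" "i < J" using P by (auto simp: pivot_def)
  have vi: "v i = (1, 0)" using sl by (simp add: slice_def)
  define bad where "bad \<longleftrightarrow> (\<exists>k. 1 \<le> k \<and> k < i \<and> v k \<noteq> 0) \<or> (\<exists>k. i < k \<and> k < J \<and> snd (ucol r X v k) \<noteq> 0)"
  have zero_iff: "normal_coords r i J X v \<noteq> (\<lambda>_. 0) \<longleftrightarrow> bad"
  proof
    assume "bad"
    show "normal_coords r i J X v \<noteq> (\<lambda>_. 0)"
    proof
      assume z: "normal_coords r i J X v = (\<lambda>_. 0)"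
      have nz: "normal_complex (\<lambda>_. 0) m = 0" for m by (simp add: normal_complex_def complex_eq_iff)
      note col = section_col_normal_coords[OF P, of _ X v, unfolded z]
      from \<open>bad\<close> consider k where "1 \<le> k" "k < i" "v k \<noteq> 0" | k where "i < k" "k < J" "snd (ucol r X v k) \<noteq> 0"
        unfolding bad_def by blast
      then show False
      proof cases
        case 1
        then have "ucol r X v k = v k" using piv by (simp add: ucol_def)
        then show False using col(1,2)[OF 1(1,2)] 1 by (simp add: section_col_def nz prod_eq_iff)
      next
        case 2
        then have "1 \<le> k" by simp
        then show False using col(3)[OF _ 2(1,2)] 2 by (simp add: section_col_def nz)
      qed
    qed
  next
    assume nz: "normal_coords r i J X v \<noteq> (\<lambda>_. 0)"
    show "bad"
    proof (rule ccontr)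
      assume nb: "\<not> bad"
      have v0: "v k = 0" if "1 \<le> k" "k < i" for k using nb that unfolding bad_def by blast
      have u0: "snd (ucol r X v k) = 0" if "1 \<le> k" "k < J" for k
      proof -
        consider "k < i" | "k = i" | "i < k" by linarith
        then show ?thesis
        proof cases
          case 1
          then show ?thesis using v0[OF that(1) 1] piv by (simp add: ucol_def)
        next
          case 2
          then show ?thesis using vi piv by (simp add: ucol_def)
        next
          case 3
          then show ?thesis using nb that unfolding bad_def by blast
        qed
      qed
      have "normal_entry r i X v m = 0" if m: "m < i + J - 3" for m
      proof -
        consider "m < i - 1" | "i - 1 \<le> m" "m < 2 * (i - 1)" | "2 * (i - 1) \<le> m" by linarith
        then show ?thesis
        proof cases
          case 1
          then show ?thesis using v0[of "m + 1"] piv by (simp add: normal_entry_def ucol_def)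
        next
          case 2
          then have "m - (i - 1) + 1 < J" using piv by auto
          then show ?thesis using 2 u0[of "m - (i - 1) + 1"] by (simp add: normal_entry_def)
        next
          case 3
          then have "m - (i - 1) + 2 < J" using m piv by auto
          moreover have "\<not> m < i - 1" "\<not> m < 2 * (i - 1)" using 3 by auto
          ultimately show ?thesis using u0[of "m - (i - 1) + 2"] by (simp add: normal_entry_def)
        qed
      qed
      then have "normal_coords r i J X v = (\<lambda>_. 0)" by (intro ext) (auto simp: normal_coords_def)
      then show False using nz by simp
    qed
  qed
  have ex: "\<exists>i' J'. pivot r i' J' \<and> i' + J' < i + J \<and> piv_det r i' J' X v \<noteq> 0" if "bad"
  proof -
    from that consider k where "1 \<le> k" "k < i" "v k \<noteq> 0" | k where "i < k" "k < J" "snd (ucol r X v k) \<noteq> 0"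
      unfolding bad_def by blast
    then show ?thesis
    proof cases
      case 1
      show ?thesis
      \<comment> \<open>If the second entry of \<open>v k\<close> is nonzero, \<open>v k\<close> is
        independent of \<open>v i = (1, 0)\<close>, which gives the pair (k, i). Otherwise
        \<open>v k\<close> is a nonzero multiple of \<open>v i\<close> and can replace it as first
        pivot, which gives the pair (k, J).\<close>
      proof (cases "snd (v k) = 0")
        case False
        have "pivot r k i" "k + i < i + J" "piv_det r k i X v \<noteq> 0"
          using 1 piv False vi by (auto simp: pivot_def piv_det_def cdet_def)
        then show ?thesis by blast
      next
        case True
        then have f: "fst (v k) \<noteq> 0" using 1 by (auto simp: prod_eq_iff)
        have "piv_det r k J X v \<noteq> 0"
          using sl True f by (auto simp: piv_det_def slice_def cdet_def)
        moreover have "pivot r k J" "k + J < i + J" using 1 piv by (auto simp: pivot_def)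
        ultimately show ?thesis by blast
      qed
    next
      case 2
      have "piv_det r i k X v \<noteq> 0"
        using 2 vi by (auto simp: piv_det_def cdet_def ucol_def app_unit split: if_splits)
      moreover have "pivot r i k" "i + k < i + J" using 2 piv by (auto simp: pivot_def)
      ultimately show ?thesis by blast
    qed
  qed
  have conv: "i \<le> i' \<and> J \<le> J'" if nb: "\<not> bad" and Q: "pivot r i' J'" "piv_det r i' J' X v \<noteq> 0" for i' J'
  proof -
    have Q': "1 \<le> i'" "i' \<le> r" "i' < J'" using Q by (auto simp: pivot_def)
    have v0: "v k = 0" if "1 \<le> k" "k < i" for k using nb that unfolding bad_def by blast
    have u0: "snd (ucol r X v k) = 0" if "i \<le> k" "k < J" for k
      using nb that vi piv unfolding bad_def by (cases "k = i") (auto simp: ucol_def)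
    have ii: "i \<le> i'"
    proof (rule ccontr)
      assume "\<not> i \<le> i'"
      then have "v i' = 0" using v0 Q' by simp
      then show False using Q(2) by (simp add: piv_det_def cdet_def)
    qed
    moreover have "J \<le> J'"
    proof (rule ccontr)
      assume "\<not> J \<le> J'"
      then have s: "snd (ucol r X v i') = 0" "snd (ucol r X v J') = 0" using u0 ii Q' by auto
      then show False using Q(2) Q' by (auto simp: piv_det_def cdet_def ucol_def split: if_splits)
    qed
    ultimately show ?thesis by blast
  qed
  show ?thesis
  proof
    assume "\<exists>i' J'. pivot r i' J' \<and> pivot_rank r i' J' < pivot_rank r i J \<and> piv_det r i' J' X v \<noteq> 0"
    then obtain i' J' where Q: "pivot r i' J'" "pivot_rank r i' J' < pivot_rank r i J" "piv_det r i' J' X v \<noteq> 0"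
      by blast
    show "normal_coords r i J X v \<noteq> (\<lambda>_. 0)"
      unfolding zero_iff using conv[OF _ Q(1,3)] pivot_rank_mono(2)[OF P Q(1)] Q(2) by force
  next
    assume "normal_coords r i J X v \<noteq> (\<lambda>_. 0)"
    then show "\<exists>i' J'. pivot r i' J' \<and> pivot_rank r i' J' < pivot_rank r i J \<and> piv_det r i' J' X v \<noteq> 0"
      using ex pivot_rank_mono(1)[OF P] unfolding zero_iff by blast
  qed
qed

subsection \<open>Continuity of the coordinates\<close>

lemma continuous_map_scale:
  assumes \<tau>: "continuous_map T euclideanreal \<tau>" and X: "\<And>b. continuous_map T euclidean (\<lambda>t. X t b)"
    and v: "\<And>k. continuous_map T euclidean (\<lambda>t. v t k)"
  shows "continuous_map T euclidean (\<lambda>t. scale_op r J (\<tau> t) (X t) b)"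
    and "continuous_map T euclidean (\<lambda>t. scale_vec i J (\<tau> t) (v t) k)"
proof -
  have if\<tau>: "continuous_map T euclideanreal (\<lambda>t. if P then 1 else \<tau> t)" for P
    using \<tau> by (cases P) simp_all
  show "continuous_map T euclidean (\<lambda>t. scale_vec i J (\<tau> t) (v t) k)"
    unfolding scale_vec_def by (intro continuous_map_euclidean_intros if\<tau> v)
  show "continuous_map T euclidean (\<lambda>t. scale_op r J (\<tau> t) (X t) b)"
  proof (cases "J \<le> r")
    case True
    show ?thesis unfolding scale_op_def if_P[OF True]
      by (intro continuous_map_euclidean_intros continuous_map_csc \<tau> X)
  next
    case False
    show ?thesis unfolding scale_op_def if_not_P[OF False] Let_def
      by (intro continuous_map_euclidean_intros if\<tau> \<tau> X)
  qed
qed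

lemma continuous_map_Re_Im:
  "continuous_map T euclidean f \<Longrightarrow> continuous_map T euclideanreal (\<lambda>t. Re (f t))"
  "continuous_map T euclidean f \<Longrightarrow> continuous_map T euclideanreal (\<lambda>t. Im (f t))"
  by (simp_all add: continuous_map_tendsto tendsto_Re tendsto_Im)

lemma continuous_map_normal_coords:
  assumes X: "\<And>b. continuous_map T euclidean (\<lambda>t. X t b)" and v: "\<And>k. continuous_map T euclidean (\<lambda>t. v t k)"
  shows "continuous_map T (Euclidean_space (2 * (i + J - 3))) (\<lambda>t. normal_coords r i J (X t) (v t))"
proof (rule continuous_map_Euclidean_spaceI)
  have u: "continuous_map T euclidean (\<lambda>t. ucol r (X t) (v t) k)" for k
    by (cases "k \<le> r") (simp_all add: ucol_def X v continuous_map_fst_euclidean)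
  have e: "continuous_map T euclidean (\<lambda>t. normal_entry r i (X t) (v t) m)" for m
  proof -
    consider "m < i - 1" | "\<not> m < i - 1" "m < 2 * (i - 1)" | "\<not> m < i - 1" "\<not> m < 2 * (i - 1)" by linarith
    then show ?thesis unfolding normal_entry_def
      by cases (simp_all only: if_True if_False continuous_map_fst_euclidean[OF u] continuous_map_snd_euclidean[OF u])
  qed
  fix l
  show "continuous_map T euclideanreal (\<lambda>t. normal_coords r i J (X t) (v t) l)"
    unfolding normal_coords_def
    by (cases "l < 2 * (i + J - 3)"; cases "even l") (simp_all add: continuous_map_Re_Im e)
qed (simp add: normal_coords_def)

lemma continuous_map_section:
  assumes y: "\<And>l. continuous_map T euclideanreal (\<lambda>t. y t l)"
  shows "continuous_map T euclidean (\<lambda>t. section_op r i J (y t) b)"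
    and "continuous_map T euclidean (\<lambda>t. section_vec r i J (y t) k)"
proof -
  have z: "continuous_map T euclidean (\<lambda>t. normal_complex (y t) m)" for m
  proof -
    have "normal_complex (y t) m = complex_of_real (y t (2 * m)) + \<i> * complex_of_real (y t (2 * m + 1))" for t
      by (simp add: normal_complex_def complex_eq_iff)
    then show ?thesis by (simp only:) (intro continuous_map_euclidean_intros y)
  qed
  have if_cont: "continuous_map T euclidean (\<lambda>t. if P then f t else g t)"
    if "continuous_map T euclidean f" "continuous_map T euclidean g" for P and f g :: "'a \<Rightarrow> complex"
    using that by simp
  have c: "continuous_map T euclidean (\<lambda>t. section_col i J (y t) k)" for k
    unfolding section_col_def by (intro continuous_map_Pair_euclidean if_cont z continuous_map_const_euclidean)
  show "continuous_map T euclidean (\<lambda>t. section_vec r i J (y t) k)"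
    by (cases "k \<in> {1..r}") (simp_all only: section_vec_def if_True if_False c continuous_map_const_euclidean)
  show "continuous_map T euclidean (\<lambda>t. section_op r i J (y t) b)"
    by (cases "b = 0") (simp_all only: section_op_def simp_thms if_True if_False continuous_map_const_euclidean
        continuous_map_Pair_euclidean continuous_map_snd_euclidean c)
qed

section \<open>The charts of the colimit\<close>

lemma colimit_class_invariant:
  assumes "\<And>u v. colimit_step X f u v \<Longrightarrow> F u = F v" and "colimit_class X f u = colimit_class X f v"
  shows "F u = F v"
proof -
  have "v \<in> colimit_class X f v" by (simp add: colimit_class_def)
  then have "equivclp (colimit_step X f) u v" using assms(2) unfolding colimit_class_def by blast
  then show ?thesis
    by (induction rule: equivclp_induct) (use assms(1) in \<open>auto dest: sym\<close>)
qed

lemma colimit_class_step: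
  assumes "colimit_step X f u v"
  shows "colimit_class X f u = colimit_class X f v"
proof -
  have "equivclp (colimit_step X f) u v" using assms by (rule r_into_equivclp)
  then show ?thesis unfolding colimit_class_def
    using equivclp_sym[of "colimit_step X f"] equivclp_trans[of "colimit_step X f"] by blast
qed

lemma continuous_map_sum_topologyI:
  assumes "\<And>n. n \<in> I \<Longrightarrow> continuous_map (Y n) Z (\<lambda>x. F (n, x))"
  shows "continuous_map (sum_topology Y I) Z F"
  unfolding continuous_map
proof (intro conjI allI impI)
  show "F ` topspace (sum_topology Y I) \<subseteq> topspace Z"
    using assms by (auto simp: continuous_map_def Pi_iff)
  fix W assume W: "openin Z W"
  have "openin (Y n) {x. (n, x) \<in> {u \<in> topspace (sum_topology Y I). F u \<in> W}}" if n: "n \<in> I" for n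
  proof -
    have "{x. (n, x) \<in> {u \<in> topspace (sum_topology Y I). F u \<in> W}} = {x \<in> topspace (Y n). F (n, x) \<in> W}"
      using n by auto
    then show ?thesis using openin_continuous_map_preimage[OF assms[OF n] W] by simp
  qed
  then show "openin (sum_topology Y I) {u \<in> topspace (sum_topology Y I). F u \<in> W}"
    unfolding openin_sum_topology by auto
qed

text \<open>Products distribute over disjoint unions, so a homotopy on a disjoint union may be
  checked on each summand.\<close>

lemma continuous_map_prod_sum_topologyI:
  assumes "\<And>n. n \<in> I \<Longrightarrow> continuous_map (prod_topology T (Y n)) Z (\<lambda>z. F (fst z, (n, snd z)))"
  shows "continuous_map (prod_topology T (sum_topology Y I)) Z F"
  unfolding continuous_map
proof (intro conjI allI impI)
  let ?P = "prod_topology T (sum_topology Y I)"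
  show "F ` topspace ?P \<subseteq> topspace Z"
  proof
    fix y assume "y \<in> F ` topspace ?P"
    then obtain t n x where "t \<in> topspace T" "n \<in> I" "x \<in> topspace (Y n)" "y = F (t, (n, x))" by auto
    then show "y \<in> topspace Z"
      using continuous_map_image_subset_topspace[OF assms[of n]] by force
  qed
  fix W assume W: "openin Z W"
  show "openin ?P {z \<in> topspace ?P. F z \<in> W}"
    unfolding openin_prod_topology_alt
  proof (intro allI impI)
    fix t u assume z: "(t, u) \<in> {z \<in> topspace ?P. F z \<in> W}"
    obtain n x where u: "u = (n, x)" by force
    have n: "n \<in> I" and tx: "t \<in> topspace T" "x \<in> topspace (Y n)" "F (t, (n, x)) \<in> W" using z u by auto
    let ?A = "{z \<in> topspace (prod_topology T (Y n)). F (fst z, (n, snd z)) \<in> W}"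
    have op: "openin (prod_topology T (Y n)) ?A" by (rule openin_continuous_map_preimage[OF assms[OF n] W])
    have mem: "(t, x) \<in> ?A" using tx by simp
    from op[unfolded openin_prod_topology_alt, rule_format, OF mem]
    obtain A B where AB: "openin T A" "openin (Y n) B" "t \<in> A" "x \<in> B" "A \<times> B \<subseteq> ?A"
      by (elim exE conjE)
    have "openin (sum_topology Y I) (Pair n ` B)"
      using open_map_component_injection[OF n, of Y] AB(2) unfolding open_map_def by blast
    moreover have "A \<times> Pair n ` B \<subseteq> {z \<in> topspace ?P. F z \<in> W}"
    proof
      fix z assume "z \<in> A \<times> Pair n ` B"
      then obtain a b where z: "z = (a, (n, b))" and ab: "(a, b) \<in> A \<times> B" by auto
      have "(a, b) \<in> ?A" using AB(5) ab by blast
      then show "z \<in> {z \<in> topspace ?P. F z \<in> W}" using n by (simp add: z)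
    qed
    ultimately show "\<exists>A B. openin T A \<and> openin (sum_topology Y I) B \<and> t \<in> A \<and> u \<in> B \<and>
        A \<times> B \<subseteq> {z \<in> topspace ?P. F z \<in> W}"
      using AB(1,3,4) u by (intro exI[of _ A] exI[of _ "Pair n ` B"] conjI) simp_all
  qed
qed

abbreviation quot_class :: "nat \<Rightarrow> nat \<times> (nat \<Rightarrow>\<^sub>0 complex mpoly) set \<Rightarrow> (nat \<times> (nat \<Rightarrow>\<^sub>0 complex mpoly) set) set" where
  "quot_class r \<equiv> colimit_class (\<lambda>n. Quot2 n r) (Quot2_embed r)"

lemma supported_mono: "supported n r X v \<Longrightarrow> n \<le> m \<Longrightarrow> supported m r X v"
  unfolding supported_def by auto

text \<open>A normalised tuple names the same point of the colimit at every level where it is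
  supported, so points given at different levels can be compared at a common one.\<close>

lemma quot_class_ker_ev:
  assumes P: "pivot r i J" and S: "supported n r X v" and sl: "slice r i J X v" and nm: "n \<le> m"
  shows "quot_class r (n, ker_ev n r X v) = quot_class r (m, ker_ev m r X v)"
  using nm
proof (induction m rule: dec_induct)
  case (step m)
  have S': "supported m r X v" by (rule supported_mono[OF S step.hyps(1)])
  have "Suc m \<notin> {1..m}" by simp
  then have "X (Suc m) = 0" using S' unfolding supported_def by blast
  then have emb: "Quot2_embed r m (ker_ev m r X v) = ker_ev (Suc m) r X v" by (rule Quot2_embed_ker_ev)
  have "ker_ev m r X v \<in> Quot2_points m r"
    using coordinates_ker_ev(3)[OF P S' sl] by (simp add: chart_def)
  then have "colimit_step (\<lambda>n. Quot2 n r) (Quot2_embed r) (m, ker_ev m r X v) (Suc m, ker_ev (Suc m) r X v)"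
    by (simp add: colimit_step_def topspace_Quot2 emb)
  from colimit_class_step[OF this] step.IH show ?case by simp
qed simp

text \<open>Membership and coordinates are bundled into one option-valued function \<open>F\<close>.
  Its invariance then has to be checked only for a single step and not for the generated equivalence
  relation.\<close>

lemma chart_invariant:
  assumes P: "pivot r i J" and eq: "quot_class r (n, K) = quot_class r (m, L)"
  shows "K \<in> chart n r i J \<longleftrightarrow> L \<in> chart m r i J"
    and "K \<in> chart n r i J \<Longrightarrow> chart_op n r i J K = chart_op m r i J L \<and> chart_vec r i J K = chart_vec r i J L"
proof -
  define F where "F u = (if snd u \<in> chart (fst u) r i J
    then Some (chart_op (fst u) r i J (snd u), chart_vec r i J (snd u)) else None)" for u
  have "F u = F w" if step: "colimit_step (\<lambda>n. Quot2 n r) (Quot2_embed r) u w" for u w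
  proof -
    obtain n K where u: "u = (n, K)" by force
    have K: "K \<in> Quot2_points n r" and w: "w = (Suc n, Quot2_embed r n K)"
      using step by (auto simp: colimit_step_def topspace_Quot2 u)
    have emb: "Quot2_embed r n (ker_ev n r X v) = ker_ev (Suc n) r X v" "supported (Suc n) r X v"
      if S: "supported n r X v" for X v
    proof -
      have "Suc n \<notin> {1..n}" by simp
      then have "X (Suc n) = 0" using S unfolding supported_def by blast
      then show "Quot2_embed r n (ker_ev n r X v) = ker_ev (Suc n) r X v" by (rule Quot2_embed_ker_ev)
      show "supported (Suc n) r X v" by (rule supported_mono[OF S]) simp
    qed
    show ?thesis
    proof (cases "K \<in> chart n r i J")
      case True
      note d = chart_coordinates[OF P True]
      have e: "Quot2_embed r n K = ker_ev (Suc n) r (chart_op n r i J K) (chart_vec r i J K)"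
        using emb(1)[OF d(1)] d(3) by simp
      show ?thesis using coordinates_ker_ev[OF P emb(2)[OF d(1)] d(2)] True
        by (simp add: F_def u w flip: e)
    next
      case False
      obtain X v where S: "supported n r X v" and K: "K = ker_ev n r X v" using Quot2_points_cases[OF K] .
      have "Quot2_embed r n K \<notin> chart (Suc n) r i J"
        using False chart_iff[OF S P] chart_iff[OF emb(2)[OF S] P] emb(1)[OF S] K by simp
      then show ?thesis using False by (simp add: F_def u w)
    qed
  qed
  from colimit_class_invariant[of "\<lambda>n. Quot2 n r" "Quot2_embed r" F, OF this eq]
  have "F (n, K) = F (m, L)" .
  then show "K \<in> chart n r i J \<longleftrightarrow> L \<in> chart m r i J"
    "K \<in> chart n r i J \<Longrightarrow> chart_op n r i J K = chart_op m r i J L \<and> chart_vec r i J K = chart_vec r i J L"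
    by (auto simp: F_def split: if_splits)
qed

definition chart_infinity :: "nat \<Rightarrow> nat \<Rightarrow> nat \<Rightarrow> (nat \<times> (nat \<Rightarrow>\<^sub>0 complex mpoly) set) set set" where
  "chart_infinity r i J = quot_class r ` (SIGMA n:UNIV. chart n r i J)"

lemma chart_points: "K \<in> chart n r i J \<Longrightarrow> K \<in> Quot2_points n r"
  by (simp add: chart_def)

lemma topspace_Quot2_infinity: "topspace (Quot2_infinity r) = quot_class r ` (SIGMA n:UNIV. Quot2_points n r)"
  unfolding Quot2_infinity_def topspace_sequential_colimit by (simp add: topspace_Quot2 o_def)

lemma chart_infinity_iff:
  assumes "pivot r i J"
  shows "quot_class r (n, K) \<in> chart_infinity r i J \<longleftrightarrow> K \<in> chart n r i J"
proof
  assume "quot_class r (n, K) \<in> chart_infinity r i J"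
  then obtain m L where "L \<in> chart m r i J" "quot_class r (n, K) = quot_class r (m, L)"
    by (auto simp: chart_infinity_def)
  then show "K \<in> chart n r i J" using chart_invariant(1)[OF assms] by blast
qed (auto simp: chart_infinity_def)

lemma chart_infinity_preimage:
  assumes "pivot r i J"
  shows "{u \<in> topspace (sum_topology (\<lambda>n. Quot2 n r) UNIV). quot_class r u \<in> chart_infinity r i J}
    = (SIGMA n:UNIV. chart n r i J)"
  by (auto simp: chart_infinity_iff[OF assms] topspace_Quot2 dest: chart_points)

lemma openin_chart_infinity:
  assumes P: "pivot r i J"
  shows "openin (Quot2_infinity r) (chart_infinity r i J)"
  unfolding Quot2_infinity_def openin_sequential_colimit chart_infinity_preimage[OF P]
proof
  show "chart_infinity r i J \<subseteq> quot_class r ` topspace (sum_topology (\<lambda>n. Quot2 n r) UNIV)"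
    unfolding chart_infinity_def by (intro image_mono) (auto simp: topspace_Quot2 dest: chart_points)
  show "openin (sum_topology (\<lambda>n. Quot2 n r) UNIV) (SIGMA n:UNIV. chart n r i J)"
    unfolding openin_sum_topology using openin_chart
    by (auto simp: topspace_Quot2 dest: chart_points)
qed

text \<open>A quotient map restricts to a quotient map over an open set. Hence a continuous map on a
  chart of the colimit amounts to a compatible family on the charts of finite level.\<close>

lemma quotient_map_chart_infinity:
  assumes P: "pivot r i J"
  shows "quotient_map (sum_topology (\<lambda>n. subtopology (Quot2 n r) (chart n r i J)) UNIV)
    (subtopology (Quot2_infinity r) (chart_infinity r i J)) (quot_class r)"
proof -
  have "quotient_map (subtopology (sum_topology (\<lambda>n. Quot2 n r) UNIV) (SIGMA n:UNIV. chart n r i J))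
    (subtopology (Quot2_infinity r) (chart_infinity r i J)) (quot_class r)"
    by (rule quotient_map_restriction[OF _ chart_infinity_preimage[OF P]])
      (simp_all add: openin_chart_infinity[OF P] Quot2_infinity_def[symmetric]
        quotient_map_sequential_colimit[of "\<lambda>n. Quot2 n r" "Quot2_embed r", folded Quot2_infinity_def])
  then show ?thesis by (simp only: subtopology_sum_topology)
qed

lemma continuous_map_quot_class: "continuous_map (Quot2 n r) (Quot2_infinity r) (\<lambda>K. quot_class r (n, K))"
proof -
  have "continuous_map (sum_topology (\<lambda>n. Quot2 n r) UNIV) (Quot2_infinity r) (quot_class r)"
    unfolding Quot2_infinity_def by (rule quotient_imp_continuous_map[OF quotient_map_sequential_colimit])
  from continuous_map_compose[OF continuous_map_component_injection this, of n]
  show ?thesis by (simp add: o_def)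
qed

definition lower_charts :: "nat \<Rightarrow> nat \<Rightarrow> (nat \<times> (nat \<Rightarrow>\<^sub>0 complex mpoly) set) set set" where
  "lower_charts r k = (\<Union>(i, J)\<in>{(i, J). pivot r i J \<and> pivot_rank r i J < k}. chart_infinity r i J)"

lemma lower_charts_iff:
  "quot_class r (n, K) \<in> lower_charts r k \<longleftrightarrow> (\<exists>i J. pivot r i J \<and> pivot_rank r i J < k \<and> K \<in> chart n r i J)"
proof
  assume "quot_class r (n, K) \<in> lower_charts r k"
  then obtain i J where "pivot r i J" "pivot_rank r i J < k" "quot_class r (n, K) \<in> chart_infinity r i J"
    unfolding lower_charts_def by blast
  then show "\<exists>i J. pivot r i J \<and> pivot_rank r i J < k \<and> K \<in> chart n r i J"
    using chart_infinity_iff by blast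
next
  assume "\<exists>i J. pivot r i J \<and> pivot_rank r i J < k \<and> K \<in> chart n r i J"
  then obtain i J where "pivot r i J" "pivot_rank r i J < k" "K \<in> chart n r i J" by blast
  then show "quot_class r (n, K) \<in> lower_charts r k"
    unfolding lower_charts_def using chart_infinity_iff by blast
qed

text \<open>The transverse coordinates \<open>f\<close> and the section \<open>g\<close> are
  mutually inverse homotopy equivalences of pairs: on Euclidean space \<open>f\<close> after
  \<open>g\<close> is the identity, and the scaling homotopy \<open>H\<close> joins \<open>g\<close>
  after \<open>f\<close> to the identity. By \<open>T_iff\<close> the covered part of the chart is
  where \<open>f\<close> avoids the origin.\<close>

theorem relative_homology_chart_infinity:
  assumes P: "pivot r i J"
  shows "relative_homology_group p (subtopology (Quot2_infinity r) (chart_infinity r i J))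
      (chart_infinity r i J \<inter> lower_charts r (pivot_rank r i J))
    \<cong> free_Abelian_group (if p = int (2 * (i + J - 3)) then {s} else {})"
proof -
  let ?E = "Euclidean_space (2 * (i + J - 3))"
  let ?S = "topspace ?E - {\<lambda>_. 0}"
  let ?C = "chart_infinity r i J"
  let ?X = "subtopology (Quot2_infinity r) ?C"
  let ?T = "?C \<inter> lower_charts r (pivot_rank r i J)"
  let ?Y = "\<lambda>n. subtopology (Quot2 n r) (chart n r i J)"
  let ?\<Sigma> = "sum_topology ?Y UNIV"
  let ?I = "top_of_set {0..1::real}"
  have topX: "topspace ?X = ?C"
    using openin_subset[OF openin_chart_infinity[OF P]] by auto
  have topY: "topspace (?Y n) = chart n r i J" for n
    by (auto simp: topspace_Quot2 dest: chart_points)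
  have quot: "quotient_map ?\<Sigma> ?X (quot_class r)" by (rule quotient_map_chart_infinity[OF P])
  have cases_C: "\<exists>n K. K \<in> chart n r i J \<and> x = quot_class r (n, K)" if "x \<in> ?C" for x
    using that by (auto simp: chart_infinity_def)
  define h where "h u = normal_coords r i J (chart_op (fst u) r i J (snd u)) (chart_vec r i J (snd u))"
    for u :: "nat \<times> (nat \<Rightarrow>\<^sub>0 complex mpoly) set"
  have "continuous_map ?\<Sigma> ?E h"
    by (rule continuous_map_sum_topologyI)
      (simp add: h_def continuous_map_normal_coords continuous_map_chart_op[OF P] continuous_map_chart_vec)
  moreover have "h u = h u'" if "u \<in> topspace ?\<Sigma>" "u' \<in> topspace ?\<Sigma>" "quot_class r u = quot_class r u'" for u u'
  proof -
    obtain n K m L where u: "u = (n, K)" "u' = (m, L)" by force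
    then have "K \<in> chart n r i J" using that(1) by simp
    from chart_invariant(2)[OF P that(3)[unfolded u] this] show ?thesis by (simp add: h_def u)
  qed
  ultimately obtain f where f: "continuous_map ?X ?E f" and "f ` topspace ?X = h ` topspace ?\<Sigma>"
    and fq': "\<And>u. u \<in> topspace ?\<Sigma> \<Longrightarrow> f (quot_class r u) = h u"
    using quotient_map_lift_exists[OF quot] by blast
  have fq: "f (quot_class r (n, K)) = normal_coords r i J (chart_op n r i J K) (chart_vec r i J K)"
    if "K \<in> chart n r i J" for n K
    using fq'[of "(n, K)"] that topspace_Quot2[of n r] chart_points[OF that] by (simp add: h_def)
  have fq_data: "f (quot_class r (n, ker_ev n r X v)) = normal_coords r i J X v"
    if "supported n r X v" "slice r i J X v" for n X v
    using fq[OF coordinates_ker_ev(3)[OF P that]] coordinates_ker_ev(1,2)[OF P that] by simp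
  have T_iff: "x \<in> ?T \<longleftrightarrow> f x \<noteq> (\<lambda>_. 0)" if x: "x \<in> ?C" for x
  proof -
    obtain n K where K: "K \<in> chart n r i J" "x = quot_class r (n, K)" using cases_C[OF x] by blast
    note d = chart_coordinates[OF P K(1)]
    have "x \<in> ?T \<longleftrightarrow> (\<exists>i' J'. pivot r i' J' \<and> pivot_rank r i' J' < pivot_rank r i J \<and> K \<in> chart n r i' J')"
      using x unfolding K(2) by (simp add: lower_charts_iff)
    also have "\<dots> \<longleftrightarrow> (\<exists>i' J'. pivot r i' J' \<and> pivot_rank r i' J' < pivot_rank r i J \<and>
        piv_det r i' J' (chart_op n r i J K) (chart_vec r i J K) \<noteq> 0)"
      using chart_iff[OF d(1)] d(3) by auto
    also have "\<dots> \<longleftrightarrow> f x \<noteq> (\<lambda>_. 0)"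
      using smaller_pivot_iff[OF P d(1,2)] fq[OF K(1)] K(2) by simp
    finally show ?thesis .
  qed
  \<comment> \<open>Level \<open>J\<close> is large enough since \<open>J \<le> r + J\<close>, so a
    single finite level carries the whole section.\<close>
  define g where "g y = quot_class r (J, ker_ev J r (section_op r i J y) (section_vec r i J y))" for y
  have sec: "supported J r (section_op r i J y) (section_vec r i J y)"
    "slice r i J (section_op r i J y) (section_vec r i J y)" for y
    using supported_section[OF P] slice_section[OF P] by simp_all
  have gC: "g y \<in> ?C" for y
    unfolding g_def chart_infinity_iff[OF P] by (rule coordinates_ker_ev(3)[OF P sec])
  have g: "continuous_map ?E ?X g"
  proof -
    have "continuous_map ?E (Quot2 J r) (\<lambda>y. ker_ev J r (section_op r i J y) (section_vec r i J y))"
    proof (rule continuous_map_ker_ev)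
      show "continuous_map ?E euclidean (\<lambda>y. section_op r i J y b)" for b
        by (rule continuous_map_section) (rule continuous_map_Euclidean_space_coordinate)
      show "continuous_map ?E euclidean (\<lambda>y. section_vec r i J y k)" for k
        by (rule continuous_map_section) (rule continuous_map_Euclidean_space_coordinate)
      show "commuting (section_op r i J y)" for y using sec(1)[of y] by (simp add: supported_def)
      show "ker_ev J r (section_op r i J y) (section_vec r i J y) \<in> Quot2_points J r" for y
        using coordinates_ker_ev(3)[OF P sec] chart_points by blast
    qed
    from continuous_map_compose[OF this continuous_map_quot_class]
    have "continuous_map ?E (Quot2_infinity r) g" by (simp add: o_def g_def[abs_def])
    then show ?thesis using gC by (simp add: continuous_map_in_subtopology image_subset_iff)
  qed
  have fg: "f (g y) = y" if "y \<in> topspace ?E" for y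
  proof -
    have "f (g y) = normal_coords r i J (section_op r i J y) (section_vec r i J y)"
      unfolding g_def by (rule fq_data[OF sec])
    also have "\<dots> = y" using that by (intro normal_coords_section[OF P]) (auto simp: topspace_Euclidean_space)
    finally show ?thesis .
  qed
  define G where "G z = quot_class r (fst (snd z), ker_ev (fst (snd z)) r
      (scale_op r J (fst z) (chart_op (fst (snd z)) r i J (snd (snd z))))
      (scale_vec i J (fst z) (chart_vec r i J (snd (snd z)))))"
    for z :: "real \<times> nat \<times> (nat \<Rightarrow>\<^sub>0 complex mpoly) set"
  have scaled: "supported n r (scale_op r J \<tau> (chart_op n r i J K)) (scale_vec i J \<tau> (chart_vec r i J K))"
    "slice r i J (scale_op r J \<tau> (chart_op n r i J K)) (scale_vec i J \<tau> (chart_vec r i J K))"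
    if "K \<in> chart n r i J" for n K \<tau>
    using supported_scale[OF chart_coordinates(1)[OF P that]] slice_scale[OF P chart_coordinates(2)[OF P that]]
    by auto
  have GC: "G (\<tau>, (n, K)) \<in> ?C" if "K \<in> chart n r i J" for \<tau> n K
    unfolding G_def fst_conv snd_conv chart_infinity_iff[OF P] by (rule coordinates_ker_ev(3)[OF P scaled[OF that]])
  have Gcont: "continuous_map (prod_topology ?I ?\<Sigma>) ?X G"
  proof (rule continuous_map_prod_sum_topologyI)
    fix n
    let ?P = "prod_topology ?I (?Y n)"
    have chart_snd: "snd z \<in> chart n r i J" if "z \<in> topspace ?P" for z
      using that topY by (auto simp: topspace_prod_topology)
    have snd_cont: "continuous_map ?P euclidean (\<lambda>z. k (snd z))" if "continuous_map (?Y n) euclidean k"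
      for k :: "_ \<Rightarrow> 'z::topological_space"
      using continuous_map_compose[OF continuous_map_snd that] by (simp add: o_def)
    have fst_cont: "continuous_map ?P euclideanreal (\<lambda>z. fst z)"
      using continuous_map_real_fst[of "?Y n"] by simp
    have "continuous_map ?P (Quot2 n r) (\<lambda>z. ker_ev n r
        (scale_op r J (fst z) (chart_op n r i J (snd z))) (scale_vec i J (fst z) (chart_vec r i J (snd z))))"
    proof (rule continuous_map_ker_ev)
      show "continuous_map ?P euclidean (\<lambda>z. scale_op r J (fst z) (chart_op n r i J (snd z)) b)" for b
        by (rule continuous_map_scale(1)[OF fst_cont snd_cont[OF continuous_map_chart_op[OF P]]
              snd_cont[OF continuous_map_chart_vec]])
      show "continuous_map ?P euclidean (\<lambda>z. scale_vec i J (fst z) (chart_vec r i J (snd z)) k)" for k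
        by (rule continuous_map_scale(2)[OF fst_cont snd_cont[OF continuous_map_chart_op[OF P]]
              snd_cont[OF continuous_map_chart_vec]])
      fix z assume "z \<in> topspace ?P"
      note s = scaled[OF chart_snd[OF this], of "fst z"]
      show "commuting (scale_op r J (fst z) (chart_op n r i J (snd z)))" using s(1) by (simp add: supported_def)
      show "ker_ev n r (scale_op r J (fst z) (chart_op n r i J (snd z))) (scale_vec i J (fst z) (chart_vec r i J (snd z)))
          \<in> Quot2_points n r"
        using coordinates_ker_ev(3)[OF P s] chart_points by blast
    qed
    from continuous_map_compose[OF this continuous_map_quot_class]
    have "continuous_map ?P (Quot2_infinity r) (\<lambda>z. G (fst z, (n, snd z)))" by (simp add: o_def G_def)
    then show "continuous_map ?P ?X (\<lambda>z. G (fst z, (n, snd z)))"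
      using GC chart_snd by (simp add: continuous_map_in_subtopology image_subset_iff Pi_iff)
  qed
  \<comment> \<open>The homotopy \<open>G\<close> lives on the finite levels and has to descend. The
    interval is locally compact and Hausdorff, so the product with it preserves the quotient
    map.\<close>
  have quotI: "quotient_map (prod_topology ?I ?\<Sigma>) (prod_topology ?I ?X) (\<lambda>(t, u). (t, quot_class r u))"
  proof (rule quotient_map_prod_right[OF _ _ quot])
    have "compact_space ?I" by (simp add: compact_space_subtopology compactin_euclidean_iff)
    moreover have H: "Hausdorff_space ?I" by (simp add: Hausdorff_space_subtopology)
    ultimately show "locally_compact_space ?I" by (simp add: compact_imp_locally_compact_space)
    show "Hausdorff_space ?I \<or> regular_space ?I" using H by blast
  qed
  have Gwell: "G z = G z'" if z: "z \<in> topspace (prod_topology ?I ?\<Sigma>)" "z' \<in> topspace (prod_topology ?I ?\<Sigma>)"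
    and eq: "(\<lambda>(t, u). (t, quot_class r u)) z = (\<lambda>(t, u). (t, quot_class r u)) z'" for z z'
  proof -
    obtain t n K t' m L where zz: "z = (t, (n, K))" "z' = (t', (m, L))" by (metis surj_pair)
    have tt: "t = t'" and cl: "quot_class r (n, K) = quot_class r (m, L)" using eq by (auto simp: zz)
    have K: "K \<in> chart n r i J" and L: "L \<in> chart m r i J" using z by (auto simp: zz)
    note c = chart_invariant(2)[OF P cl K]
    let ?X' = "scale_op r J t (chart_op n r i J K)" and ?v' = "scale_vec i J t (chart_vec r i J K)"
    note sK = scaled[OF K, of t]
    have sL: "supported m r ?X' ?v'" using scaled(1)[OF L, of t] c by simp
    \<comment> \<open>Both representatives have the same coordinates and hence the same scaled
      tuple; the two levels are compared at the larger one.\<close>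
    have "quot_class r (n, ker_ev n r ?X' ?v') = quot_class r (max n m, ker_ev (max n m) r ?X' ?v')"
      by (rule quot_class_ker_ev[OF P sK]) simp
    also have "\<dots> = quot_class r (m, ker_ev m r ?X' ?v')"
      by (rule quot_class_ker_ev[OF P sL sK(2), symmetric]) simp
    finally show ?thesis using c by (simp add: G_def zz tt)
  qed
  obtain H where H: "continuous_map (prod_topology ?I ?X) ?X H"
    and HG': "\<And>z. z \<in> topspace (prod_topology ?I ?\<Sigma>) \<Longrightarrow> H ((\<lambda>(t, u). (t, quot_class r u)) z) = G z"
  proof (rule quotient_map_lift_exists[OF quotI Gcont Gwell])
    fix H assume "continuous_map (prod_topology ?I ?X) ?X H"
      and "\<And>z. z \<in> topspace (prod_topology ?I ?\<Sigma>) \<Longrightarrow> H ((\<lambda>(t, u). (t, quot_class r u)) z) = G z"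
    then show thesis by (rule that)
  qed
  have HG: "H (\<tau>, quot_class r (n, K)) = quot_class r (n, ker_ev n r
      (scale_op r J \<tau> (chart_op n r i J K)) (scale_vec i J \<tau> (chart_vec r i J K)))"
    if "\<tau> \<in> {0..1}" "K \<in> chart n r i J" for \<tau> n K
    using HG'[of "(\<tau>, (n, K))"] that topspace_Quot2[of n r] chart_points[OF that(2)] by (simp add: G_def)
  have Hf: "H (\<tau>, x) \<in> ?C \<and> f (H (\<tau>, x)) = f x" if \<tau>: "\<tau> \<in> {0..1}" and x: "x \<in> ?C" for \<tau> x
  proof -
    obtain n K where K: "K \<in> chart n r i J" "x = quot_class r (n, K)" using cases_C[OF x] by blast
    have "H (\<tau>, x) \<in> ?C"
      unfolding K(2) HG[OF \<tau> K(1)] chart_infinity_iff[OF P] by (rule coordinates_ker_ev(3)[OF P scaled[OF K(1)]])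
    moreover have "f (H (\<tau>, x)) = f x"
      unfolding K(2) HG[OF \<tau> K(1)] fq_data[OF scaled[OF K(1)]] fq[OF K(1)] by (rule normal_coords_scale[OF P])
    ultimately show ?thesis by blast
  qed
  have H0: "H (0, x) = g (f x)" if x: "x \<in> ?C" for x
  proof -
    obtain n K where K: "K \<in> chart n r i J" "x = quot_class r (n, K)" using cases_C[OF x] by blast
    note d = chart_coordinates[OF P K(1)]
    let ?y = "normal_coords r i J (chart_op n r i J K) (chart_vec r i J K)"
    let ?X' = "section_op r i J ?y" and ?v' = "section_vec r i J ?y"
    have "H (0, x) = quot_class r (n, ker_ev n r ?X' ?v')"
      unfolding K(2) using HG[OF _ K(1), of 0] scale_zero[OF P d(1,2)] by simp
    also have "\<dots> = quot_class r (max n J, ker_ev (max n J) r ?X' ?v')"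
      by (rule quot_class_ker_ev[OF P _ sec(2)])
        (use scaled(1)[OF K(1), of 0] scale_zero[OF P d(1,2)] in simp_all)
    also have "\<dots> = quot_class r (J, ker_ev J r ?X' ?v')"
      by (rule quot_class_ker_ev[OF P sec, symmetric]) simp
    also have "\<dots> = g (f x)" by (simp add: g_def K(2) fq[OF K(1)])
    finally show ?thesis .
  qed
  have H1: "H (1, x) = x" if x: "x \<in> ?C" for x
  proof -
    obtain n K where K: "K \<in> chart n r i J" "x = quot_class r (n, K)" using cases_C[OF x] by blast
    note d = chart_coordinates[OF P K(1)]
    show ?thesis unfolding K(2) using HG[OF _ K(1), of 1] scale_one[OF P d(1,2)] d(3) by simp
  qed
  have fT: "f \<in> ?T \<rightarrow> ?S"
    using T_iff continuous_map_image_subset_topspace[OF f] topX by auto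
  have gT: "g \<in> ?S \<rightarrow> ?T"
    using T_iff[OF gC] fg by auto
  have "relative_homology_group p ?X ?T \<cong> relative_homology_group p ?E ?S"
  proof (rule homotopy_equivalent_space_imp_isomorphic_relative_homology_groups[OF f fT g gT])
    show "homotopic_with (\<lambda>h. h \<in> ?T \<rightarrow> ?T) ?X ?X (g \<circ> f) id"
    proof (subst homotopic_with)
      fix h k :: "(nat \<times> (nat \<Rightarrow>\<^sub>0 complex mpoly) set) set \<Rightarrow> (nat \<times> (nat \<Rightarrow>\<^sub>0 complex mpoly) set) set"
      assume "\<And>x. x \<in> topspace ?X \<Longrightarrow> h x = k x"
      then have "h x = k x" if "x \<in> ?T" for x using that topX by blast
      then show "(h \<in> ?T \<rightarrow> ?T) = (k \<in> ?T \<rightarrow> ?T)" by (auto simp: Pi_iff)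
    next
      have "(\<lambda>x. H (t, x)) \<in> ?T \<rightarrow> ?T" if t: "t \<in> {0..1}" for t
      proof
        fix x assume x: "x \<in> ?T"
        then have xC: "x \<in> ?C" by blast
        from Hf[OF t xC] T_iff[OF xC] x T_iff[of "H (t, x)"] show "H (t, x) \<in> ?T" by simp
      qed
      then show "\<exists>h. continuous_map (prod_topology ?I ?X) ?X h \<and>
          (\<forall>x\<in>topspace ?X. h (0, x) = (g \<circ> f) x) \<and> (\<forall>x\<in>topspace ?X. h (1, x) = id x) \<and>
          (\<forall>t\<in>{0..1}. (\<lambda>x. h (t, x)) \<in> ?T \<rightarrow> ?T)"
        using H H0 H1 topX by (intro exI[of _ H]) simp
    qed
    show "homotopic_with (\<lambda>k. k \<in> ?S \<rightarrow> ?S) ?E ?E (f \<circ> g) id"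
    proof (rule homotopic_with_equal)
      show "continuous_map ?E ?E (f \<circ> g)" by (rule continuous_map_compose[OF g f])
      show "(f \<circ> g) \<in> ?S \<rightarrow> ?S" using fg by auto
    qed (use fg in auto)
  qed
  then show ?thesis by (rule iso_trans) (rule punctured_Euclidean_space_relative_homology)
qed

section \<open>The Hilbert series\<close>

lemma pivot_rank_div: "pivot r i J \<Longrightarrow> pivot_rank r i J div (r + 1) = i + J"
proof -
  assume "pivot r i J"
  then have "i div (r + 1) = 0" by (simp add: pivot_def)
  moreover have "((i + J) * (r + 1) + i) div (r + 1) = (i + J) + i div (r + 1)"
    by (rule div_mult_self3) simp
  ultimately show ?thesis unfolding pivot_rank_def by (simp only: add_0_right)
qed

text \<open>Charts are numbered by their rank \<open>k\<close>, and \<open>k div (r + 1) - 3\<close>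
  recovers i + J - 3, half the degree in which the chart contributes.\<close>

lemma homology_Quot2_infinity:
  "homology_group (int p) (Quot2_infinity r)
    \<cong> free_Abelian_group {k. (\<exists>i J. pivot r i J \<and> k = pivot_rank r i J) \<and> p = 2 * (k div (r + 1) - 3)}"
proof -
  let ?K = "{k. \<exists>i J. pivot r i J \<and> k = pivot_rank r i J}"
  let ?c = "\<lambda>k. k div (r + 1) - 3"
  have "homology_group (int p) (Quot2_infinity r) \<cong> free_Abelian_group {k \<in> ?K. p = 2 * ?c k}"
  proof (rule homology_filtered_space[where U = "lower_charts r"])
    show "openin (Quot2_infinity r) (lower_charts r k)" for k
      unfolding lower_charts_def using openin_chart_infinity by auto
    show "lower_charts r 0 = {}" by (simp add: lower_charts_def)
    show "(\<Union>k. lower_charts r k) = topspace (Quot2_infinity r)"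
    proof
      show "(\<Union>k. lower_charts r k) \<subseteq> topspace (Quot2_infinity r)"
      proof
        fix x assume "x \<in> (\<Union>k. lower_charts r k)"
        then obtain i J where P: "pivot r i J" and x: "x \<in> chart_infinity r i J"
          unfolding lower_charts_def by blast
        show "x \<in> topspace (Quot2_infinity r)"
          using openin_subset[OF openin_chart_infinity[OF P]] x by (rule subsetD)
      qed
      show "topspace (Quot2_infinity r) \<subseteq> (\<Union>k. lower_charts r k)"
      proof
        fix x assume "x \<in> topspace (Quot2_infinity r)"
        then obtain n K where K: "K \<in> Quot2_points n r" "x = quot_class r (n, K)"
          by (auto simp: topspace_Quot2_infinity)
        then obtain i J where "pivot r i J" "K \<in> chart n r i J" using chart_cover by blast
        then have "x \<in> lower_charts r (Suc (pivot_rank r i J))"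
          unfolding K(2) lower_charts_iff by blast
        then show "x \<in> (\<Union>k. lower_charts r k)" by blast
      qed
    qed
    show "lower_charts r (Suc k) = lower_charts r k" if "k \<notin> ?K" for k
    proof -
      have "{(i, J). pivot r i J \<and> pivot_rank r i J < Suc k} = {(i, J). pivot r i J \<and> pivot_rank r i J < k}"
        using that by (auto simp: less_Suc_eq)
      then show ?thesis by (simp add: lower_charts_def)
    qed
    show "\<exists>C. openin (Quot2_infinity r) C \<and> lower_charts r (Suc k) = lower_charts r k \<union> C \<and>
        (\<forall>p. relative_homology_group p (subtopology (Quot2_infinity r) C) (C \<inter> lower_charts r k)
               \<cong> free_Abelian_group (if p = int (2 * ?c k) then {k} else {}))" if kK: "k \<in> ?K" for k
    proof -
      obtain i J where P: "pivot r i J" and k: "k = pivot_rank r i J" using kK by blast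
      have inj: "a = i \<and> b = J" if "pivot r a b" "pivot_rank r a b = pivot_rank r i J" for a b
        by (rule pivot_rank_inj[OF that(1) P that(2)])
      have "{(i, J). pivot r i J \<and> pivot_rank r i J < Suc k}
          = {(i, J). pivot r i J \<and> pivot_rank r i J < k} \<union> {(i, J)}"
        using P by (auto simp: less_Suc_eq k dest: inj)
      then have "lower_charts r (Suc k) = lower_charts r k \<union> chart_infinity r i J"
        by (simp add: lower_charts_def Un_commute)
      moreover have "?c k = i + J - 3" using pivot_rank_div[OF P] by (simp add: k)
      ultimately show ?thesis
        using openin_chart_infinity[OF P] relative_homology_chart_infinity[OF P, where s = k]
        by (intro exI[of _ "chart_infinity r i J"]) (simp add: k)
    qed
    show "finite {k \<in> ?K. ?c k = m}" for m
    proof (rule finite_subset)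
      show "{k \<in> ?K. ?c k = m} \<subseteq> (\<lambda>(i, J). pivot_rank r i J) ` ({..m + 3} \<times> {..m + 3})"
      proof
        fix k assume k: "k \<in> {k \<in> ?K. ?c k = m}"
        then obtain i J where P: "pivot r i J" "k = pivot_rank r i J" by blast
        then have "i + J - 3 = m" using k pivot_rank_div[OF P(1)] by simp
        then have "(i, J) \<in> {..m + 3} \<times> {..m + 3}" by auto
        then show "k \<in> (\<lambda>(i, J). pivot_rank r i J) ` ({..m + 3} \<times> {..m + 3})" using P(2) by force
      qed
    qed simp
  qed
  then show ?thesis by (simp only: mem_Collect_eq)
qed

lemma bij_betw_weight_set:
  "bij_betw (\<lambda>(a, b). pivot_rank r (b + 1) (a + b + 2)) (weight_set r p)
    {k. (\<exists>i J. pivot r i J \<and> k = pivot_rank r i J) \<and> p = 2 * (k div (r + 1) - 3)}"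
proof -
  have piv: "pivot r (b + 1) (a + b + 2)" if "b < r" for a b using that by (simp add: pivot_def)
  show ?thesis unfolding bij_betw_def
  proof
    show "inj_on (\<lambda>(a, b). pivot_rank r (b + 1) (a + b + 2)) (weight_set r p)"
    proof (rule inj_onI, clarify)
      fix a b a' b' assume "(a, b) \<in> weight_set r p" "(a', b') \<in> weight_set r p"
        and eq: "pivot_rank r (b + 1) (a + b + 2) = pivot_rank r (b' + 1) (a' + b' + 2)"
      then have "b < r" "b' < r" by (auto simp: weight_set_def)
      from pivot_rank_inj[OF piv[OF this(1)] piv[OF this(2)] eq] show "a = a' \<and> b = b'" by auto
    qed
    show "(\<lambda>(a, b). pivot_rank r (b + 1) (a + b + 2)) ` weight_set r p
        = {k. (\<exists>i J. pivot r i J \<and> k = pivot_rank r i J) \<and> p = 2 * (k div (r + 1) - 3)}"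
    proof (intro Set.set_eqI iffI)
      fix k assume "k \<in> (\<lambda>(a, b). pivot_rank r (b + 1) (a + b + 2)) ` weight_set r p"
      then obtain a b where ab: "b < r" "2 * a + 4 * b = p" "k = pivot_rank r (b + 1) (a + b + 2)"
        by (auto simp: weight_set_def)
      have "k div (r + 1) = (b + 1) + (a + b + 2)" unfolding ab(3) by (rule pivot_rank_div[OF piv[OF ab(1)]])
      then have "p = 2 * (k div (r + 1) - 3)" using ab(2) by simp
      then show "k \<in> {k. (\<exists>i J. pivot r i J \<and> k = pivot_rank r i J) \<and> p = 2 * (k div (r + 1) - 3)}"
        using piv[OF ab(1)] ab(3) by blast
    next
      fix k assume "k \<in> {k. (\<exists>i J. pivot r i J \<and> k = pivot_rank r i J) \<and> p = 2 * (k div (r + 1) - 3)}"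
      then obtain i J where P: "pivot r i J" and k: "k = pivot_rank r i J" "p = 2 * (k div (r + 1) - 3)" by blast
      have iJ: "1 \<le> i" "i \<le> r" "i < J" using P by (auto simp: pivot_def)
      have p: "p = 2 * (i + J - 3)" using k pivot_rank_div[OF P] by simp
      have "(J - i - 1, i - 1) \<in> weight_set r p" using iJ p by (auto simp: weight_set_def)
      moreover have "k = (\<lambda>(a, b). pivot_rank r (b + 1) (a + b + 2)) (J - i - 1, i - 1)"
      proof -
        have "i - 1 + 1 = i" "J - i - 1 + (i - 1) + 2 = J" using iJ by auto
        then show ?thesis by (simp only: k(1) prod.case)
      qed
      ultimately show "k \<in> (\<lambda>(a, b). pivot_rank r (b + 1) (a + b + 2)) ` weight_set r p" by blast
    qed
  qed
qed

lemma abelian_rank_cohomology_Quot2_infinity: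
  "abelian_rank (cohomology_group p (Quot2_infinity r)) = enat (card (weight_set r p))"
proof -
  let ?S = "\<lambda>p. {k. (\<exists>i J. pivot r i J \<and> k = pivot_rank r i J) \<and> p = 2 * (k div (r + 1) - 3)}"
  have "abelian_rank (cohomology_group p (Quot2_infinity r)) = enat (card (?S p))"
    by (rule cohomology_rank_of_free_homology[OF homology_Quot2_infinity])
      (use bij_betw_finite[OF bij_betw_weight_set] finite_weight_set in blast)
  then show ?thesis using bij_betw_same_card[OF bij_betw_weight_set[of r p]] by simp
qed

text \<open>For fixed \<open>b\<close> the sum over \<open>a\<close> is t^(4 b) times the geometric
  series \<open>g\<close>, the inverse of 1 - t^2. The finite sum of t^(4 b) over
  \<open>b < r\<close> contributes (1 - t^(4 r)) / (1 - t^4).\<close>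

lemma weight_series:
  "Abs_fps (\<lambda>i. of_nat (card (weight_set r i))) =
     (1 - (fps_X ^ 2) ^ (2 * r)) / ((1 - (fps_X ^ 2) ^ 2) * (1 - fps_X ^ 2) :: rat fps)"
proof -
  define g :: "rat fps" where "g = Abs_fps (\<lambda>i. if even i then 1 else 0)"
  let ?A = "Abs_fps (\<lambda>i. of_nat (card (weight_set r i))) :: rat fps"
  have g: "g * (1 - fps_X ^ 2) = 1"
  proof (rule fps_ext)
    fix i
    have "fps_nth (g * (1 - fps_X ^ 2)) i = fps_nth g i - fps_nth (g * fps_X ^ 2) i"
      by (simp add: algebra_simps)
    also have "\<dots> = fps_nth (1 :: rat fps) i"
    proof -
      consider "i = 0" | "i = 1" | j where "i = Suc (Suc j)" by (metis One_nat_def not0_implies_Suc)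
      then show ?thesis by cases (simp_all add: g_def fps_X_power_mult_right_nth)
    qed
    finally show "fps_nth (g * (1 - fps_X ^ 2)) i = fps_nth 1 i" .
  qed
  have A: "?A = (\<Sum>b<r. g * fps_X ^ (4 * b))"
  proof (rule fps_ext)
    fix i
    let ?B = "{b. b < r \<and> 4 * b \<le> i \<and> even (i - 4 * b)}"
    have "bij_betw (\<lambda>(a, b). b) (weight_set r i) ?B"
      by (rule bij_betw_byWitness[where f' = "\<lambda>b. ((i - 4 * b) div 2, b)"])
        (auto simp: weight_set_def)
    then have "card (weight_set r i) = card ?B" by (rule bij_betw_same_card)
    moreover have "fps_nth (\<Sum>b<r. g * fps_X ^ (4 * b)) i = (\<Sum>b<r. if 4 * b \<le> i \<and> even (i - 4 * b) then 1 else 0)"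
      unfolding fps_sum_nth by (intro sum.cong) (auto simp: g_def fps_X_power_mult_right_nth)
    moreover have "(\<Sum>b<r. if 4 * b \<le> i \<and> even (i - 4 * b) then 1 else 0 :: rat) = of_nat (card ?B)"
      by (simp add: sum.If_cases Int_def lessThan_def conj_commute)
    ultimately show "fps_nth ?A i = fps_nth (\<Sum>b<r. g * fps_X ^ (4 * b)) i" by simp
  qed
  have "(\<Sum>b<r. g * fps_X ^ (4 * b)) = g * (\<Sum>b<r. (fps_X ^ 4) ^ b)"
    by (simp add: sum_distrib_left power_mult)
  then have "?A * ((1 - (fps_X ^ 2) ^ 2) * (1 - fps_X ^ 2))
      = (g * (1 - fps_X ^ 2)) * ((1 - fps_X ^ 4) * (\<Sum>b<r. (fps_X ^ 4) ^ b))"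
    unfolding A by (simp add: algebra_simps flip: power_mult)
  also have "(1 - fps_X ^ 4) * (\<Sum>b<r. (fps_X ^ 4) ^ b) = 1 - (fps_X ^ 4 :: rat fps) ^ r"
    by (rule one_diff_power_eq[symmetric])
  finally have "?A * ((1 - (fps_X ^ 2) ^ 2) * (1 - fps_X ^ 2)) = 1 - (fps_X ^ 2) ^ (2 * r)"
    unfolding g by (simp flip: power_mult)
  moreover have "(1 - (fps_X ^ 2) ^ 2) * (1 - fps_X ^ 2) \<noteq> (0 :: rat fps)"
  proof -
    have "fps_nth ((1 - (fps_X ^ 2) ^ 2) * (1 - fps_X ^ 2 :: rat fps)) 0 = 1"
      by (simp add: fps_mult_nth flip: power_mult)
    then show ?thesis by (metis fps_zero_nth zero_neq_one)
  qed
  ultimately show ?thesis by (metis nonzero_mult_div_cancel_right)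
qed

theorem mainTheorem10:
  fixes r :: nat and t q :: "rat fps"
  assumes "r \<ge> 1"
    and "t = fps_X" and "q = t ^ 2"
  shows "finite_type (\<lambda>i. cohomology_group i (Quot2_infinity r)) \<and>
    hilbert_series (\<lambda>i. cohomology_group i (Quot2_infinity r))
      = (1 - q ^ (2 * r)) / ((1 - q ^ 2) * (1 - q)) \<and>
    finite_type (truncated_ring_piece r) \<and>
    (1 - q ^ (2 * r)) / ((1 - q ^ 2) * (1 - q)) = hilbert_series (truncated_ring_piece r)"
  using weight_series[of r]
  by (simp add: assms finite_type_def hilbert_series_def abelian_rank_cohomology_Quot2_infinity
      abelian_rank_truncated_ring_piece)

end
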